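(* Consider a balanced generalized Pólya urn with replacement matrix $R=\begin{pmatrix} a & b \\ c & d \end{pmatrix}$, composition $U_n$ at time $n$, and $S=a+b=c+d$, $m=a-c=d-b$, $\sigma=m/S$, $v_1=\frac{S}{b+c}\begin{pmatrix} c \\ b \end{pmatrix}$. Assume that the urn is critically small, i.e. $\sigma=1/2$, and that $bc\neq0$. Then the quadratic strong law holds: $$\lim_{n\to\infty}\frac{1}{\log\log n}\sum_{k=2}^n\frac{1}{(k\log k)^2}(U_k-kv_1)(U_k-kv_1)^T=bc\begin{pmatrix} 1 & -1 \\ -1 & 1 \end{pmatrix}\quad\text{a.s.}$$ In particular, $$\lim_{n\to\infty}\frac{1}{\log\log n}\sum_{k=2}^n\frac{\|U_k-kv_1\|^2}{(k\log k)^2}=2bc\quad\text{a.s.}$$ Moreover, the law of iterated logarithm holds: $$\limsup_{n\to\infty}\frac{\|U_n-nv_1\|^2}{2\,n\log n\,\log\log\log n}=2bc\quad\text{a.s.}$$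
   Context: Generalized Pólya urn model: $a,b,c,d$ are nonnegative integers, the replacement matrix $R$ is not diagonal ($b+c\ge1$), and the urn is balanced: $a+b=c+d=S\ge1$. At time $0$ the urn contains $\alpha\ge0$ red balls and $\beta\ge0$ white balls ($\alpha,\beta$ integers), with $\tau=\alpha+\beta\ge1$. At each time $n\ge1$ one ball is drawn uniformly at random from the urn and its color observed. If it is red, it is returned together with $a$ additional red balls and $b$ additional white balls; if it is white, it is returned together with $c$ additional red balls and $d$ additional white balls. $U_n=(X_n,Y_n)^T$, where $X_n$ and $Y_n$ are the numbers of red and white balls at time $n$; $U_0=(\alpha,\beta)^T$ and $X_n+Y_n=\tau_n=\tau+nS$. Equivalently, $U_{n+1}=U_n+R^T(\varepsilon_{n+1},1-\varepsilon_{n+1})^T$, where the conditional distribution of $\varepsilon_{n+1}$ given the past $\mathcal{F}_n$ up to time $n$ is Bernoulli with parameter $X_n/\tau_n$. $\|\cdot\|$ is the Euclidean norm on $\mathbb{R}^2$. *)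

theory Defs
  imports "HOL-Probability.Probability"
begin

definition replacement_matrix :: "nat \<Rightarrow> nat \<Rightarrow> nat \<Rightarrow> nat \<Rightarrow> real^2^2" where
  "replacement_matrix a b c d = vector [vector [real a, real b], vector [real c, real d]]"

text \<open>
  The variable \<open>\<epsilon> n\<close> (for \<open>n \<ge> 1\<close>; \<open>\<epsilon> 0\<close> plays no role) is 1 if the ball drawn at time \<open>n\<close>
  is red and 0 if it is white. \<open>F n\<close> is the past up to time \<open>n\<close>: any filtration to which the
  draws are adapted is allowed, in particular the one they generate. Component 1 of \<open>U n\<close> counts
  the red balls, component 2 the white ones. Drawing uniformly means that, given \<open>F n\<close>, the next
  ball is red with probability equal to the current proportion of red balls.
\<close>

locale balanced_polya_urn = prob_space M + filtration "space M" F
  for M :: "'w measure" and F :: "nat \<Rightarrow> 'w measure" +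
  fixes a b c d \<alpha> \<beta> :: nat
    and \<epsilon> :: "nat \<Rightarrow> 'w \<Rightarrow> real"
    and U :: "nat \<Rightarrow> 'w \<Rightarrow> real^2"
  assumes not_diagonal: "b + c \<ge> 1"
    and balanced: "a + b = c + d"
    and balance_pos: "a + b \<ge> 1"
    and nonempty: "\<alpha> + \<beta> \<ge> 1"
    and subalgebra_F: "\<And>n. subalgebra M (F n)"
    and adapted: "\<And>n. \<epsilon> (Suc n) \<in> borel_measurable (F (Suc n))"
    and draw_range: "\<And>n \<omega>. \<omega> \<in> space M \<Longrightarrow> \<epsilon> (Suc n) \<omega> \<in> {0, 1}"
    and U_0: "\<And>\<omega>. \<omega> \<in> space M \<Longrightarrow> U 0 \<omega> = vector [real \<alpha>, real \<beta>]"
    and U_Suc: "\<And>n \<omega>. \<omega> \<in> space M \<Longrightarrow>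
      U (Suc n) \<omega> = U n \<omega> +
        transpose (replacement_matrix a b c d) *v vector [\<epsilon> (Suc n) \<omega>, 1 - \<epsilon> (Suc n) \<omega>]"
    and draw_prob: "\<And>n. AE \<omega> in M.
      real_cond_exp M (F n) (indicator {\<omega> \<in> space M. \<epsilon> (Suc n) \<omega> = 1}) \<omega> =
        U n \<omega> $ 1 / (U n \<omega> $ 1 + U n \<omega> $ 2)"

text \<open>The matrix \<open>x x\<^sup>T\<close> of a vector \<open>x\<close>, viewed as a column.\<close>

definition outer_square :: "real^2 \<Rightarrow> real^2^2" where
  "outer_square x = (columnvector x :: real^1^2) ** (rowvector x :: real^2^1)"

end

theory Submission
  imports Defs "HOL-Real_Asymp.Real_Asymp"
begin

text \<open>
  Let \<open>Z n\<close> be the number of red balls at time \<open>n\<close>, centred by \<open>2cn + c\<tau>/(b + c)\<close>. For \<open>\<sigma> = 1/2\<close> one has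
  \<open>Z (n+1) = (1 + m/\<tau>\<^sub>n) Z n + m \<xi> n\<close>, where \<open>m = b + c\<close> and \<open>\<xi>\<close> is the centred indicator of a red draw. Dividing
  by the product of the factors \<open>1 + m/\<tau>\<^sub>k\<close>, which is of order \<open>sqrt n\<close>, gives a martingale
  with increments \<open>b k * \<xi> k\<close>, \<open>b k\<close> deterministic, and with variance \<open>\<nu> n\<close> (up to the limit of \<open>Var \<xi>\<close>)
  of order \<open>ln n\<close>; the iterated logarithm of \<open>\<nu> n\<close> is the triple logarithm of \<open>n\<close>.

  All almost sure statements come from two-sided bounds on the conditional exponential moments of \<open>\<xi>\<close>.
  Ville's inequality for the exponential supermartingale on geometric blocks yields the upper half
  of the law of the iterated logarithm, and hence the law of large numbers for the proportion of red balls; a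
  tilting argument on each block and the conditional Borel--Cantelli lemma yield the lower half. For the
  quadratic strong law, telescope \<open>M\<^sup>2/\<nu>\<close>: since \<open>\<xi>\<^sup>2 - p(1 - p) = (1 - 2p) \<xi>\<close>, everything except
  the quadratic sum and a sum asymptotic to a multiple of \<open>ln (\<nu> n)\<close> is a martingale that is negligible against its own variance.
\<close>

section \<open>Exponential inequalities for Bernoulli draws\<close>

text \<open>A circle has to be broken: a sharp iterated logarithm needs the conditional variance
  \<open>q\<close> to converge, while for the urn this convergence needs a bound on the martingale.
  The bound \<open>q \<le> 1/4\<close> breaks it, giving the right order with a wrong constant; the
  sharp laws are then implications from convergence of \<open>q\<close> on a single path. Since that
  hypothesis concerns the future, multipliers are cut off by events of the past, so that the
  exponential bounds hold on every path. Bounded weights suffice because the tilt used on a block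
  tends to zero, which removes the cubic error of the exponential moments. In the quadratic law the
  leftover martingale has variance at most twice the quadratic sum plus a constant, so a small
  multiple of that sum absorbs it. The constant bc appears because the limit of growth/sqrt n, a
  quotient of Gamma values, cancels: its square multiplies Z^2 and divides \<open>\<nu>\<close>, and
  the m^2 in \<open>\<nu>\<close> cancels against the limit bc/m^2 of \<open>q\<close>. Exponential
  bounds are integrated over events of the past in extended nonnegative reals, which avoids
  integrability questions.\<close>

lemma exp_taylor2_bounds:
  fixes x :: real
  assumes "\<bar>x\<bar> \<le> 1"
  shows "exp x \<le> 1 + x + x\<^sup>2 / 2 * (1 + \<bar>x\<bar>)" and "exp x \<ge> 1 + x + x\<^sup>2 / 2 * (1 - \<bar>x\<bar>)"
proof -
  obtain t where t: "\<bar>t\<bar> \<le> \<bar>x\<bar>" "exp x = (\<Sum>m<3. x ^ m / fact m) + exp t / fact 3 * x ^ 3"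
    using Maclaurin_exp_le[of x 3] by blast
  \<comment> \<open>As e < 3, the Lagrange remainder is at most |x|^3/2, which is |x| times the
    quadratic term.\<close>
  have "exp t \<le> exp 1" using t assms by simp
  also have "exp 1 < (3::real)" using e_less_272 by simp
  finally have e: "exp t \<le> 3" by simp
  have eq: "exp x = 1 + x + x\<^sup>2 / 2 + exp t / 6 * x ^ 3"
    using t(2) by (simp add: eval_nat_numeral)
  have "\<bar>exp t / 6 * x ^ 3\<bar> = exp t / 6 * \<bar>x\<bar> ^ 3" by (simp add: abs_mult power_abs)
  also have "\<dots> \<le> 3 / 6 * \<bar>x\<bar> ^ 3" using e by (intro mult_right_mono) auto
  also have "\<dots> = x\<^sup>2 / 2 * \<bar>x\<bar>" by (simp add: power3_eq_cube power2_eq_square)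
  finally show "exp x \<le> 1 + x + x\<^sup>2 / 2 * (1 + \<bar>x\<bar>)" "exp x \<ge> 1 + x + x\<^sup>2 / 2 * (1 - \<bar>x\<bar>)"
    unfolding eq by (auto simp: algebra_simps)
qed

text \<open>The moment generating function, at \<open>h\<close>, of a Bernoulli variable with
  parameter \<open>p\<close> minus its mean.\<close>

definition bernoulli_mgf :: "real \<Rightarrow> real \<Rightarrow> real" where
  "bernoulli_mgf h p = p * exp (h * (1 - p)) + (1 - p) * exp (- (h * p))"

text \<open>The linear Taylor terms cancel and the quadratic ones add up to the variance p(1 - p),
  so the Taylor error survives only as a relative error |h| in the exponent. The lower bound loses a
  second |h| when 1 + z is turned back into an exponential.\<close>

lemma bernoulli_mgf_bounds:
  assumes "0 \<le> p" "p \<le> 1" "\<bar>h\<bar> \<le> 1"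
  shows "bernoulli_mgf h p \<le> exp (h\<^sup>2 * (p * (1 - p)) / 2 * (1 + \<bar>h\<bar>))"
    and "exp (h\<^sup>2 * (p * (1 - p)) / 2 * (1 - 2 * \<bar>h\<bar>)) \<le> bernoulli_mgf h p"
proof -
  have 1: "\<bar>h * (1 - p)\<bar> \<le> \<bar>h\<bar>" using assms by (auto simp: abs_mult intro: mult_left_le)
  have 2: "\<bar>- (h * p)\<bar> \<le> \<bar>h\<bar>" using assms by (auto simp: abs_mult intro: mult_left_le)
  note e1 = exp_taylor2_bounds[OF order_trans[OF 1 assms(3)]]
  note e2 = exp_taylor2_bounds[OF order_trans[OF 2 assms(3)]]
  let ?y = "h\<^sup>2 * (p * (1 - p)) / 2"
  have y0: "0 \<le> ?y" using assms by simp
  have "exp (h * (1 - p)) \<le> 1 + h * (1 - p) + (h * (1 - p))\<^sup>2 / 2 * (1 + \<bar>h\<bar>)"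
    by (rule order_trans[OF e1(1)]) (use 1 in \<open>auto intro!: mult_left_mono\<close>)
  moreover have "exp (- (h * p)) \<le> 1 + - (h * p) + (- (h * p))\<^sup>2 / 2 * (1 + \<bar>h\<bar>)"
    by (rule order_trans[OF e2(1)]) (use 2 in \<open>auto intro!: mult_left_mono\<close>)
  ultimately have "bernoulli_mgf h p \<le> p * (1 + h * (1 - p) + (h * (1 - p))\<^sup>2 / 2 * (1 + \<bar>h\<bar>))
     + (1 - p) * (1 + - (h * p) + (- (h * p))\<^sup>2 / 2 * (1 + \<bar>h\<bar>))"
    unfolding bernoulli_mgf_def using assms by (intro add_mono mult_left_mono) auto
  also have "\<dots> = 1 + ?y * (1 + \<bar>h\<bar>)"
    by (simp add: power2_eq_square field_simps)
  also have "\<dots> \<le> exp (?y * (1 + \<bar>h\<bar>))" by (rule exp_ge_add_one_self)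
  finally show "bernoulli_mgf h p \<le> exp (?y * (1 + \<bar>h\<bar>))" .
  have "exp (h * (1 - p)) \<ge> 1 + h * (1 - p) + (h * (1 - p))\<^sup>2 / 2 * (1 - \<bar>h\<bar>)"
    by (rule order_trans[OF _ e1(2)]) (use 1 in \<open>auto intro!: mult_left_mono\<close>)
  moreover have "exp (- (h * p)) \<ge> 1 + - (h * p) + (- (h * p))\<^sup>2 / 2 * (1 - \<bar>h\<bar>)"
    by (rule order_trans[OF _ e2(2)]) (use 2 in \<open>auto intro!: mult_left_mono\<close>)
  ultimately have "bernoulli_mgf h p \<ge> p * (1 + h * (1 - p) + (h * (1 - p))\<^sup>2 / 2 * (1 - \<bar>h\<bar>))
     + (1 - p) * (1 + - (h * p) + (- (h * p))\<^sup>2 / 2 * (1 - \<bar>h\<bar>))"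
    unfolding bernoulli_mgf_def using assms by (intro add_mono mult_left_mono) auto
  also have "p * (1 + h * (1 - p) + (h * (1 - p))\<^sup>2 / 2 * (1 - \<bar>h\<bar>))
     + (1 - p) * (1 + - (h * p) + (- (h * p))\<^sup>2 / 2 * (1 - \<bar>h\<bar>)) = 1 + ?y * (1 - \<bar>h\<bar>)"
    by (simp add: power2_eq_square field_simps)
  finally have low: "1 + ?y * (1 - \<bar>h\<bar>) \<le> bernoulli_mgf h p" .
  define z where "z = ?y * (1 - \<bar>h\<bar>)"
  have z0: "0 \<le> z" using y0 assms by (simp add: z_def)
  have pp: "p * (1 - p) \<le> 1"
    using assms by (intro mult_le_one) auto
  have "h\<^sup>2 * (p * (1 - p)) \<le> h\<^sup>2 * 1" using pp by (intro mult_left_mono) auto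
  also have "h\<^sup>2 * 1 = \<bar>h\<bar> * \<bar>h\<bar>" by (simp add: power2_eq_square)
  also have "\<dots> \<le> \<bar>h\<bar> * 1" using assms(3) by (intro mult_left_mono) auto
  finally have yh: "?y \<le> \<bar>h\<bar> / 2" by simp
  have zy: "z \<le> ?y" unfolding z_def using y0 by (intro mult_left_le) auto
  have z1: "z \<le> 1/2" using zy yh assms(3) by simp
  \<comment> \<open>This logarithm bound needs z at most 1/2, which is what |h| at most 1 provides.
    The loss z^2 is at most \<open>?y * \<bar>h\<bar>\<close>, hence the 2 in the final
    factor.\<close>
  have "z - z\<^sup>2 \<le> ln (1 + z)" using ln_one_plus_pos_lower_bound[of z] z0 z1 by simp
  hence "exp (z - z\<^sup>2) \<le> 1 + z" using z0 by (subst (asm) ln_ge_iff) auto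
  moreover have "?y * (1 - 2 * \<bar>h\<bar>) \<le> z - z\<^sup>2"
  proof -
    have "z\<^sup>2 \<le> ?y * \<bar>h\<bar>" unfolding power2_eq_square
      by (rule order_trans[OF mult_mono[OF zy _ y0 z0, of "\<bar>h\<bar>"]]) (use zy yh in \<open>auto simp: power2_eq_square\<close>)
    moreover have "z = ?y - ?y * \<bar>h\<bar>" "?y * (1 - 2 * \<bar>h\<bar>) = ?y - 2 * (?y * \<bar>h\<bar>)"
      unfolding z_def by (simp_all only: right_diff_distrib mult_1_right mult.left_commute)
    ultimately show ?thesis by linarith
  qed
  ultimately show "exp (?y * (1 - 2 * \<bar>h\<bar>)) \<le> bernoulli_mgf h p"
    using low unfolding z_def by (smt (verit) exp_le_cancel_iff)
qed

section \<open>Draws with predictable success probability: conditional exponential moments\<close>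

locale bernoulli_draws = prob_space M + filtration "space M" F
  for M :: "'w measure" and F :: "nat \<Rightarrow> 'w measure" +
  fixes p :: "nat \<Rightarrow> 'w \<Rightarrow> real" and \<epsilon> :: "nat \<Rightarrow> 'w \<Rightarrow> real"
  assumes subalg: "\<And>n. subalgebra M (F n)"
    and p_meas [measurable]: "\<And>n. p n \<in> borel_measurable (F n)"
    and eps_meas [measurable]: "\<And>n. \<epsilon> (Suc n) \<in> borel_measurable (F (Suc n))"
    and p_range: "\<And>n \<omega>. \<omega> \<in> space M \<Longrightarrow> 0 \<le> p n \<omega> \<and> p n \<omega> \<le> 1"
    and eps_range: "\<And>n \<omega>. \<omega> \<in> space M \<Longrightarrow> \<epsilon> (Suc n) \<omega> \<in> {0, 1}"
    and p_cond: "\<And>n. AE \<omega> in M.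
      real_cond_exp M (F n) (indicator {\<omega> \<in> space M. \<epsilon> (Suc n) \<omega> = 1}) \<omega> = p n \<omega>"
begin

definition \<xi> :: "nat \<Rightarrow> 'w \<Rightarrow> real" where "\<xi> n \<omega> = \<epsilon> (Suc n) \<omega> - p n \<omega>"

definition q :: "nat \<Rightarrow> 'w \<Rightarrow> real" where "q n \<omega> = p n \<omega> * (1 - p n \<omega>)"

lemma q_meas [measurable]: "q n \<in> borel_measurable (F n)"
  unfolding q_def by measurable

lemma F_meas_mono: "f \<in> borel_measurable (F m) \<Longrightarrow> m \<le> n \<Longrightarrow> f \<in> borel_measurable (F n)"
  using borel_measurable_subalgebra[of "F m" "F n"] sets_F_mono[of m n] by (simp add: space_F)

lemma F_meas: "f \<in> borel_measurable (F n) \<Longrightarrow> f \<in> borel_measurable M"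
  by (rule measurable_from_subalg[OF subalg])

lemma F_sets: "A \<in> sets (F n) \<Longrightarrow> A \<in> sets M"
  using subalg[of n] by (auto simp: subalgebra_def)

lemma xi_meas: "\<xi> n \<in> borel_measurable (F (Suc n))"
  unfolding \<xi>_def using F_meas_mono[OF p_meas, of n "Suc n"] by measurable

lemma q_range: "\<omega> \<in> space M \<Longrightarrow> 0 \<le> q n \<omega>" "\<omega> \<in> space M \<Longrightarrow> q n \<omega> \<le> 1/4"
proof -
  show "\<omega> \<in> space M \<Longrightarrow> 0 \<le> q n \<omega>" using p_range[of \<omega> n] by (simp add: q_def)
  have "p n \<omega> * (1 - p n \<omega>) = 1/4 - (p n \<omega> - 1/2)\<^sup>2"
    by (simp add: power2_eq_square field_simps)
  thus "q n \<omega> \<le> 1/4" by (simp add: q_def)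
qed

lemma xi_abs_le: "\<omega> \<in> space M \<Longrightarrow> \<bar>\<xi> n \<omega>\<bar> \<le> 1"
  using p_range[of \<omega> n] eps_range[of \<omega> n] by (auto simp: \<xi>_def)

lemma xi_square: "\<omega> \<in> space M \<Longrightarrow> (\<xi> n \<omega>)\<^sup>2 = q n \<omega> + (1 - 2 * p n \<omega>) * \<xi> n \<omega>"
  using eps_range[of \<omega> n] by (auto simp: \<xi>_def q_def power2_eq_square field_simps)

text \<open>\<open>g\<close> is a version of the conditional expectation of \<open>f\<close> given
  \<open>F n\<close>, so equality on events of \<open>F n\<close> extends to all nonnegative weights
  \<open>G\<close> known at time \<open>n\<close>.\<close>

lemma nn_integral_cond_eqI:
  fixes f g :: "'w \<Rightarrow> real" and G :: "'w \<Rightarrow> ennreal"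
  assumes f [measurable]: "f \<in> borel_measurable M" and g: "g \<in> borel_measurable (F n)"
    and f01: "\<And>\<omega>. \<omega> \<in> space M \<Longrightarrow> 0 \<le> f \<omega> \<and> f \<omega> \<le> 1"
    and g01: "\<And>\<omega>. \<omega> \<in> space M \<Longrightarrow> 0 \<le> g \<omega> \<and> g \<omega> \<le> 1"
    and eq: "\<And>A. A \<in> sets (F n) \<Longrightarrow> (\<integral>\<omega>. indicator A \<omega> * f \<omega> \<partial>M) = (\<integral>\<omega>. indicator A \<omega> * g \<omega> \<partial>M)"
    and G: "G \<in> borel_measurable (F n)"
  shows "(\<integral>\<^sup>+\<omega>. G \<omega> * ennreal (f \<omega>) \<partial>M) = (\<integral>\<^sup>+\<omega>. G \<omega> * ennreal (g \<omega>) \<partial>M)"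
proof -
  interpret S: finite_measure_subalgebra M "F n" by unfold_locales (rule subalg)
  note [measurable] = F_meas[OF g]
  have nn: "(\<integral>\<^sup>+\<omega>\<in>A. ennreal (k \<omega>) \<partial>M) = ennreal (\<integral>\<omega>. indicator A \<omega> * k \<omega> \<partial>M)"
    if [measurable]: "A \<in> sets M" "k \<in> borel_measurable M" and k: "\<And>\<omega>. \<omega> \<in> space M \<Longrightarrow> 0 \<le> k \<omega> \<and> k \<omega> \<le> 1" for A k
  proof -
    have "(\<integral>\<^sup>+\<omega>\<in>A. ennreal (k \<omega>) \<partial>M) = (\<integral>\<^sup>+\<omega>. ennreal (indicator A \<omega> * k \<omega>) \<partial>M)"
      by (intro nn_integral_cong) (auto simp: indicator_def)
    also have "\<dots> = ennreal (\<integral>\<omega>. indicator A \<omega> * k \<omega> \<partial>M)"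
      using k by (intro nn_integral_eq_integral integrable_const_bound[where B = 1])
        (auto simp: indicator_def)
    finally show ?thesis .
  qed
  have "AE \<omega> in M. ennreal (g \<omega>) = nn_cond_exp M (F n) (\<lambda>\<omega>. ennreal (f \<omega>)) \<omega>"
    by (rule S.nn_cond_exp_charact) (use g in \<open>auto simp: nn F_sets f01 g01 eq\<close>)
  hence "(\<integral>\<^sup>+\<omega>. G \<omega> * ennreal (g \<omega>) \<partial>M) = (\<integral>\<^sup>+\<omega>. G \<omega> * nn_cond_exp M (F n) (\<lambda>\<omega>. ennreal (f \<omega>)) \<omega> \<partial>M)"
    by (intro nn_integral_cong_AE) auto
  also have "\<dots> = (\<integral>\<^sup>+\<omega>. G \<omega> * ennreal (f \<omega>) \<partial>M)"
    by (rule S.nn_cond_exp_intg[OF G]) simp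
  finally show ?thesis ..
qed

text \<open>\<open>G\<close> stands for everything accumulated up to time \<open>n\<close>. Given
  that past, \<open>\<xi> n\<close> has the two values 1 - p and -p, and averaging over the color
  drawn produces the generating function. As an equality, the step serves both upper and lower
  bounds.\<close>

lemma nn_integral_exp_step:
  fixes h g :: "'w \<Rightarrow> real" and G :: "'w \<Rightarrow> ennreal"
  assumes [measurable]: "G \<in> borel_measurable (F n)" "h \<in> borel_measurable (F n)" "g \<in> borel_measurable (F n)"
  shows "(\<integral>\<^sup>+\<omega>. G \<omega> * ennreal (exp (h \<omega> * \<xi> n \<omega> + g \<omega>)) \<partial>M) =
         (\<integral>\<^sup>+\<omega>. G \<omega> * ennreal (exp (g \<omega>) * bernoulli_mgf (h \<omega>) (p n \<omega>)) \<partial>M)"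
proof -
  interpret S: finite_measure_subalgebra M "F n" by unfold_locales (rule subalg)
  let ?E = "{\<omega> \<in> space M. \<epsilon> (Suc n) \<omega> = 1}"
  let ?i = "indicator ?E :: 'w \<Rightarrow> real"
  note [measurable] = F_meas[OF p_meas[of n]] F_meas[OF eps_meas[of n]]
    F_meas[OF assms(1)] F_meas[OF assms(2)] F_meas[OF assms(3)]
  have E [measurable]: "?E \<in> sets M" by measurable
  have int: "integrable M (\<lambda>\<omega>. indicator A \<omega> * p n \<omega>)" "integrable M (\<lambda>\<omega>. indicator A \<omega> * ?i \<omega>)"
    "integrable M (indicator A :: 'w \<Rightarrow> real)" if [measurable]: "A \<in> sets M" for A
    by (rule integrable_const_bound[where B = 1]; use p_range[of _ n] in \<open>auto simp: indicator_def\<close>)+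
  have eq: "(\<integral>\<omega>. indicator A \<omega> * ?i \<omega> \<partial>M) = (\<integral>\<omega>. indicator A \<omega> * p n \<omega> \<partial>M)" if A: "A \<in> sets (F n)" for A
  proof -
    note [measurable] = F_sets[OF A]
    have "(\<integral>\<omega>. indicator A \<omega> * p n \<omega> \<partial>M) =
          (\<integral>\<omega>. indicator A \<omega> * real_cond_exp M (F n) ?i \<omega> \<partial>M)"
      by (rule integral_cong_AE) (use p_cond[of n] in auto)
    also have "\<dots> = (\<integral>\<omega>. indicator A \<omega> * ?i \<omega> \<partial>M)"
      using S.real_cond_exp_intA[OF int(3)[OF E] A] by (simp add: set_lebesgue_integral_def)
    finally show ?thesis ..
  qed
  have eq': "(\<integral>\<omega>. indicator A \<omega> * (1 - ?i \<omega>) \<partial>M) = (\<integral>\<omega>. indicator A \<omega> * (1 - p n \<omega>) \<partial>M)" if A: "A \<in> sets (F n)" for A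
    unfolding right_diff_distrib mult_1_right
    using int[OF F_sets[OF A]] eq[OF A] by (subst (1 2) Bochner_Integration.integral_diff) auto
  have key: "(\<integral>\<^sup>+\<omega>. f \<omega> * ennreal (?i \<omega>) \<partial>M) = (\<integral>\<^sup>+\<omega>. f \<omega> * ennreal (p n \<omega>) \<partial>M)"
    and key': "(\<integral>\<^sup>+\<omega>. f \<omega> * ennreal (1 - ?i \<omega>) \<partial>M) = (\<integral>\<^sup>+\<omega>. f \<omega> * ennreal (1 - p n \<omega>) \<partial>M)"
    if "f \<in> borel_measurable (F n)" for f :: "'w \<Rightarrow> ennreal"
    by (rule nn_integral_cond_eqI; use that p_range eq eq' in \<open>auto simp: indicator_def\<close>)+
  have "(\<integral>\<^sup>+\<omega>. G \<omega> * ennreal (exp (h \<omega> * \<xi> n \<omega> + g \<omega>)) \<partial>M) =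
     (\<integral>\<^sup>+\<omega>. (G \<omega> * ennreal (exp (g \<omega>) * exp (h \<omega> * (1 - p n \<omega>)))) * ennreal (?i \<omega>)
        + (G \<omega> * ennreal (exp (g \<omega>) * exp (- (h \<omega> * p n \<omega>)))) * ennreal (1 - indicator ?E \<omega>) \<partial>M)"
  proof (intro nn_integral_cong)
    fix \<omega> assume w: "\<omega> \<in> space M"
    show "G \<omega> * ennreal (exp (h \<omega> * \<xi> n \<omega> + g \<omega>)) =
      (G \<omega> * ennreal (exp (g \<omega>) * exp (h \<omega> * (1 - p n \<omega>)))) * ennreal (?i \<omega>)
        + (G \<omega> * ennreal (exp (g \<omega>) * exp (- (h \<omega> * p n \<omega>)))) * ennreal (1 - indicator ?E \<omega>)"
      using eps_range[OF w, of n] w by (auto simp: \<xi>_def exp_add mult.commute)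
  qed
  also have "\<dots> = (\<integral>\<^sup>+\<omega>. (G \<omega> * ennreal (exp (g \<omega>) * exp (h \<omega> * (1 - p n \<omega>)))) * ennreal (?i \<omega>) \<partial>M)
        + (\<integral>\<^sup>+\<omega>. (G \<omega> * ennreal (exp (g \<omega>) * exp (- (h \<omega> * p n \<omega>)))) * ennreal (1 - indicator ?E \<omega>) \<partial>M)"
    by (rule nn_integral_add) measurable
  also have "\<dots> = (\<integral>\<^sup>+\<omega>. (G \<omega> * ennreal (exp (g \<omega>) * exp (h \<omega> * (1 - p n \<omega>)))) * ennreal (p n \<omega>) \<partial>M)
        + (\<integral>\<^sup>+\<omega>. (G \<omega> * ennreal (exp (g \<omega>) * exp (- (h \<omega> * p n \<omega>)))) * ennreal (1 - p n \<omega>) \<partial>M)"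
    by (subst key, measurable, subst key') measurable
  also have "\<dots> = (\<integral>\<^sup>+\<omega>. (G \<omega> * ennreal (exp (g \<omega>) * exp (h \<omega> * (1 - p n \<omega>)))) * ennreal (p n \<omega>)
        + (G \<omega> * ennreal (exp (g \<omega>) * exp (- (h \<omega> * p n \<omega>)))) * ennreal (1 - p n \<omega>) \<partial>M)"
    by (rule nn_integral_add[symmetric]) measurable
  also have "\<dots> = (\<integral>\<^sup>+\<omega>. G \<omega> * ennreal (exp (g \<omega>) * bernoulli_mgf (h \<omega>) (p n \<omega>)) \<partial>M)"
  proof (intro nn_integral_cong)
    fix \<omega> assume w: "\<omega> \<in> space M"
    have "exp (g \<omega>) * bernoulli_mgf (h \<omega>) (p n \<omega>) = (exp (g \<omega>) * exp (h \<omega> * (1 - p n \<omega>))) * p n \<omega> +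
      (exp (g \<omega>) * exp (- (h \<omega> * p n \<omega>))) * (1 - p n \<omega>)"
      by (simp add: bernoulli_mgf_def algebra_simps)
    also have "ennreal \<dots> = ennreal (exp (g \<omega>) * exp (h \<omega> * (1 - p n \<omega>))) * ennreal (p n \<omega>) +
       ennreal (exp (g \<omega>) * exp (- (h \<omega> * p n \<omega>))) * ennreal (1 - p n \<omega>)"
      using p_range[OF w, of n] by (simp add: ennreal_plus ennreal_mult)
    finally show "G \<omega> * ennreal (exp (g \<omega>) * exp (h \<omega> * (1 - p n \<omega>))) * ennreal (p n \<omega>) +
         G \<omega> * ennreal (exp (g \<omega>) * exp (- (h \<omega> * p n \<omega>))) * ennreal (1 - p n \<omega>) =
         G \<omega> * ennreal (exp (g \<omega>) * bernoulli_mgf (h \<omega>) (p n \<omega>))"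
      by (simp add: distrib_left mult.assoc)
  qed
  finally show ?thesis .
qed

lemma F_meas_sum:
  assumes "\<And>k. h k \<in> borel_measurable (F k)" "\<And>k. g k \<in> borel_measurable (F k)" "s \<le> n"
  shows "(\<lambda>\<omega>. \<Sum>k=s..<n. h k \<omega> * \<xi> k \<omega> + g k \<omega>) \<in> borel_measurable (F n)"
proof (rule borel_measurable_sum)
  fix k assume k: "k \<in> {s..<n}"
  have [measurable]: "h k \<in> borel_measurable (F n)" "g k \<in> borel_measurable (F n)" "\<xi> k \<in> borel_measurable (F n)"
    using F_meas_mono[OF assms(1)] F_meas_mono[OF assms(2)] F_meas_mono[OF xi_meas] k by auto
  show "(\<lambda>\<omega>. h k \<omega> * \<xi> k \<omega> + g k \<omega>) \<in> borel_measurable (F n)" by measurable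
qed

text \<open>\<open>g\<close> is a predictable compensator: it offsets the random variance in the
  exponent so that a deterministic \<open>u\<close> remains, which can leave the integral.\<close>

lemma exp_step_le:
  assumes [measurable]: "G \<in> borel_measurable (F n)" "h \<in> borel_measurable (F n)" "g \<in> borel_measurable (F n)"
    and h1: "\<And>\<omega>. \<omega> \<in> space M \<Longrightarrow> \<bar>h \<omega>\<bar> \<le> 1"
    and u: "\<And>\<omega>. \<omega> \<in> space M \<Longrightarrow> g \<omega> + (h \<omega>)\<^sup>2 * q n \<omega> / 2 * (1 + \<bar>h \<omega>\<bar>) \<le> u"
  shows "(\<integral>\<^sup>+\<omega>. G \<omega> * ennreal (exp (h \<omega> * \<xi> n \<omega> + g \<omega>)) \<partial>M) \<le> ennreal (exp u) * (\<integral>\<^sup>+\<omega>. G \<omega> \<partial>M)"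
proof -
  note [measurable] = F_meas[OF assms(1)]
  have "(\<integral>\<^sup>+\<omega>. G \<omega> * ennreal (exp (h \<omega> * \<xi> n \<omega> + g \<omega>)) \<partial>M) =
         (\<integral>\<^sup>+\<omega>. G \<omega> * ennreal (exp (g \<omega>) * bernoulli_mgf (h \<omega>) (p n \<omega>)) \<partial>M)"
    by (rule nn_integral_exp_step) measurable
  also have "\<dots> \<le> (\<integral>\<^sup>+\<omega>. G \<omega> * ennreal (exp u) \<partial>M)"
  proof (intro nn_integral_mono mult_left_mono ennreal_leI)
    fix \<omega> assume w: "\<omega> \<in> space M"
    have "exp (g \<omega>) * bernoulli_mgf (h \<omega>) (p n \<omega>) \<le> exp (g \<omega>) * exp ((h \<omega>)\<^sup>2 * q n \<omega> / 2 * (1 + \<bar>h \<omega>\<bar>))"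
      unfolding q_def using p_range[OF w, of n] h1[OF w] by (intro mult_left_mono bernoulli_mgf_bounds) auto
    also have "\<dots> \<le> exp u" using u[OF w] by (simp add: exp_add[symmetric])
    finally show "exp (g \<omega>) * bernoulli_mgf (h \<omega>) (p n \<omega>) \<le> exp u" .
  qed auto
  also have "\<dots> = ennreal (exp u) * (\<integral>\<^sup>+\<omega>. G \<omega> \<partial>M)"
    by (subst nn_integral_cmult[symmetric]) (auto simp: mult.commute)
  finally show ?thesis .
qed

lemma exp_step_ge:
  assumes [measurable]: "G \<in> borel_measurable (F n)" "h \<in> borel_measurable (F n)" "g \<in> borel_measurable (F n)"
    and h1: "\<And>\<omega>. \<omega> \<in> space M \<Longrightarrow> \<bar>h \<omega>\<bar> \<le> 1"
    and u: "\<And>\<omega>. \<omega> \<in> space M \<Longrightarrow> u \<le> g \<omega> + (h \<omega>)\<^sup>2 * q n \<omega> / 2 * (1 - 2 * \<bar>h \<omega>\<bar>)"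
  shows "ennreal (exp u) * (\<integral>\<^sup>+\<omega>. G \<omega> \<partial>M) \<le> (\<integral>\<^sup>+\<omega>. G \<omega> * ennreal (exp (h \<omega> * \<xi> n \<omega> + g \<omega>)) \<partial>M)"
proof -
  note [measurable] = F_meas[OF assms(1)]
  have "ennreal (exp u) * (\<integral>\<^sup>+\<omega>. G \<omega> \<partial>M) = (\<integral>\<^sup>+\<omega>. G \<omega> * ennreal (exp u) \<partial>M)"
    by (subst nn_integral_cmult[symmetric]) (auto simp: mult.commute)
  also have "\<dots> \<le> (\<integral>\<^sup>+\<omega>. G \<omega> * ennreal (exp (g \<omega>) * bernoulli_mgf (h \<omega>) (p n \<omega>)) \<partial>M)"
  proof (intro nn_integral_mono mult_left_mono ennreal_leI)
    fix \<omega> assume w: "\<omega> \<in> space M"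
    have "exp u \<le> exp (g \<omega>) * exp ((h \<omega>)\<^sup>2 * q n \<omega> / 2 * (1 - 2 * \<bar>h \<omega>\<bar>))"
      using u[OF w] by (simp add: exp_add[symmetric])
    also have "\<dots> \<le> exp (g \<omega>) * bernoulli_mgf (h \<omega>) (p n \<omega>)"
      unfolding q_def using p_range[OF w, of n] h1[OF w] by (intro mult_left_mono bernoulli_mgf_bounds) auto
    finally show "exp u \<le> exp (g \<omega>) * bernoulli_mgf (h \<omega>) (p n \<omega>)" .
  qed auto
  also have "\<dots> = (\<integral>\<^sup>+\<omega>. G \<omega> * ennreal (exp (h \<omega> * \<xi> n \<omega> + g \<omega>)) \<partial>M)"
    by (rule nn_integral_exp_step[symmetric]) measurable
  finally show ?thesis .
qed

text \<open>Iteration of the one-step bounds over a block. As \<open>A\<close> ranges over all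
  events known at time \<open>s\<close>, these are bounds on the conditional exponential moment of
  the block given \<open>F s\<close>; the tilting argument needs both directions.\<close>

lemma exp_block:
  assumes h: "\<And>k. h k \<in> borel_measurable (F k)" and g: "\<And>k. g k \<in> borel_measurable (F k)"
    and A: "A \<in> sets (F s)" and st: "s \<le> t"
    and h1: "\<And>k \<omega>. s \<le> k \<Longrightarrow> k < t \<Longrightarrow> \<omega> \<in> space M \<Longrightarrow> \<bar>h k \<omega>\<bar> \<le> 1"
  shows exp_block_le: "(\<And>k \<omega>. s \<le> k \<Longrightarrow> k < t \<Longrightarrow> \<omega> \<in> space M \<Longrightarrow>
          g k \<omega> + (h k \<omega>)\<^sup>2 * q k \<omega> / 2 * (1 + \<bar>h k \<omega>\<bar>) \<le> u k) \<Longrightarrow>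
        (\<integral>\<^sup>+\<omega>. indicator A \<omega> * ennreal (exp (\<Sum>k=s..<t. h k \<omega> * \<xi> k \<omega> + g k \<omega>)) \<partial>M)
          \<le> ennreal (exp (\<Sum>k=s..<t. u k)) * emeasure M A"
    and exp_block_ge: "(\<And>k \<omega>. s \<le> k \<Longrightarrow> k < t \<Longrightarrow> \<omega> \<in> space M \<Longrightarrow>
          u k \<le> g k \<omega> + (h k \<omega>)\<^sup>2 * q k \<omega> / 2 * (1 - 2 * \<bar>h k \<omega>\<bar>)) \<Longrightarrow>
        ennreal (exp (\<Sum>k=s..<t. u k)) * emeasure M A \<le>
        (\<integral>\<^sup>+\<omega>. indicator A \<omega> * ennreal (exp (\<Sum>k=s..<t. h k \<omega> * \<xi> k \<omega> + g k \<omega>)) \<partial>M)"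
proof -
  let ?L = "\<lambda>n \<omega>. indicator A \<omega> * ennreal (exp (\<Sum>k=s..<n. h k \<omega> * \<xi> k \<omega> + g k \<omega>))"
  have AM: "A \<in> sets M" using A by (rule F_sets)
  have Lm: "?L n \<in> borel_measurable (F n)" if "s \<le> n" for n
  proof -
    have "A \<in> sets (F n)" using sets_F_mono[OF that] A by auto
    thus ?thesis using F_meas_sum[of h g, OF h g that] by measurable
  qed
  have Suc: "?L (Suc n) \<omega> = ?L n \<omega> * ennreal (exp (h n \<omega> * \<xi> n \<omega> + g n \<omega>))" if "s \<le> n" for n \<omega>
    using that by (simp add: exp_add ennreal_mult mult.assoc)
  {
    assume u: "\<And>k \<omega>. s \<le> k \<Longrightarrow> k < t \<Longrightarrow> \<omega> \<in> space M \<Longrightarrow>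
        g k \<omega> + (h k \<omega>)\<^sup>2 * q k \<omega> / 2 * (1 + \<bar>h k \<omega>\<bar>) \<le> u k"
    have "n \<le> t \<Longrightarrow> (\<integral>\<^sup>+\<omega>. ?L n \<omega> \<partial>M) \<le> ennreal (exp (\<Sum>k=s..<n. u k)) * emeasure M A" if "s \<le> n" for n
      using that
    proof (induction n rule: dec_induct)
      case base
      thus ?case using AM by simp
    next
      case (step n)
      have "(\<integral>\<^sup>+\<omega>. ?L (Suc n) \<omega> \<partial>M) \<le> ennreal (exp (u n)) * (\<integral>\<^sup>+\<omega>. ?L n \<omega> \<partial>M)"
        unfolding Suc[OF step(1)]
        by (rule exp_step_le) (use step Lm h g h1 u in auto)
      also have "\<dots> \<le> ennreal (exp (u n)) * (ennreal (exp (\<Sum>k=s..<n. u k)) * emeasure M A)"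
        using step by (intro mult_left_mono) auto
      also have "\<dots> = ennreal (exp (\<Sum>k=s..<Suc n. u k)) * emeasure M A"
        using step(1) by (simp add: exp_add ennreal_mult mult_ac)
      finally show ?case .
    qed
    thus "(\<integral>\<^sup>+\<omega>. ?L t \<omega> \<partial>M) \<le> ennreal (exp (\<Sum>k=s..<t. u k)) * emeasure M A" using st by simp
  }
  {
    assume u: "\<And>k \<omega>. s \<le> k \<Longrightarrow> k < t \<Longrightarrow> \<omega> \<in> space M \<Longrightarrow>
        u k \<le> g k \<omega> + (h k \<omega>)\<^sup>2 * q k \<omega> / 2 * (1 - 2 * \<bar>h k \<omega>\<bar>)"
    have "n \<le> t \<Longrightarrow> ennreal (exp (\<Sum>k=s..<n. u k)) * emeasure M A \<le> (\<integral>\<^sup>+\<omega>. ?L n \<omega> \<partial>M)" if "s \<le> n" for n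
      using that
    proof (induction n rule: dec_induct)
      case base
      thus ?case using AM by simp
    next
      case (step n)
      have "ennreal (exp (\<Sum>k=s..<Suc n. u k)) * emeasure M A =
            ennreal (exp (u n)) * (ennreal (exp (\<Sum>k=s..<n. u k)) * emeasure M A)"
        using step(1) by (simp add: exp_add ennreal_mult mult_ac)
      also have "\<dots> \<le> ennreal (exp (u n)) * (\<integral>\<^sup>+\<omega>. ?L n \<omega> \<partial>M)"
        using step by (intro mult_left_mono) auto
      also have "\<dots> \<le> (\<integral>\<^sup>+\<omega>. ?L (Suc n) \<omega> \<partial>M)"
        unfolding Suc[OF step(1)]
        by (rule exp_step_ge) (use step Lm h g h1 u in auto)
      finally show ?case .
    qed
    thus "ennreal (exp (\<Sum>k=s..<t. u k)) * emeasure M A \<le> (\<integral>\<^sup>+\<omega>. ?L t \<omega> \<partial>M)" using st by simp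
  }
qed

text \<open>Ville's maximal inequality with infinite horizon for the supermartingale exp(S n). The
  proof freezes the process at the value e^x as soon as S reaches the level
  \<open>x\<close>.\<close>

lemma ville_exp:
  fixes x :: real
  assumes h: "\<And>k. h k \<in> borel_measurable (F k)" and g: "\<And>k. g k \<in> borel_measurable (F k)"
    and h1: "\<And>k \<omega>. \<omega> \<in> space M \<Longrightarrow> \<bar>h k \<omega>\<bar> \<le> 1"
    and u: "\<And>k \<omega>. \<omega> \<in> space M \<Longrightarrow> g k \<omega> + (h k \<omega>)\<^sup>2 * q k \<omega> / 2 * (1 + \<bar>h k \<omega>\<bar>) \<le> 0"
  shows ville_sets: "{\<omega> \<in> space M. \<exists>n. x \<le> (\<Sum>k<n. h k \<omega> * \<xi> k \<omega> + g k \<omega>)} \<in> sets M"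
    and ville_le: "prob {\<omega> \<in> space M. \<exists>n. x \<le> (\<Sum>k<n. h k \<omega> * \<xi> k \<omega> + g k \<omega>)} \<le> exp (- x)"
proof -
  define S where "S n \<omega> = (\<Sum>k<n. h k \<omega> * \<xi> k \<omega> + g k \<omega>)" for n \<omega>
  have Sm: "S n \<in> borel_measurable (F n)" for n
    using F_meas_sum[of h g 0 n, OF h g] by (simp add: S_def[abs_def] atLeast0LessThan)
  have SM [measurable]: "S n \<in> borel_measurable M" for n by (rule F_meas[OF Sm])
  \<comment> \<open>Only times before \<open>n\<close> are inspected, so \<open>A (Suc n)\<close> is
    still an event of \<open>F n\<close> and the one-step bound applies to it.\<close>
  define A where "A n = {\<omega> \<in> space M. \<forall>i\<in>{..<n}. S i \<omega> < x}" for n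
  have AF: "A n \<in> sets (F n)" for n
  proof -
    have "{\<omega> \<in> space (F n). \<forall>i\<in>{..<n}. S i \<omega> < x} \<in> sets (F n)"
    proof (rule sets.sets_Collect_finite_All)
      fix i assume "i \<in> {..<n}"
      hence [measurable]: "S i \<in> borel_measurable (F n)" by (intro F_meas_mono[OF Sm]) auto
      show "{\<omega> \<in> space (F n). S i \<omega> < x} \<in> sets (F n)" by measurable
    qed auto
    thus ?thesis unfolding A_def space_F .
  qed
  have AM [measurable]: "A n \<in> sets M" for n using AF by (rule F_sets)
  let ?L = "\<lambda>n \<omega>. ennreal (exp (S n \<omega>))"
  define B where "B n = space M - A n" for n
  have BM [measurable]: "B n \<in> sets M" for n unfolding B_def by (intro sets.Diff sets.top AM)
  \<comment> \<open>A path that has reached the level is credited with exactly e^x, any other with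
    its current exponential. At the moment of crossing the exponential is at least e^x, so replacing
    it can only lower the expectation.\<close>
  have J: "(\<integral>\<^sup>+\<omega>. indicator (A n) \<omega> * ?L n \<omega> + ennreal (exp x) * indicator (B n) \<omega> \<partial>M) \<le> 1" for n
  proof (induction n)
    case 0
    have "(\<integral>\<^sup>+\<omega>. indicator (A 0) \<omega> * ?L 0 \<omega> + ennreal (exp x) * indicator (B 0) \<omega> \<partial>M) = (\<integral>\<^sup>+\<omega>. 1 \<partial>M)"
      by (intro nn_integral_cong) (auto simp: A_def B_def S_def)
    also have "\<dots> = 1" by (simp add: emeasure_space_1)
    finally show ?case by simp
  next
    case (Suc n)
    have A': "A (Suc n) = A n \<inter> {\<omega> \<in> space M. S n \<omega> < x}" by (auto simp: A_def less_Suc_eq)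
    have AF': "A (Suc n) \<in> sets (F n)"
      unfolding A' using AF[of n] borel_measurable_pred_less[OF Sm[of n], of "\<lambda>_. x"]
      by (auto simp: pred_def space_F)
    have "(\<integral>\<^sup>+\<omega>. indicator (A (Suc n)) \<omega> * ?L (Suc n) \<omega> \<partial>M) =
          (\<integral>\<^sup>+\<omega>. (indicator (A (Suc n)) \<omega> * ?L n \<omega>) * ennreal (exp (h n \<omega> * \<xi> n \<omega> + g n \<omega>)) \<partial>M)"
      by (intro nn_integral_cong) (auto simp: S_def exp_add ennreal_mult mult.assoc)
    also have "\<dots> \<le> ennreal (exp 0) * (\<integral>\<^sup>+\<omega>. indicator (A (Suc n)) \<omega> * ?L n \<omega> \<partial>M)"
      using Sm[of n] AF' h g h1 u by (intro exp_step_le) auto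
    finally have 1: "(\<integral>\<^sup>+\<omega>. indicator (A (Suc n)) \<omega> * ?L (Suc n) \<omega> \<partial>M)
        \<le> (\<integral>\<^sup>+\<omega>. indicator (A (Suc n)) \<omega> * ?L n \<omega> \<partial>M)" by simp
    have "(\<integral>\<^sup>+\<omega>. indicator (A (Suc n)) \<omega> * ?L (Suc n) \<omega> + ennreal (exp x) * indicator (B (Suc n)) \<omega> \<partial>M)
      = (\<integral>\<^sup>+\<omega>. indicator (A (Suc n)) \<omega> * ?L (Suc n) \<omega> \<partial>M) + (\<integral>\<^sup>+\<omega>. ennreal (exp x) * indicator (B (Suc n)) \<omega> \<partial>M)"
      by (rule nn_integral_add) measurable
    also have "\<dots> \<le> (\<integral>\<^sup>+\<omega>. indicator (A (Suc n)) \<omega> * ?L n \<omega> \<partial>M) + (\<integral>\<^sup>+\<omega>. ennreal (exp x) * indicator (B (Suc n)) \<omega> \<partial>M)"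
      using 1 by (rule add_right_mono)
    also have "\<dots> = (\<integral>\<^sup>+\<omega>. indicator (A (Suc n)) \<omega> * ?L n \<omega> + ennreal (exp x) * indicator (B (Suc n)) \<omega> \<partial>M)"
      by (rule nn_integral_add[symmetric]) measurable
    also have "\<dots> \<le> (\<integral>\<^sup>+\<omega>. indicator (A n) \<omega> * ?L n \<omega> + ennreal (exp x) * indicator (B n) \<omega> \<partial>M)"
      by (intro nn_integral_mono) (auto simp: A' B_def indicator_def intro!: ennreal_leI)
    also have "\<dots> \<le> 1" by (rule Suc)
    finally show ?case .
  qed
  have PB: "emeasure M (B n) \<le> ennreal (exp (- x))" for n
  proof -
    have "ennreal (exp x) * emeasure M (B n) = (\<integral>\<^sup>+\<omega>. ennreal (exp x) * indicator (B n) \<omega> \<partial>M)"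
      by (simp add: nn_integral_cmult_indicator)
    also have "\<dots> \<le> (\<integral>\<^sup>+\<omega>. indicator (A n) \<omega> * ?L n \<omega> + ennreal (exp x) * indicator (B n) \<omega> \<partial>M)"
      by (intro nn_integral_mono) auto
    also have "\<dots> \<le> 1" by (rule J)
    finally have "ennreal (exp (- x)) * (ennreal (exp x) * emeasure M (B n)) \<le> ennreal (exp (- x)) * 1"
      by (intro mult_left_mono) auto
    thus ?thesis by (simp add: mult.assoc[symmetric] ennreal_mult[symmetric] exp_minus)
  qed
  have eq: "{\<omega> \<in> space M. \<exists>n. x \<le> S n \<omega>} = (\<Union>n. B n)"
    by (auto simp: B_def A_def not_less) (metis lessI lessThan_iff not_le)
  have "incseq B" by (auto simp: incseq_def B_def A_def)
  hence "emeasure M (\<Union>n. B n) = (SUP n. emeasure M (B n))"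
    by (intro SUP_emeasure_incseq[symmetric]) auto
  also have "\<dots> \<le> ennreal (exp (- x))" by (intro SUP_least PB)
  finally show "prob {\<omega> \<in> space M. \<exists>n. x \<le> (\<Sum>k<n. h k \<omega> * \<xi> k \<omega> + g k \<omega>)} \<le> exp (- x)"
    unfolding S_def[symmetric] eq by (simp add: emeasure_eq_measure)
  show "{\<omega> \<in> space M. \<exists>n. x \<le> (\<Sum>k<n. h k \<omega> * \<xi> k \<omega> + g k \<omega>)} \<in> sets M"
    unfolding S_def[symmetric] eq by auto
qed

text \<open>Each \<open>j\<close> has its own tilt and compensator, meant for one geometric block.
  The maximal inequality handles all \<open>n\<close> at once, so only the blocks are counted in the
  first Borel-Cantelli lemma.\<close>

lemma borel_cantelli_ville:
  fixes x :: "nat \<Rightarrow> real"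
  assumes h: "\<And>j k. h j k \<in> borel_measurable (F k)" and g: "\<And>j k. g j k \<in> borel_measurable (F k)"
    and h1: "\<And>j k \<omega>. j \<ge> J \<Longrightarrow> \<omega> \<in> space M \<Longrightarrow> \<bar>h j k \<omega>\<bar> \<le> 1"
    and u: "\<And>j k \<omega>. j \<ge> J \<Longrightarrow> \<omega> \<in> space M \<Longrightarrow> g j k \<omega> + (h j k \<omega>)\<^sup>2 * q k \<omega> / 2 * (1 + \<bar>h j k \<omega>\<bar>) \<le> 0"
    and x: "summable (\<lambda>j. exp (- x j))"
  shows "AE \<omega> in M. \<forall>\<^sub>F j in sequentially. \<forall>n. (\<Sum>k<n. h j k \<omega> * \<xi> k \<omega> + g j k \<omega>) < x j"
proof -
  define A where "A j = {\<omega> \<in> space M. \<exists>n. x (j + J) \<le> (\<Sum>k<n. h (j + J) k \<omega> * \<xi> k \<omega> + g (j + J) k \<omega>)}" for j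
  have AM: "A j \<in> sets M" for j
    unfolding A_def by (rule ville_sets) (use assms in auto)
  have PA: "prob (A j) \<le> exp (- x (j + J))" for j
    unfolding A_def by (rule ville_le) (use assms in auto)
  have "summable (\<lambda>j. prob (A j))"
    by (rule summable_comparison_test'[OF summable_ignore_initial_segment[OF x, of J], of 0])
       (use PA in auto)
  hence "AE \<omega> in M. \<forall>\<^sub>F j in sequentially. \<omega> \<in> space M - A j"
    using AM by (intro borel_cantelli_AE1) (auto simp: emeasure_eq_measure)
  thus ?thesis
  proof eventually_elim
    case (elim \<omega>)
    hence "\<forall>\<^sub>F j in sequentially. \<forall>n. (\<Sum>k<n. h (j + J) k \<omega> * \<xi> k \<omega> + g (j + J) k \<omega>) < x (j + J)"
      by eventually_elim (auto simp: A_def not_le)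
    thus ?case by (subst (asm) eventually_sequentially_seg[where k = J])
  qed
qed

text \<open>For the tilt \<open>l\<close> the factor 1 + |l h| is at most 2, so l^2 h^2 q
  compensates. Levels e^j have summable failure probabilities; almost surely some level is never
  reached, and it supplies C = j/l.\<close>

lemma martingale_growth_upper:
  assumes h: "\<And>k. h k \<in> borel_measurable (F k)"
    and h1: "\<And>k \<omega>. \<omega> \<in> space M \<Longrightarrow> \<bar>h k \<omega>\<bar> \<le> 1" and l: "0 < l" "l \<le> 1"
  shows "AE \<omega> in M. \<exists>C. \<forall>n. (\<Sum>k<n. h k \<omega> * \<xi> k \<omega>) \<le> C + l * (\<Sum>k<n. (h k \<omega>)\<^sup>2 * q k \<omega>)"
proof -
  have "AE \<omega> in M. \<forall>\<^sub>F j in sequentially. \<forall>n. (\<Sum>k<n. (l * h k \<omega>) * \<xi> k \<omega> + (- (l\<^sup>2 * ((h k \<omega>)\<^sup>2 * q k \<omega>)))) < real j"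
  proof (rule borel_cantelli_ville[where J = 0])
    show "(\<lambda>\<omega>. l * h k \<omega>) \<in> borel_measurable (F k)" for k using h[of k] by simp
    show "(\<lambda>\<omega>. - (l\<^sup>2 * ((h k \<omega>)\<^sup>2 * q k \<omega>))) \<in> borel_measurable (F k)" for k
      by (intro borel_measurable_uminus borel_measurable_times borel_measurable_const borel_measurable_power h q_meas)
    fix k \<omega> assume w: "\<omega> \<in> space M"
    show 1: "\<bar>l * h k \<omega>\<bar> \<le> 1" using h1[OF w, of k] l by (auto simp: abs_mult intro: mult_le_one)
    have "(l * h k \<omega>)\<^sup>2 * q k \<omega> / 2 * (1 + \<bar>l * h k \<omega>\<bar>) \<le> (l * h k \<omega>)\<^sup>2 * q k \<omega> / 2 * (1 + 1)"
      using 1 q_range[OF w, of k] by (intro mult_left_mono) auto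
    thus "- (l\<^sup>2 * ((h k \<omega>)\<^sup>2 * q k \<omega>)) + (l * h k \<omega>)\<^sup>2 * q k \<omega> / 2 * (1 + \<bar>l * h k \<omega>\<bar>) \<le> 0"
      by (simp add: power_mult_distrib mult_ac)
  next
    have "summable (\<lambda>j. exp (-1 :: real) ^ j)" by (rule summable_geometric) simp
    thus "summable (\<lambda>j. exp (- real j))" by (simp add: exp_of_nat_mult[symmetric])
  qed
  thus ?thesis
  proof eventually_elim
    case (elim \<omega>)
    from eventually_happens'[OF sequentially_bot elim] obtain j where j: "\<And>n. (\<Sum>k<n. (l * h k \<omega>) * \<xi> k \<omega> + (- (l\<^sup>2 * ((h k \<omega>)\<^sup>2 * q k \<omega>)))) < real j"
      by blast
    have "(\<Sum>k<n. h k \<omega> * \<xi> k \<omega>) \<le> real j / l + l * (\<Sum>k<n. (h k \<omega>)\<^sup>2 * q k \<omega>)" for n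
    proof -
      have "(\<Sum>k<n. (l * h k \<omega>) * \<xi> k \<omega> + (- (l\<^sup>2 * ((h k \<omega>)\<^sup>2 * q k \<omega>)))) =
        l * ((\<Sum>k<n. h k \<omega> * \<xi> k \<omega>) - l * (\<Sum>k<n. (h k \<omega>)\<^sup>2 * q k \<omega>))"
        unfolding right_diff_distrib sum_distrib_left sum_subtractf[symmetric]
        by (intro sum.cong) (auto simp: power2_eq_square)
      with j[of n] have "(\<Sum>k<n. h k \<omega> * \<xi> k \<omega>) - l * (\<Sum>k<n. (h k \<omega>)\<^sup>2 * q k \<omega>) < real j / l"
        using l by (simp add: pos_less_divide_eq mult.commute)
      thus ?thesis by simp
    qed
    thus ?case by blast
  qed
qed

text \<open>Up to a random constant, a martingale is at most an arbitrarily small fraction of its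
  conditional variance. Cutting \<open>h\<close> off at 1 is predictable and changes only finitely
  many terms on the paths considered; the slopes 1/(i+1) keep the null sets countable.\<close>

lemma martingale_growth:
  assumes h: "\<And>k. h k \<in> borel_measurable (F k)"
  shows "AE \<omega> in M. (\<forall>\<^sub>F k in sequentially. \<bar>h k \<omega>\<bar> \<le> 1) \<longrightarrow>
    (\<forall>l>0. \<exists>C. \<forall>n. \<bar>\<Sum>k<n. h k \<omega> * \<xi> k \<omega>\<bar> \<le> C + l * (\<Sum>k<n. (h k \<omega>)\<^sup>2 * q k \<omega>))"
proof -
  define h' where "h' k \<omega> = (if \<bar>h k \<omega>\<bar> \<le> 1 then h k \<omega> else 0)" for k \<omega>
  have h'm: "h' k \<in> borel_measurable (F k)" for k
    unfolding h'_def using h[of k] by measurable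
  have h'm': "(\<lambda>\<omega>. - h' k \<omega>) \<in> borel_measurable (F k)" for k
    using h'm[of k] by measurable
  have "AE \<omega> in M. \<forall>i. \<exists>C. \<forall>n. (\<Sum>k<n. h' k \<omega> * \<xi> k \<omega>) \<le> C + (1 / real (Suc i)) * (\<Sum>k<n. (h' k \<omega>)\<^sup>2 * q k \<omega>)"
    unfolding AE_all_countable
    by (intro allI martingale_growth_upper h'm) (auto simp: h'_def)
  moreover have "AE \<omega> in M. \<forall>i. \<exists>C. \<forall>n. (\<Sum>k<n. - h' k \<omega> * \<xi> k \<omega>) \<le> C + (1 / real (Suc i)) * (\<Sum>k<n. (- h' k \<omega>)\<^sup>2 * q k \<omega>)"
    unfolding AE_all_countable
    by (intro allI martingale_growth_upper h'm') (auto simp: h'_def)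
  ultimately show ?thesis using AE_space
  proof eventually_elim
    case (elim \<omega>)
    note w = elim(3)
    show ?case
    proof (intro impI allI)
      assume "\<forall>\<^sub>F k in sequentially. \<bar>h k \<omega>\<bar> \<le> 1"
      then obtain K where K: "\<And>k. k \<ge> K \<Longrightarrow> \<bar>h k \<omega>\<bar> \<le> 1" by (auto simp: eventually_sequentially)
      fix l :: real assume "0 < l"
      then obtain i where i: "1 / real (Suc i) < l" by (metis nat_approx_posE)
      obtain C1 where C1: "\<And>n. (\<Sum>k<n. h' k \<omega> * \<xi> k \<omega>) \<le> C1 + (1 / real (Suc i)) * (\<Sum>k<n. (h' k \<omega>)\<^sup>2 * q k \<omega>)"
        using elim(1) by blast
      obtain C2 where C2: "\<And>n. (\<Sum>k<n. - h' k \<omega> * \<xi> k \<omega>) \<le> C2 + (1 / real (Suc i)) * (\<Sum>k<n. (- h' k \<omega>)\<^sup>2 * q k \<omega>)"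
        using elim(2) by blast
      let ?D = "\<Sum>k<K. \<bar>h k \<omega> - h' k \<omega>\<bar>"
      have "\<bar>\<Sum>k<n. h k \<omega> * \<xi> k \<omega>\<bar> \<le> (\<bar>C1\<bar> + \<bar>C2\<bar> + ?D) + l * (\<Sum>k<n. (h k \<omega>)\<^sup>2 * q k \<omega>)" for n
      proof -
        have "\<bar>(\<Sum>k<n. h k \<omega> * \<xi> k \<omega>) - (\<Sum>k<n. h' k \<omega> * \<xi> k \<omega>)\<bar> = \<bar>\<Sum>k<n. (h k \<omega> - h' k \<omega>) * \<xi> k \<omega>\<bar>"
          by (simp add: sum_subtractf left_diff_distrib)
        also have "\<dots> \<le> (\<Sum>k<n. \<bar>h k \<omega> - h' k \<omega>\<bar> * 1)"
          by (rule order_trans[OF sum_abs sum_mono])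
             (use xi_abs_le[OF w] in \<open>auto simp: abs_mult intro!: mult_left_le\<close>)
        \<comment> \<open>Extending the range past \<open>K\<close> makes the collapse onto the
          first \<open>K\<close> terms valid whether or not \<open>n\<close> exceeds
          \<open>K\<close>.\<close>
        also have "\<dots> \<le> (\<Sum>k<n + K. \<bar>h k \<omega> - h' k \<omega>\<bar>)"
          by (simp, rule sum_mono2) auto
        also have "\<dots> = ?D"
          by (rule sum.mono_neutral_right) (use K in \<open>auto simp: h'_def not_less\<close>)
        finally have 1: "\<bar>(\<Sum>k<n. h k \<omega> * \<xi> k \<omega>) - (\<Sum>k<n. h' k \<omega> * \<xi> k \<omega>)\<bar> \<le> ?D" .
        have "(\<Sum>k<n. (h' k \<omega>)\<^sup>2 * q k \<omega>) \<le> (\<Sum>k<n. (h k \<omega>)\<^sup>2 * q k \<omega>)"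
          using q_range[OF w] by (intro sum_mono mult_right_mono) (auto simp: h'_def)
        moreover have "0 \<le> (\<Sum>k<n. (h k \<omega>)\<^sup>2 * q k \<omega>)"
          using q_range[OF w] by (intro sum_nonneg) auto
        ultimately have 2: "(1 / real (Suc i)) * (\<Sum>k<n. (h' k \<omega>)\<^sup>2 * q k \<omega>) \<le> l * (\<Sum>k<n. (h k \<omega>)\<^sup>2 * q k \<omega>)"
          using i by (intro mult_mono') (auto intro!: sum_nonneg simp: q_range[OF w])
        have "- (\<Sum>k<n. h' k \<omega> * \<xi> k \<omega>) \<le> C2 + (1 / real (Suc i)) * (\<Sum>k<n. (h' k \<omega>)\<^sup>2 * q k \<omega>)"
          using C2[of n] by (simp add: sum_negf)
        thus ?thesis using 1 2 C1[of n] by linarith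
      qed
      thus "\<exists>C. \<forall>n. \<bar>\<Sum>k<n. h k \<omega> * \<xi> k \<omega>\<bar> \<le> C + l * (\<Sum>k<n. (h k \<omega>)\<^sup>2 * q k \<omega>)" by blast
    qed
  qed
qed

end

section \<open>The law of the iterated logarithm\<close>

locale weighted_draws = bernoulli_draws M F p \<epsilon>
  for M :: "'w measure" and F :: "nat \<Rightarrow> 'w measure" and p \<epsilon> :: "nat \<Rightarrow> 'w \<Rightarrow> real" +
  fixes b :: "nat \<Rightarrow> real" and B :: real
  assumes b_bound: "\<And>k. \<bar>b k\<bar> \<le> B"
    and nu_at_top: "filterlim (\<lambda>n. \<Sum>k<n. (b k)\<^sup>2) at_top sequentially"
begin

definition \<nu> :: "nat \<Rightarrow> real" where "\<nu> n = (\<Sum>k<n. (b k)\<^sup>2)"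

lemma nu_lim: "filterlim \<nu> at_top sequentially"
  using nu_at_top by (simp add: \<nu>_def[abs_def])

lemma nu_mono: "m \<le> n \<Longrightarrow> \<nu> m \<le> \<nu> n"
  unfolding \<nu>_def by (rule sum_mono2) auto

lemma nu_Suc: "\<nu> (Suc n) = \<nu> n + (b n)\<^sup>2"
  by (simp add: \<nu>_def)

lemma b_square_le: "(b k)\<^sup>2 \<le> B\<^sup>2"
  using b_bound[of k] by (simp add: abs_le_square_iff[symmetric])

lemma B_nonneg: "0 \<le> B"
  using b_bound[of 0] by linarith

text \<open>Write \<open>\<gamma>\<close> as the square of \<open>\<rho>\<close>. One factor
  \<open>\<rho>\<close> covers the Bernoulli error 1 + |h| and makes j^(-\<rho>) summable. The other
  covers the position of \<open>\<nu> n\<close> inside its block and the comparison of ln j with ln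
  ln of \<open>\<nu> n\<close>. A general \<open>h\<close> below \<open>b\<close> is allowed so that
  cut-off weights can be used.\<close>

lemma lil_upper:
  assumes h: "\<And>k. h k \<in> borel_measurable (F k)"
    and hb: "\<And>k \<omega>. \<omega> \<in> space M \<Longrightarrow> \<bar>h k \<omega>\<bar> \<le> \<bar>b k\<bar>"
    and hq: "\<And>k \<omega>. \<omega> \<in> space M \<Longrightarrow> (h k \<omega>)\<^sup>2 * q k \<omega> \<le> (b k)\<^sup>2 * r"
    and r: "0 < r" and \<gamma>: "1 < \<gamma>"
  shows "AE \<omega> in M. \<forall>\<^sub>F n in sequentially.
    (\<Sum>k<n. h k \<omega> * \<xi> k \<omega>) \<le> \<gamma> * sqrt (2 * r * \<nu> n * ln (ln (\<nu> n)))"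
proof -
  define \<rho> where "\<rho> = sqrt \<gamma>"
  have \<rho>: "1 < \<rho>" "\<rho> * \<rho> = \<gamma>" using \<gamma> by (auto simp: \<rho>_def)
  \<comment> \<open>The tilt that balances the level \<open>\<rho> * ln j\<close> against the
    compensator at the upper end \<open>\<rho> ^ Suc j\<close> of the block: there both are equal,
    which minimises their sum divided by the tilt.\<close>
  define \<theta> where "\<theta> j = sqrt (2 * ln (real j) / (r * \<rho> ^ Suc j))" for j
  have "(\<lambda>j. \<theta> j * B) \<longlonglongrightarrow> 0"
    unfolding \<theta>_def using \<rho>(1) r by real_asymp
  hence "\<forall>\<^sub>F j in sequentially. \<theta> j * B < min 1 (\<rho> - 1)"
    by (rule order_tendstoD) (use \<rho> in auto)
  moreover have "\<forall>\<^sub>F j in sequentially. j \<ge> (2::nat)" by (rule eventually_ge_at_top)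
  ultimately have "\<forall>\<^sub>F j in sequentially. \<theta> j * B < min 1 (\<rho> - 1) \<and> j \<ge> 2" by (rule eventually_conj)
  then obtain J where J: "\<And>j. j \<ge> J \<Longrightarrow> \<theta> j * B < min 1 (\<rho> - 1)" "\<And>j. j \<ge> J \<Longrightarrow> j \<ge> 2"
    by (auto simp: eventually_sequentially)
  have l0: "0 \<le> \<theta> j" for j
    unfolding \<theta>_def using r \<rho> by (cases "j = 0") auto
  have "AE \<omega> in M. \<forall>\<^sub>F j in sequentially. \<forall>n. (\<Sum>k<n. (\<theta> j * h k \<omega>) * \<xi> k \<omega> + (- ((\<theta> j)\<^sup>2 * \<rho> * r / 2 * (b k)\<^sup>2))) < \<rho> * ln (real j)"
  proof (rule borel_cantelli_ville[where J = J])
    show "(\<lambda>\<omega>. \<theta> j * h k \<omega>) \<in> borel_measurable (F k)" for j k using h[of k] by simp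
    show "(\<lambda>\<omega>. - ((\<theta> j)\<^sup>2 * \<rho> * r / 2 * (b k)\<^sup>2)) \<in> borel_measurable (F k)" for j k by simp
    fix j k \<omega> assume j: "J \<le> j" and w: "\<omega> \<in> space M"
    have "\<bar>\<theta> j * h k \<omega>\<bar> \<le> \<theta> j * B"
      using l0[of j] hb[OF w, of k] b_bound[of k] by (auto simp: abs_mult intro!: mult_left_mono)
    hence 1: "\<bar>\<theta> j * h k \<omega>\<bar> < min 1 (\<rho> - 1)" using J(1)[OF j] by linarith
    thus "\<bar>\<theta> j * h k \<omega>\<bar> \<le> 1" by simp
    have "(\<theta> j * h k \<omega>)\<^sup>2 * q k \<omega> / 2 * (1 + \<bar>\<theta> j * h k \<omega>\<bar>) \<le> ((\<theta> j)\<^sup>2 * ((b k)\<^sup>2 * r) / 2) * \<rho>"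
      using 1 q_range[OF w, of k] hq[OF w, of k] r \<rho>
      by (intro mult_mono) (auto simp: power_mult_distrib mult.assoc intro!: mult_left_mono)
    thus "- ((\<theta> j)\<^sup>2 * \<rho> * r / 2 * (b k)\<^sup>2) + (\<theta> j * h k \<omega>)\<^sup>2 * q k \<omega> / 2 * (1 + \<bar>\<theta> j * h k \<omega>\<bar>) \<le> 0"
      by (simp add: mult_ac)
  next
    have "summable (\<lambda>j. real j powr (- \<rho>))" using \<rho> by (simp add: summable_real_powr_iff)
    moreover have "\<forall>\<^sub>F j in sequentially. exp (- (\<rho> * ln (real j))) = real j powr (- \<rho>)"
      using eventually_gt_at_top[of 0] by eventually_elim (simp add: powr_def)
    ultimately show "summable (\<lambda>j. exp (- (\<rho> * ln (real j))))"
      by (subst summable_cong)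
  qed
  thus ?thesis
  proof eventually_elim
    case (elim \<omega>)
    let ?S = "\<lambda>n. \<Sum>k<n. h k \<omega> * \<xi> k \<omega>"
    have main: "\<forall>\<^sub>F j in sequentially. \<forall>n. \<nu> n \<le> \<rho> ^ Suc j \<longrightarrow> ?S n \<le> \<rho> * sqrt (2 * r * \<rho> ^ Suc j * ln (real j))"
      using elim eventually_ge_at_top[of 2]
    proof eventually_elim
      case (elim j)
      show ?case
      proof (intro allI impI)
        fix n assume n: "\<nu> n \<le> \<rho> ^ Suc j"
        have lj: "ln (real j) > 0" using elim by simp
        have lp: "\<theta> j > 0" unfolding \<theta>_def using lj r \<rho> by simp
        let ?P = "\<rho> ^ Suc j"
        have P: "?P > 0" using \<rho> by simp
        have lsq: "(\<theta> j)\<^sup>2 * (r * ?P) = 2 * ln (real j)"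
          unfolding \<theta>_def using lj r P \<rho> by (simp add: real_sqrt_pow2)
        have "\<theta> j * ?S n - (\<theta> j)\<^sup>2 * \<rho> * r / 2 * \<nu> n =
          (\<Sum>k<n. (\<theta> j * h k \<omega>) * \<xi> k \<omega> + (- ((\<theta> j)\<^sup>2 * \<rho> * r / 2 * (b k)\<^sup>2)))"
          unfolding \<nu>_def sum_distrib_left sum_subtractf[symmetric] by (simp add: mult.assoc)
        also have "\<dots> < \<rho> * ln (real j)" using elim by blast
        finally have "\<theta> j * ?S n < \<rho> * ln (real j) + (\<theta> j)\<^sup>2 * \<rho> * r / 2 * \<nu> n" by simp
        also have "\<dots> \<le> \<rho> * ln (real j) + (\<theta> j)\<^sup>2 * \<rho> * r / 2 * ?P"
          using n r \<rho> by (intro add_left_mono mult_left_mono) auto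
        also have "\<dots> = \<rho> * ln (real j) + \<rho> / 2 * ((\<theta> j)\<^sup>2 * (r * ?P))" by simp
        also have "\<dots> = \<rho> * (2 * ln (real j))" unfolding lsq by simp
        also have "2 * ln (real j) = \<theta> j * (\<theta> j * (r * ?P))" using lsq by (simp add: power2_eq_square)
        also have "\<theta> j * (r * ?P) = sqrt ((\<theta> j)\<^sup>2 * (r * ?P) * (r * ?P))"
          by (rule real_sqrt_unique[symmetric]) (use lp r P in \<open>auto simp: power2_eq_square\<close>)
        also have "\<dots> = sqrt (2 * r * ?P * ln (real j))" unfolding lsq by (simp add: mult_ac)
        finally have "\<theta> j * ?S n < \<theta> j * (\<rho> * sqrt (2 * r * ?P * ln (real j)))" by (simp add: mult_ac)
        thus "?S n \<le> \<rho> * sqrt (2 * r * ?P * ln (real j))" using lp by simp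
      qed
    qed
    \<comment> \<open>The block of \<open>n\<close>:
      \<open>\<rho> ^ j n \<le> \<nu> n < \<rho> ^ Suc (j n)\<close>.\<close>
    define j where "j n = nat \<lfloor>log \<rho> (\<nu> n)\<rfloor>" for n
    have lim_j: "filterlim j at_top sequentially"
    proof -
      have "filterlim (\<lambda>x. nat \<lfloor>log \<rho> x\<rfloor>) at_top at_top"
        using \<rho>(1) by real_asymp
      from filterlim_compose[OF this nu_lim] show ?thesis by (simp add: j_def[abs_def])
    qed
    have "\<forall>\<^sub>F x in at_top. ln (ln x / ln \<rho>) \<le> \<rho> * ln (ln x)" "\<forall>\<^sub>F x::real in at_top. 0 \<le> ln (ln x)"
      using \<rho>(1) by real_asymp+
    from this[THEN eventually_compose_filterlim[OF _ nu_lim]]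
    have "\<forall>\<^sub>F n in sequentially. ln (ln (\<nu> n) / ln \<rho>) \<le> \<rho> * ln (ln (\<nu> n))" "\<forall>\<^sub>F n in sequentially. 0 \<le> ln (ln (\<nu> n))"
      by auto
    moreover have "\<forall>\<^sub>F n in sequentially. \<nu> n > \<rho>"
      using nu_lim by (auto simp: filterlim_at_top_dense)
    moreover have "\<forall>\<^sub>F n in sequentially. j n \<ge> 2" using lim_j by (auto simp: filterlim_at_top)
    ultimately show ?case using eventually_compose_filterlim[OF main lim_j]
    proof eventually_elim
      case (elim n)
      have pos: "\<nu> n > 0" using elim \<rho> by simp
      have lg: "0 \<le> \<lfloor>log \<rho> (\<nu> n)\<rfloor>" using elim \<rho> by (simp add: le_log_iff)
      hence rj: "real (j n) = of_int \<lfloor>log \<rho> (\<nu> n)\<rfloor>" by (simp add: j_def)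
      have j1: "real (j n) \<le> log \<rho> (\<nu> n)" "log \<rho> (\<nu> n) < real (Suc (j n))"
        using rj by linarith+
      have p1: "\<rho> ^ j n \<le> \<nu> n"
        using j1(1) pos \<rho> by (simp add: le_log_iff powr_realpow)
      have p2: "\<nu> n < \<rho> ^ Suc (j n)"
        using j1(2) pos \<rho> by (subst (asm) log_less_iff) (auto simp: powr_realpow simp flip: of_nat_Suc simp del: power_Suc)
      have lj: "ln (real (j n)) \<le> \<rho> * ln (ln (\<nu> n))"
      proof -
        have "ln (real (j n)) \<le> ln (ln (\<nu> n) / ln \<rho>)"
          using j1(1) elim by (subst ln_le_cancel_iff) (auto simp: log_def)
        thus ?thesis using elim by linarith
      qed
      have "?S n \<le> \<rho> * sqrt (2 * r * \<rho> ^ Suc (j n) * ln (real (j n)))"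
        using elim p2 by (meson less_imp_le)
      also have "\<dots> \<le> \<rho> * sqrt (2 * r * (\<rho> * \<nu> n) * (\<rho> * ln (ln (\<nu> n))))"
        using p1 \<rho> r lj elim by (intro mult_left_mono real_sqrt_le_mono mult_mono) auto
      also have "2 * r * (\<rho> * \<nu> n) * (\<rho> * ln (ln (\<nu> n))) = \<rho>\<^sup>2 * (2 * r * \<nu> n * ln (ln (\<nu> n)))"
        by (simp add: power2_eq_square mult_ac)
      also have "\<rho> * sqrt (\<rho>\<^sup>2 * (2 * r * \<nu> n * ln (ln (\<nu> n)))) = \<gamma> * sqrt (2 * r * \<nu> n * ln (ln (\<nu> n)))"
        using \<rho> by (simp add: real_sqrt_mult)
      finally show ?case .
    qed
  qed
qed

end

context bernoulli_draws
begin

text \<open>Independence is replaced by a lower bound \<open>c j\<close> on the conditional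
  probability of \<open>H j\<close>, phrased over all events of the past. Applied to the event that
  none of H K, ..., H (n-1) occurred, it shrinks that event by a factor at most 1 - c n, hence at
  most exp(-c n).\<close>

lemma second_borel_cantelli:
  fixes c :: "nat \<Rightarrow> real"
  assumes t: "mono t" and H: "\<And>j. H j \<in> sets (F (t (Suc j)))"
    and c0: "\<And>j. 0 \<le> c j" and c: "\<not> summable c"
    and le: "\<And>j A. j \<ge> J \<Longrightarrow> A \<in> sets (F (t j)) \<Longrightarrow> c j * prob A \<le> prob (A \<inter> H j)"
  shows "AE \<omega> in M. \<exists>\<^sub>F j in sequentially. \<omega> \<in> H j"
proof -
  have HM [measurable]: "H j \<in> sets M" for j using H by (rule F_sets)
  have null: "AE \<omega> in M. \<exists>j\<ge>K. \<omega> \<in> H j" if K: "K \<ge> J" for K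
  proof -
    define A where "A n = space M - (\<Union>j\<in>{K..<n}. H j)" for n
    have AF: "A n \<in> sets (F (t n))" for n
    proof -
      have "H j \<in> sets (F (t n))" if "j \<in> {K..<n}" for j
        using H[of j] sets_F_mono[of "t (Suc j)" "t n"] monoD[OF t, of "Suc j" n] that by auto
      hence "(\<Union>j\<in>{K..<n}. H j) \<in> sets (F (t n))" by (intro sets.finite_UN) auto
      hence "space (F (t n)) - (\<Union>j\<in>{K..<n}. H j) \<in> sets (F (t n))" by (rule sets.compl_sets)
      thus ?thesis unfolding A_def space_F .
    qed
    have AM [measurable]: "A n \<in> sets M" for n using AF by (rule F_sets)
    have PA: "prob (A n) \<le> exp (- (\<Sum>j=K..<n. c j))" if "K \<le> n" for n
      using that
    proof (induction n rule: dec_induct)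
      case base
      thus ?case by simp
    next
      case (step n)
      have "A (Suc n) = A n - (A n \<inter> H n)" using step(1) by (auto simp: A_def less_Suc_eq)
      hence "prob (A (Suc n)) = prob (A n) - prob (A n \<inter> H n)"
        using AM[of n] HM[of n] by (simp only:) (intro finite_measure_Diff, auto)
      also have "\<dots> \<le> prob (A n) * (1 - c n)"
        using le[of n "A n", OF _ AF] step(1) K by (simp add: algebra_simps)
      also have "\<dots> \<le> prob (A n) * exp (- c n)"
        using exp_ge_add_one_self[of "- c n"] by (intro mult_left_mono) auto
      also have "\<dots> \<le> exp (- (\<Sum>j=K..<n. c j)) * exp (- c n)"
        using step by (intro mult_right_mono) auto
      also have "\<dots> = exp (- (\<Sum>j=K..<Suc n. c j))"
        using step(1) by (simp add: exp_add[symmetric])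
      finally show ?case .
    qed
    define Z where "Z = (\<Inter>n. A n)"
    have ZM: "Z \<in> sets M" unfolding Z_def by (rule sets.countable_INT) auto
    have "prob Z \<le> e" if e: "0 < e" for e
    proof -
      have "\<not> (\<forall>n. (\<Sum>j<n. c j) \<le> (\<Sum>j<K. c j) - ln e)"
        using c c0 summableI_nonneg_bounded[of c] by blast
      then obtain n where n: "(\<Sum>j<K. c j) - ln e < (\<Sum>j<n. c j)" by (auto simp: not_le)
      also have "\<dots> \<le> (\<Sum>j<n+K. c j)" by (rule sum_mono2) (auto simp: c0)
      also have "\<dots> = (\<Sum>j<K. c j) + (\<Sum>j=K..<n+K. c j)"
        by (simp add: sum.atLeastLessThan_concat[of 0 K "n+K", symmetric] lessThan_atLeast0)
      finally have "- ln e < (\<Sum>j=K..<n+K. c j)" by simp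
      hence "- (\<Sum>j=K..<n+K. c j) \<le> ln e" by simp
      hence "exp (- (\<Sum>j=K..<n+K. c j)) \<le> exp (ln e)" by (subst exp_le_cancel_iff)
      moreover have "prob Z \<le> prob (A (n+K))" by (rule finite_measure_mono) (auto simp: Z_def)
      ultimately show ?thesis using PA[of "n+K"] e by simp
    qed
    hence "prob Z \<le> 0" by (rule field_le_epsilon) simp
    hence "Z \<in> null_sets M" using ZM by (auto simp: emeasure_eq_measure measure_nonneg antisym)
    hence "AE \<omega> in M. \<omega> \<notin> Z" by (rule AE_not_in)
    thus ?thesis using AE_space by eventually_elim (auto simp: Z_def A_def)
  qed
  have "AE \<omega> in M. \<forall>K. \<exists>j\<ge>J+K. \<omega> \<in> H j"
    unfolding AE_all_countable using null by auto
  thus ?thesis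
    by eventually_elim (unfold frequently_sequentially, meson le_add2 order_trans)
qed

end

section \<open>Lower half of the law of the iterated logarithm, block by block\<close>

context weighted_draws
begin

text \<open>
  At the times when the conditional variance is not yet close to \<open>Q\<close>, the increment is replaced by a
  deterministic drift, so that the probability of the event is bounded below without any assumption on the past.
\<close>

lemma lil_lower_block:
  fixes \<delta> \<theta> Q :: real and s t :: nat
  defines "V \<equiv> Q * (\<nu> t - \<nu> s)"
  defines "N \<equiv> \<lambda>\<omega>. \<Sum>k=s..<t. if \<bar>q k \<omega> - Q\<bar> \<le> \<delta>\<^sup>2/40 * Q then b k * \<xi> k \<omega> else \<theta> * (b k)\<^sup>2 * Q"
  assumes st: "s \<le> t" and \<delta>: "0 < \<delta>" "\<delta> \<le> 1" and Q: "0 < Q" and \<theta>: "0 \<le> \<theta>" "2 * \<theta> * B \<le> \<delta>\<^sup>2/80"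
    and T: "4 * ln 4 \<le> \<theta>\<^sup>2 * V * \<delta>\<^sup>2"
  shows lil_lower_block_sets: "{\<omega> \<in> space M. (1 - \<delta>) * \<theta> * V \<le> N \<omega>} \<in> sets (F t)"
    and lil_lower_block_prob: "A \<in> sets (F s) \<Longrightarrow>
      exp (- (\<theta>\<^sup>2 * V * (1/2 + 2 * \<delta>))) / 2 * prob A \<le> prob (A \<inter> {\<omega> \<in> space M. (1 - \<delta>) * \<theta> * V \<le> N \<omega>})"
proof -
  define G where "G k \<omega> \<longleftrightarrow> \<bar>q k \<omega> - Q\<bar> \<le> \<delta>\<^sup>2/40 * Q" for k \<omega>
  have Gm: "Measurable.pred (F k) (G k)" for k
    unfolding G_def[abs_def] using q_meas[of k] by measurable
  \<comment> \<open>The exponent for the tilt \<open>(1 + \<kappa>) * \<theta>\<close>. At the bad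
    times \<open>g\<close> is what a draw of variance exactly \<open>Q\<close> would contribute to
    the logarithmic moment. Hence the logarithmic moment of the block is close to
    \<open>(1 + \<kappa>)\<^sup>2 * T / 2\<close>, with \<open>T = \<theta>\<^sup>2 * V\<close>,
    whatever the path does.\<close>
  define h where "h \<kappa> k \<omega> = (if G k \<omega> then (1 + \<kappa>) * \<theta> * b k else 0)" for \<kappa> :: real and k \<omega>
  define g where "g \<kappa> k \<omega> = (if G k \<omega> then 0 else (1 + \<kappa>)\<^sup>2 * \<theta>\<^sup>2 * (b k)\<^sup>2 * Q / 2)" for \<kappa> :: real and k \<omega>
  have hm: "h \<kappa> k \<in> borel_measurable (F k)" and gm: "g \<kappa> k \<in> borel_measurable (F k)" for \<kappa> k
    unfolding h_def[abs_def] g_def[abs_def] using Gm[of k] by measurable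
  define N1 where "N1 \<omega> = (\<Sum>k=s..<t. (if G k \<omega> then b k else 0) * \<xi> k \<omega> + (if G k \<omega> then 0 else \<theta> * (b k)\<^sup>2 * Q))" for \<omega>
  have N1: "N1 \<in> borel_measurable (F t)"
    unfolding N1_def[abs_def] using F_meas_sum[of "\<lambda>k \<omega>. if G k \<omega> then b k else 0"
       "\<lambda>k \<omega>. if G k \<omega> then 0 else \<theta> * (b k)\<^sup>2 * Q" s t] Gm st by measurable
  have NN: "N \<omega> = N1 \<omega>" for \<omega>
    unfolding N_def N1_def G_def by (intro sum.cong) auto
  define H where "H = {\<omega> \<in> space M. (1 - \<delta>) * \<theta> * V \<le> N1 \<omega>}"
  have "{\<omega> \<in> space (F t). (1 - \<delta>) * \<theta> * V \<le> N1 \<omega>} \<in> sets (F t)"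
    using N1 by measurable
  hence HF: "H \<in> sets (F t)" unfolding H_def space_F .
  thus "{\<omega> \<in> space M. (1 - \<delta>) * \<theta> * V \<le> N \<omega>} \<in> sets (F t)" unfolding NN H_def .
  have HM [measurable]: "H \<in> sets M" using HF by (rule F_sets)
  define T where "T = \<theta>\<^sup>2 * V"
  have V: "V = (\<Sum>k=s..<t. (b k)\<^sup>2 * Q)"
    using st by (simp add: V_def \<nu>_def sum_distrib_left sum_distrib_right right_diff_distrib
        sum_diff_nat_ivl[of 0 s t, symmetric] lessThan_atLeast0 mult.commute)
  have V0: "0 \<le> V" unfolding V using Q by (intro sum_nonneg) auto
  have T0: "0 \<le> T" unfolding T_def using V0 by simp
  have d1: "\<delta>\<^sup>2 \<le> 1" "\<delta>\<^sup>2 \<le> \<delta>" using \<delta> by (auto simp: power2_eq_square mult_left_le mult_le_one)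
  have hle: "\<bar>h \<kappa> k \<omega>\<bar> \<le> \<delta>\<^sup>2/80" if "\<bar>\<kappa>\<bar> \<le> \<delta>" for \<kappa> k \<omega>
  proof -
    have "\<bar>(1 + \<kappa>) * \<theta> * b k\<bar> \<le> 2 * \<theta> * B"
      using that \<delta> \<theta> b_bound[of k] by (auto simp: abs_mult intro!: mult_mono)
    thus ?thesis using \<theta> by (auto simp: h_def)
  qed
  have hle1: "\<bar>h \<kappa> k \<omega>\<bar> \<le> 1" if "\<bar>\<kappa>\<bar> \<le> \<delta>" for \<kappa> k \<omega>
    using hle[OF that, of k \<omega>] d1 by linarith
  have Gq: "q k \<omega> \<le> Q * (1 + \<delta>\<^sup>2/40)" "Q * (1 - \<delta>\<^sup>2/40) \<le> q k \<omega>" if "G k \<omega>" for k \<omega>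
  proof -
    define X where "X = \<delta>\<^sup>2/40 * Q"
    have "Q * (1 + \<delta>\<^sup>2/40) = Q + X" "Q * (1 - \<delta>\<^sup>2/40) = Q - X"
      unfolding X_def by (simp_all add: algebra_simps)
    moreover have "q k \<omega> - Q \<le> X" "- (q k \<omega> - Q) \<le> X"
      using that unfolding G_def X_def abs_le_iff by blast+
    ultimately show "q k \<omega> \<le> Q * (1 + \<delta>\<^sup>2/40)" "Q * (1 - \<delta>\<^sup>2/40) \<le> q k \<omega>"
      by simp_all
  qed
  \<comment> \<open>Error budget: \<open>\<delta>\<^sup>2/40\<close> from the variance, and from the
    tilt \<open>\<delta>\<^sup>2/80\<close> above or twice that below; each product fits into a
    relative error \<open>\<delta>\<^sup>2/10\<close>.\<close>
  have qup: "q k \<omega> * (1 + \<bar>h \<kappa> k \<omega>\<bar>) \<le> Q * (1 + \<delta>\<^sup>2/10)" if "\<bar>\<kappa>\<bar> \<le> \<delta>" "G k \<omega>" for \<kappa> k \<omega>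
  proof -
    have "q k \<omega> * (1 + \<bar>h \<kappa> k \<omega>\<bar>) \<le> (Q * (1 + \<delta>\<^sup>2/40)) * (1 + \<delta>\<^sup>2/80)"
      using Gq(1)[OF that(2)] Q hle[OF that(1), of k \<omega>] by (intro mult_mono) auto
    also have "\<dots> = Q * ((1 + \<delta>\<^sup>2/40) * (1 + \<delta>\<^sup>2/80))" by simp
    also have "\<dots> \<le> Q * (1 + \<delta>\<^sup>2/10)"
    proof (intro mult_left_mono)
      have "\<delta>\<^sup>2 * \<delta>\<^sup>2 \<le> \<delta>\<^sup>2 * 1" using d1 by (intro mult_left_mono) auto
      moreover have "(1 + D/40) * (1 + D/80) \<le> 1 + D/10" if "0 \<le> D" "D * D \<le> D * 1" for D :: real
        using that by (simp add: field_simps)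
      ultimately show "(1 + \<delta>\<^sup>2/40) * (1 + \<delta>\<^sup>2/80) \<le> 1 + \<delta>\<^sup>2/10" by simp
    qed (use Q in auto)
    finally show ?thesis .
  qed
  have qlo: "Q * (1 - \<delta>\<^sup>2/10) \<le> q k \<omega> * (1 - 2 * \<bar>h 0 k \<omega>\<bar>)" if "G k \<omega>" for k \<omega>
  proof -
    have "Q * (1 - \<delta>\<^sup>2/10) \<le> Q * ((1 - \<delta>\<^sup>2/40) * (1 - \<delta>\<^sup>2/40))"
      using Q by (intro mult_left_mono) (auto simp: algebra_simps)
    also have "\<dots> = (Q * (1 - \<delta>\<^sup>2/40)) * (1 - \<delta>\<^sup>2/40)" by simp
    also have "\<dots> \<le> q k \<omega> * (1 - 2 * \<bar>h 0 k \<omega>\<bar>)"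
    proof (intro mult_mono)
      show "Q * (1 - \<delta>\<^sup>2/40) \<le> q k \<omega>" by (rule Gq(2)[OF that])
      moreover have "0 \<le> Q * (1 - \<delta>\<^sup>2/40)" using Q d1 by simp
      ultimately show "0 \<le> q k \<omega>" by linarith
    qed (use hle[of 0 k \<omega>] d1 \<delta> in auto)
    finally show ?thesis .
  qed
  let ?W = "\<lambda>\<kappa> \<omega>. \<Sum>k=s..<t. h \<kappa> k \<omega> * \<xi> k \<omega> + g \<kappa> k \<omega>"
  have upper: "(\<integral>\<^sup>+\<omega>. indicator A \<omega> * ennreal (exp (?W \<kappa> \<omega>)) \<partial>M)
      \<le> ennreal (exp ((1 + \<kappa>)\<^sup>2 * T * (1 + \<delta>\<^sup>2/10) / 2)) * emeasure M A" if A: "A \<in> sets (F s)" and \<kappa>: "\<bar>\<kappa>\<bar> \<le> \<delta>" for A \<kappa>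
  proof -
    have "(\<integral>\<^sup>+\<omega>. indicator A \<omega> * ennreal (exp (?W \<kappa> \<omega>)) \<partial>M)
        \<le> ennreal (exp (\<Sum>k=s..<t. (1 + \<kappa>)\<^sup>2 * \<theta>\<^sup>2 * (b k)\<^sup>2 / 2 * (Q * (1 + \<delta>\<^sup>2/10)))) * emeasure M A"
    proof (rule exp_block_le[OF hm gm A st hle1[OF \<kappa>]])
      fix k \<omega> assume "\<omega> \<in> space M"
      show "g \<kappa> k \<omega> + (h \<kappa> k \<omega>)\<^sup>2 * q k \<omega> / 2 * (1 + \<bar>h \<kappa> k \<omega>\<bar>) \<le> (1 + \<kappa>)\<^sup>2 * \<theta>\<^sup>2 * (b k)\<^sup>2 / 2 * (Q * (1 + \<delta>\<^sup>2/10))"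
      proof (cases "G k \<omega>")
        case True
        have "(1 + \<kappa>)\<^sup>2 * \<theta>\<^sup>2 * (b k)\<^sup>2 / 2 * (q k \<omega> * (1 + \<bar>h \<kappa> k \<omega>\<bar>)) \<le> (1 + \<kappa>)\<^sup>2 * \<theta>\<^sup>2 * (b k)\<^sup>2 / 2 * (Q * (1 + \<delta>\<^sup>2/10))"
          by (intro mult_left_mono qup \<kappa> True) auto
        thus ?thesis using True by (simp add: g_def h_def power_mult_distrib mult_ac)
      next
        case False
        have "(1 + \<kappa>)\<^sup>2 * \<theta>\<^sup>2 * (b k)\<^sup>2 / 2 * (Q * 1) \<le> (1 + \<kappa>)\<^sup>2 * \<theta>\<^sup>2 * (b k)\<^sup>2 / 2 * (Q * (1 + \<delta>\<^sup>2/10))"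
          using Q by (intro mult_left_mono) auto
        thus ?thesis using False by (simp add: g_def h_def)
      qed
    qed
    also have "(\<Sum>k=s..<t. (1 + \<kappa>)\<^sup>2 * \<theta>\<^sup>2 * (b k)\<^sup>2 / 2 * (Q * (1 + \<delta>\<^sup>2/10))) = (1 + \<kappa>)\<^sup>2 * T * (1 + \<delta>\<^sup>2/10) / 2"
      unfolding T_def V sum_distrib_left sum_distrib_right sum_divide_distrib by (intro sum.cong) auto
    finally show ?thesis .
  qed
  have lower: "ennreal (exp (T * (1 - \<delta>\<^sup>2/10) / 2)) * emeasure M A \<le> (\<integral>\<^sup>+\<omega>. indicator A \<omega> * ennreal (exp (?W 0 \<omega>)) \<partial>M)"
    if A: "A \<in> sets (F s)" for A
  proof -
    have "ennreal (exp (\<Sum>k=s..<t. \<theta>\<^sup>2 * (b k)\<^sup>2 / 2 * (Q * (1 - \<delta>\<^sup>2/10)))) * emeasure M A \<le> (\<integral>\<^sup>+\<omega>. indicator A \<omega> * ennreal (exp (?W 0 \<omega>)) \<partial>M)"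
    proof (rule exp_block_ge[OF hm gm A st])
      show "\<bar>h 0 k \<omega>\<bar> \<le> 1" for k \<omega> using \<delta> by (intro hle1) auto
      fix k \<omega> assume "\<omega> \<in> space M"
      show "\<theta>\<^sup>2 * (b k)\<^sup>2 / 2 * (Q * (1 - \<delta>\<^sup>2/10)) \<le> g 0 k \<omega> + (h 0 k \<omega>)\<^sup>2 * q k \<omega> / 2 * (1 - 2 * \<bar>h 0 k \<omega>\<bar>)"
      proof (cases "G k \<omega>")
        case True
        have "\<theta>\<^sup>2 * (b k)\<^sup>2 / 2 * (Q * (1 - \<delta>\<^sup>2/10)) \<le> \<theta>\<^sup>2 * (b k)\<^sup>2 / 2 * (q k \<omega> * (1 - 2 * \<bar>h 0 k \<omega>\<bar>))"
          by (intro mult_left_mono qlo True) auto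
        thus ?thesis using True by (simp add: g_def h_def power_mult_distrib mult_ac)
      next
        case False
        have "\<theta>\<^sup>2 * (b k)\<^sup>2 / 2 * (Q * (1 - \<delta>\<^sup>2/10)) \<le> \<theta>\<^sup>2 * (b k)\<^sup>2 / 2 * (Q * 1)"
          using Q by (intro mult_left_mono) auto
        thus ?thesis using False by (simp add: g_def h_def)
      qed
    qed
    also have "(\<Sum>k=s..<t. \<theta>\<^sup>2 * (b k)\<^sup>2 / 2 * (Q * (1 - \<delta>\<^sup>2/10))) = T * (1 - \<delta>\<^sup>2/10) / 2"
      unfolding T_def V sum_distrib_left sum_distrib_right sum_divide_distrib by (intro sum.cong) auto
    finally show ?thesis .
  qed
  have Wm [measurable]: "?W \<kappa> \<in> borel_measurable M" for \<kappa>
    by (rule F_meas[OF F_meas_sum]) (use hm gm st in auto)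
  \<comment> \<open>Equality term by term at the good times. At the bad ones the quadratic factor
    exceeds its linearisation by \<open>\<kappa>\<^sup>2/2\<close>, a surplus in the right
    direction.\<close>
  have W: "?W 0 \<omega> + \<kappa> * \<theta> * N1 \<omega> \<le> ?W \<kappa> \<omega>" for \<kappa> \<omega>
    unfolding N1_def sum_distrib_left sum.distrib[symmetric]
  proof (rule sum_mono)
    fix k
    have "(1 + \<kappa>)\<^sup>2 * (\<theta>\<^sup>2 * (b k)\<^sup>2 * Q) / 2 - (\<theta>\<^sup>2 * (b k)\<^sup>2 * Q) / 2 - \<kappa> * (\<theta>\<^sup>2 * (b k)\<^sup>2 * Q) = \<kappa>\<^sup>2 * (\<theta>\<^sup>2 * (b k)\<^sup>2 * Q) / 2"
      by (simp add: power2_eq_square field_simps)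
    moreover have "0 \<le> \<kappa>\<^sup>2 * (\<theta>\<^sup>2 * (b k)\<^sup>2 * Q) / 2" using Q by simp
    ultimately have "(\<theta>\<^sup>2 * (b k)\<^sup>2 * Q) / 2 + \<kappa> * (\<theta>\<^sup>2 * (b k)\<^sup>2 * Q) \<le> (1 + \<kappa>)\<^sup>2 * (\<theta>\<^sup>2 * (b k)\<^sup>2 * Q) / 2" by linarith
    thus "h 0 k \<omega> * \<xi> k \<omega> + g 0 k \<omega> + \<kappa> * \<theta> * ((if G k \<omega> then b k else 0) * \<xi> k \<omega> + (if G k \<omega> then 0 else \<theta> * (b k)\<^sup>2 * Q))
        \<le> h \<kappa> k \<omega> * \<xi> k \<omega> + g \<kappa> k \<omega>"
      by (auto simp: h_def g_def algebra_simps power2_eq_square)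
  qed
  have W0: "?W 0 \<omega> \<le> \<theta> * N1 \<omega>" for \<omega>
    unfolding N1_def sum_distrib_left
    by (rule sum_mono) (use Q \<theta> in \<open>auto simp: h_def g_def algebra_simps power2_eq_square intro!: mult_nonneg_nonneg\<close>)
  let ?e1 = "exp ((1 + \<delta>) * T)" and ?e2 = "exp (- (\<delta> * (1 + \<delta>) * T))" and ?e3 = "exp (\<delta> * (1 - \<delta>) * T)"
  text \<open>Outside \<open>(1 - \<delta>)\<theta>V \<le> N \<le> (1 + \<delta>)\<theta>V\<close> one of the exponentials with a shifted parameter
    dominates, which is the tilting argument without a change of measure.\<close>
  have point: "exp (?W 0 \<omega>) \<le> ?e1 * indicator H \<omega> + ?e2 * exp (?W \<delta> \<omega>) + ?e3 * exp (?W (-\<delta>) \<omega>)"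
    if w: "\<omega> \<in> space M" for \<omega>
  proof -
    consider "N1 \<omega> < (1 - \<delta>) * \<theta> * V" | "N1 \<omega> > (1 + \<delta>) * \<theta> * V" | "\<omega> \<in> H" "N1 \<omega> \<le> (1 + \<delta>) * \<theta> * V"
      using w unfolding H_def by force
    thus ?thesis
    proof cases
      case 1
      have "\<delta> * \<theta> * N1 \<omega> \<le> \<delta> * \<theta> * ((1 - \<delta>) * \<theta> * V)" using 1 \<delta> \<theta> by (intro mult_left_mono) auto
      also have "\<dots> = \<delta> * (1 - \<delta>) * T" by (simp add: T_def power2_eq_square)
      finally have "?W 0 \<omega> \<le> \<delta> * (1 - \<delta>) * T + ?W (-\<delta>) \<omega>" using W[of \<omega> "-\<delta>"] by simp
      hence "exp (?W 0 \<omega>) \<le> ?e3 * exp (?W (-\<delta>) \<omega>)" by (simp add: exp_add[symmetric])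
      thus ?thesis by (simp add: add_increasing)
    next
      case 2
      have "\<delta> * \<theta> * ((1 + \<delta>) * \<theta> * V) \<le> \<delta> * \<theta> * N1 \<omega>" using 2 \<delta> \<theta> by (intro mult_left_mono) auto
      moreover have "\<delta> * \<theta> * ((1 + \<delta>) * \<theta> * V) = \<delta> * (1 + \<delta>) * T" by (simp add: T_def power2_eq_square)
      ultimately have "?W 0 \<omega> \<le> - (\<delta> * (1 + \<delta>) * T) + ?W \<delta> \<omega>" using W[of \<omega> \<delta>] by simp
      hence "exp (?W 0 \<omega>) \<le> ?e2 * exp (?W \<delta> \<omega>)" by (simp add: exp_add[symmetric])
      thus ?thesis by (simp add: add_increasing add_increasing2)
    next
      case 3
      have "\<theta> * N1 \<omega> \<le> \<theta> * ((1 + \<delta>) * \<theta> * V)" using 3 \<theta> by (intro mult_left_mono) auto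
      also have "\<dots> = (1 + \<delta>) * T" by (simp add: T_def power2_eq_square)
      finally have "?W 0 \<omega> \<le> (1 + \<delta>) * T" using W0[of \<omega>] by simp
      hence "exp (?W 0 \<omega>) \<le> ?e1 * indicator H \<omega>" using 3 by simp
      thus ?thesis by (simp add: add_increasing2)
    qed
  qed
  assume A: "A \<in> sets (F s)"
  hence AM [measurable]: "A \<in> sets M" by (rule F_sets)
  have "ennreal (exp (T * (1 - \<delta>\<^sup>2/10) / 2)) * emeasure M A \<le> (\<integral>\<^sup>+\<omega>. indicator A \<omega> * ennreal (exp (?W 0 \<omega>)) \<partial>M)"
    by (rule lower[OF A])
  also have "\<dots> \<le> (\<integral>\<^sup>+\<omega>. ennreal ?e1 * indicator (A \<inter> H) \<omega> + (ennreal ?e2 * (indicator A \<omega> * ennreal (exp (?W \<delta> \<omega>)))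
      + ennreal ?e3 * (indicator A \<omega> * ennreal (exp (?W (-\<delta>) \<omega>)))) \<partial>M)"
  proof (intro nn_integral_mono)
    fix \<omega> assume w: "\<omega> \<in> space M"
    show "indicator A \<omega> * ennreal (exp (?W 0 \<omega>)) \<le> ennreal ?e1 * indicator (A \<inter> H) \<omega> + (ennreal ?e2 * (indicator A \<omega> * ennreal (exp (?W \<delta> \<omega>)))
      + ennreal ?e3 * (indicator A \<omega> * ennreal (exp (?W (-\<delta>) \<omega>))))"
    proof (cases "\<omega> \<in> A")
      case True
      have "ennreal (exp (?W 0 \<omega>)) \<le> ennreal (?e1 * indicator H \<omega> + ?e2 * exp (?W \<delta> \<omega>) + ?e3 * exp (?W (-\<delta>) \<omega>))"
        by (intro ennreal_leI point w)
      also have "\<dots> = ennreal ?e1 * indicator H \<omega> + (ennreal ?e2 * ennreal (exp (?W \<delta> \<omega>))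
      + ennreal ?e3 * ennreal (exp (?W (-\<delta>) \<omega>)))"
        by (simp add: ennreal_plus ennreal_mult ennreal_indicator add.assoc)
      finally show ?thesis using True by (simp add: indicator_inter_arith)
    qed simp
  qed
  also have "\<dots> = ennreal ?e1 * emeasure M (A \<inter> H) + (ennreal ?e2 * (\<integral>\<^sup>+\<omega>. indicator A \<omega> * ennreal (exp (?W \<delta> \<omega>)) \<partial>M)
      + ennreal ?e3 * (\<integral>\<^sup>+\<omega>. indicator A \<omega> * ennreal (exp (?W (-\<delta>) \<omega>)) \<partial>M))"
    by (simp add: nn_integral_add nn_integral_cmult nn_integral_cmult_indicator)
  also have "\<dots> \<le> ennreal ?e1 * emeasure M (A \<inter> H) + (ennreal ?e2 * (ennreal (exp ((1 + \<delta>)\<^sup>2 * T * (1 + \<delta>\<^sup>2/10) / 2)) * emeasure M A)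
      + ennreal ?e3 * (ennreal (exp ((1 + (-\<delta>))\<^sup>2 * T * (1 + \<delta>\<^sup>2/10) / 2)) * emeasure M A))"
    using \<delta> by (intro add_mono mult_left_mono upper A order_refl) auto
  finally have "exp (T * (1 - \<delta>\<^sup>2/10) / 2) * prob A \<le> ?e1 * prob (A \<inter> H) + (?e2 * (exp ((1 + \<delta>)\<^sup>2 * T * (1 + \<delta>\<^sup>2/10) / 2) * prob A)
      + ?e3 * (exp ((1 + (-\<delta>))\<^sup>2 * T * (1 + \<delta>\<^sup>2/10) / 2) * prob A))"
    by (simp add: emeasure_eq_measure ennreal_mult[symmetric] ennreal_plus[symmetric] del: ennreal_plus)
  \<comment> \<open>At leading order either tail has exponent
    \<open>T * (1/2 - \<delta>\<^sup>2/2)\<close>. The errors of size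
    \<open>\<delta>\<^sup>2/10\<close> consume at most half of the gap
    \<open>T * \<delta>\<^sup>2/2\<close>. The other half is at least ln 4 by assumption, so each
    tail takes at most a quarter of the total.\<close>
  moreover have "?e2 * (exp ((1 + \<delta>)\<^sup>2 * T * (1 + \<delta>\<^sup>2/10) / 2) * prob A) \<le> exp (T * (1 - \<delta>\<^sup>2/10) / 2) / 4 * prob A"
    and "?e3 * (exp ((1 + (-\<delta>))\<^sup>2 * T * (1 + \<delta>\<^sup>2/10) / 2) * prob A) \<le> exp (T * (1 - \<delta>\<^sup>2/10) / 2) / 4 * prob A"
  proof -
    have e4: "exp (T * (1 - \<delta>\<^sup>2/10) / 2 - ln 4) = exp (T * (1 - \<delta>\<^sup>2/10) / 2) / 4" by (simp add: exp_diff)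
    have T4: "ln 4 \<le> T * \<delta>\<^sup>2 / 4" using T by (simp add: T_def)
    have dd: "\<delta> * \<delta>\<^sup>2 \<le> \<delta>\<^sup>2" "\<delta>\<^sup>2 * \<delta>\<^sup>2 \<le> \<delta>\<^sup>2"
      by (rule mult_left_le_one_le; use \<delta> d1 in simp)+
    have gen: "1/2 - x/2 + x/20 + y/10 + z/20 \<le> (1 - x/10)/2 - x/4" if "y \<le> x" "z \<le> x" for x y z :: real
      using that by (simp add: field_simps)
    have eq2: "- (\<delta> * (1 + \<delta>)) + (1 + \<delta>)\<^sup>2 * (1 + \<delta>\<^sup>2/10) / 2 = 1/2 - \<delta>\<^sup>2/2 + \<delta>\<^sup>2/20 + \<delta> * \<delta>\<^sup>2 / 10 + \<delta>\<^sup>2 * \<delta>\<^sup>2/20"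
      by (simp add: power2_eq_square field_simps)
    have "- (\<delta> * (1 + \<delta>)) + (1 + \<delta>)\<^sup>2 * (1 + \<delta>\<^sup>2/10) / 2 \<le> (1 - \<delta>\<^sup>2/10) / 2 - \<delta>\<^sup>2 / 4"
      unfolding eq2 by (rule gen[OF dd])
    hence "T * (- (\<delta> * (1 + \<delta>)) + (1 + \<delta>)\<^sup>2 * (1 + \<delta>\<^sup>2/10) / 2) \<le> T * ((1 - \<delta>\<^sup>2/10) / 2 - \<delta>\<^sup>2 / 4)"
      using T0 by (rule mult_left_mono)
    hence "- (\<delta> * (1 + \<delta>) * T) + (1 + \<delta>)\<^sup>2 * T * (1 + \<delta>\<^sup>2/10) / 2 \<le> T * (1 - \<delta>\<^sup>2/10) / 2 - ln 4"
      using T4 by (simp add: algebra_simps)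
    hence "?e2 * exp ((1 + \<delta>)\<^sup>2 * T * (1 + \<delta>\<^sup>2/10) / 2) \<le> exp (T * (1 - \<delta>\<^sup>2/10) / 2) / 4"
      unfolding e4[symmetric] by (simp add: exp_add[symmetric])
    from mult_right_mono[OF this, of "prob A"]
    show "?e2 * (exp ((1 + \<delta>)\<^sup>2 * T * (1 + \<delta>\<^sup>2/10) / 2) * prob A) \<le> exp (T * (1 - \<delta>\<^sup>2/10) / 2) / 4 * prob A"
      by (simp add: mult.assoc)
    have eq3: "\<delta> * (1 - \<delta>) + (1 + - \<delta>)\<^sup>2 * (1 + \<delta>\<^sup>2/10) / 2 = 1/2 - \<delta>\<^sup>2/2 + \<delta>\<^sup>2/20 + (- (\<delta> * \<delta>\<^sup>2)) / 10 + \<delta>\<^sup>2 * \<delta>\<^sup>2/20"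
      by (simp add: power2_eq_square field_simps)
    have "\<delta> * (1 - \<delta>) + (1 + - \<delta>)\<^sup>2 * (1 + \<delta>\<^sup>2/10) / 2 \<le> (1 - \<delta>\<^sup>2/10) / 2 - \<delta>\<^sup>2 / 4"
      unfolding eq3 by (rule gen[OF _ dd(2)]) (use \<delta> in \<open>simp add: order_trans[of _ 0]\<close>)
    hence "T * (\<delta> * (1 - \<delta>) + (1 + - \<delta>)\<^sup>2 * (1 + \<delta>\<^sup>2/10) / 2) \<le> T * ((1 - \<delta>\<^sup>2/10) / 2 - \<delta>\<^sup>2 / 4)"
      using T0 by (rule mult_left_mono)
    hence "\<delta> * (1 - \<delta>) * T + (1 + - \<delta>)\<^sup>2 * T * (1 + \<delta>\<^sup>2/10) / 2 \<le> T * (1 - \<delta>\<^sup>2/10) / 2 - ln 4"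
      using T4 by (simp add: algebra_simps)
    hence "?e3 * exp ((1 + - \<delta>)\<^sup>2 * T * (1 + \<delta>\<^sup>2/10) / 2) \<le> exp (T * (1 - \<delta>\<^sup>2/10) / 2) / 4"
      unfolding e4[symmetric] by (simp only: exp_add[symmetric] exp_le_cancel_iff)
    from mult_right_mono[OF this, of "prob A"]
    show "?e3 * (exp ((1 + (-\<delta>))\<^sup>2 * T * (1 + \<delta>\<^sup>2/10) / 2) * prob A) \<le> exp (T * (1 - \<delta>\<^sup>2/10) / 2) / 4 * prob A"
      by (simp add: mult.assoc)
  qed
  ultimately have fin: "exp (T * (1 - \<delta>\<^sup>2/10) / 2) / 2 * prob A \<le> ?e1 * prob (A \<inter> H)" by linarith
  \<comment> \<open>Dividing the remaining half of the moment by its cap \<open>?e1\<close> leaves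
    the exponent \<open>- T * (1/2 + \<delta> + \<delta>\<^sup>2/20)\<close>; the 2 in front of
    \<open>\<delta>\<close> is a rounding.\<close>
  have "exp (- (T * (1/2 + 2 * \<delta>))) \<le> exp (- ((1 + \<delta>) * T)) * exp (T * (1 - \<delta>\<^sup>2/10) / 2)"
  proof -
    have "T * (\<delta>\<^sup>2 / 20) \<le> T * \<delta>" using T0 d1 \<delta> by (intro mult_left_mono) auto
    hence "- (T * (1/2 + 2 * \<delta>)) \<le> - ((1 + \<delta>) * T) + T * (1 - \<delta>\<^sup>2/10) / 2"
      by (simp add: algebra_simps)
    thus ?thesis by (simp add: exp_add[symmetric])
  qed
  hence "exp (- (T * (1/2 + 2 * \<delta>))) / 2 * prob A \<le> exp (- ((1 + \<delta>) * T)) * (exp (T * (1 - \<delta>\<^sup>2/10) / 2) / 2 * prob A)"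
    by (simp add: mult_right_mono mult.assoc[symmetric])
  also have "\<dots> \<le> exp (- ((1 + \<delta>) * T)) * (?e1 * prob (A \<inter> H))"
    using fin by (intro mult_left_mono) auto
  also have "\<dots> = prob (A \<inter> H)" by (simp add: mult.assoc[symmetric] exp_add[symmetric])
  finally show "exp (- (\<theta>\<^sup>2 * V * (1/2 + 2 * \<delta>))) / 2 * prob A \<le> prob (A \<inter> {\<omega> \<in> space M. (1 - \<delta>) * \<theta> * V \<le> N \<omega>})"
    unfolding T_def NN H_def .
qed

definition mart :: "nat \<Rightarrow> 'w \<Rightarrow> real" where "mart n \<omega> = (\<Sum>k<n. b k * \<xi> k \<omega>)"

definition lil_scale :: "nat \<Rightarrow> real" where "lil_scale n = \<nu> n * ln (ln (\<nu> n))"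

lemma lil_scale_at_top: "filterlim lil_scale at_top sequentially"
proof -
  have "filterlim (\<lambda>x::real. x * ln (ln x)) at_top at_top" by real_asymp
  from filterlim_compose[OF this nu_lim] show ?thesis by (simp add: lil_scale_def[abs_def])
qed

text \<open>Whether \<open>q k\<close> is at most \<open>\<gamma> * Q\<close> is known before the
  draw, and on the paths considered the cut-off affects finitely many terms. The cut-off sum obeys
  the bound with factor \<open>\<gamma> * sqrt \<gamma>\<close>; the room up to
  \<open>\<gamma>\<^sup>2\<close> absorbs the constant left by those terms.\<close>

lemma lil_upper_half:
  assumes Q: "0 < Q" and \<gamma>: "1 < \<gamma>" and sg: "\<bar>sg\<bar> = (1::real)"
  shows "AE \<omega> in M. (\<forall>\<^sub>F k in sequentially. q k \<omega> \<le> \<gamma> * Q) \<longrightarrow>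
    (\<forall>\<^sub>F n in sequentially. sg * mart n \<omega> \<le> \<gamma>\<^sup>2 * sqrt (2 * Q * lil_scale n))"
proof -
  define h where "h k \<omega> = (if q k \<omega> \<le> \<gamma> * Q then sg * b k else 0)" for k \<omega>
  have hm: "h k \<in> borel_measurable (F k)" for k
    unfolding h_def[abs_def] using q_meas[of k] by measurable
  have sg2: "sg\<^sup>2 = 1" using sg by (metis one_power2 power2_abs)
  have "AE \<omega> in M. \<forall>\<^sub>F n in sequentially.
    (\<Sum>k<n. h k \<omega> * \<xi> k \<omega>) \<le> \<gamma> * sqrt (2 * (\<gamma> * Q) * \<nu> n * ln (ln (\<nu> n)))"
    using Q \<gamma> sg sg2
    by (intro lil_upper hm) (auto simp: h_def abs_mult power_mult_distrib intro!: mult_left_mono)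
  thus ?thesis using AE_space
  proof eventually_elim
    case (elim \<omega>)
    show ?case
    proof
      assume "\<forall>\<^sub>F k in sequentially. q k \<omega> \<le> \<gamma> * Q"
      then obtain K where K: "\<And>k. k \<ge> K \<Longrightarrow> q k \<omega> \<le> \<gamma> * Q" by (auto simp: eventually_sequentially)
      define C where "C = \<bar>\<Sum>k<K. (sg * b k - h k \<omega>) * \<xi> k \<omega>\<bar>"
      have diff: "sg * mart n \<omega> - (\<Sum>k<n. h k \<omega> * \<xi> k \<omega>) \<le> C" if "n \<ge> K" for n
      proof -
        have "sg * mart n \<omega> - (\<Sum>k<n. h k \<omega> * \<xi> k \<omega>) = (\<Sum>k<n. (sg * b k - h k \<omega>) * \<xi> k \<omega>)"
          by (simp add: mart_def sum_distrib_left sum_subtractf left_diff_distrib mult.assoc)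
        also have "\<dots> = (\<Sum>k<K. (sg * b k - h k \<omega>) * \<xi> k \<omega>)"
          using that by (intro sum.mono_neutral_right) (auto simp: h_def K)
        finally show ?thesis unfolding C_def by linarith
      qed
      have s: "sqrt \<gamma> < \<gamma>"
        using \<gamma> real_sqrt_less_mono[of \<gamma> "\<gamma>\<^sup>2"] by (simp add: power2_eq_square)
      have "filterlim (\<lambda>n. (\<gamma> * (\<gamma> - sqrt \<gamma>)) * sqrt (2 * Q * lil_scale n)) at_top sequentially"
        using \<gamma> s Q
        by (intro filterlim_tendsto_pos_mult_at_top[OF tendsto_const] filterlim_compose[OF sqrt_at_top]
            lil_scale_at_top) auto
      hence "\<forall>\<^sub>F n in sequentially. C \<le> (\<gamma> * (\<gamma> - sqrt \<gamma>)) * sqrt (2 * Q * lil_scale n)"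
        by (simp add: filterlim_at_top)
      thus "\<forall>\<^sub>F n in sequentially. sg * mart n \<omega> \<le> \<gamma>\<^sup>2 * sqrt (2 * Q * lil_scale n)"
        using elim(1) eventually_ge_at_top[of K]
      proof eventually_elim
        case (elim n)
        have "2 * (\<gamma> * Q) * \<nu> n * ln (ln (\<nu> n)) = \<gamma> * (2 * Q * lil_scale n)"
          by (simp add: lil_scale_def mult_ac)
        hence "(\<Sum>k<n. h k \<omega> * \<xi> k \<omega>) \<le> \<gamma> * (sqrt \<gamma> * sqrt (2 * Q * lil_scale n))"
          using elim(2) by (simp only: real_sqrt_mult)
        hence "sg * mart n \<omega> \<le> \<gamma> * (sqrt \<gamma> * sqrt (2 * Q * lil_scale n)) + (\<gamma> * (\<gamma> - sqrt \<gamma>)) * sqrt (2 * Q * lil_scale n)"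
          using diff[OF elim(3)] elim(1) by linarith
        also have "\<dots> = \<gamma>\<^sup>2 * sqrt (2 * Q * lil_scale n)"
          by (simp add: power2_eq_square algebra_simps)
        finally show ?case .
      qed
    qed
  qed
qed

lemma lil_upper_abs:
  assumes Q: "0 < Q" and \<gamma>: "1 < \<gamma>"
  shows "AE \<omega> in M. (\<forall>\<^sub>F k in sequentially. q k \<omega> \<le> \<gamma> * Q) \<longrightarrow>
    (\<forall>\<^sub>F n in sequentially. \<bar>mart n \<omega>\<bar> \<le> \<gamma>\<^sup>2 * sqrt (2 * Q * lil_scale n))"
  using lil_upper_half[OF Q \<gamma>, of 1, simplified] lil_upper_half[OF Q \<gamma>, of "-1", simplified]
proof eventually_elim
  case (elim \<omega>)
  show ?case
  proof
    assume "\<forall>\<^sub>F k in sequentially. q k \<omega> \<le> \<gamma> * Q"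
    with elim have "\<forall>\<^sub>F n in sequentially. mart n \<omega> \<le> \<gamma>\<^sup>2 * sqrt (2 * Q * lil_scale n)"
      "\<forall>\<^sub>F n in sequentially. - mart n \<omega> \<le> \<gamma>\<^sup>2 * sqrt (2 * Q * lil_scale n)" by blast+
    thus "\<forall>\<^sub>F n in sequentially. \<bar>mart n \<omega>\<bar> \<le> \<gamma>\<^sup>2 * sqrt (2 * Q * lil_scale n)"
      by eventually_elim linarith
  qed
qed

text \<open>The case Q = 1/4 and \<open>\<gamma> = 2\<close>, in which the hypothesis on
  \<open>q\<close> is automatic. Being unconditional, it is available before \<open>q\<close> is
  known to converge, and it also controls the martingale at the start of a block in the lower
  half.\<close>

lemma mart_bigo: "AE \<omega> in M. \<forall>\<^sub>F n in sequentially. \<bar>mart n \<omega>\<bar> \<le> 4 * sqrt (1 / 2 * lil_scale n)"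
proof -
  have "AE \<omega> in M. (\<forall>\<^sub>F k in sequentially. q k \<omega> \<le> 2 * (1/4)) \<longrightarrow>
    (\<forall>\<^sub>F n in sequentially. \<bar>mart n \<omega>\<bar> \<le> 2\<^sup>2 * sqrt (2 * (1/4) * lil_scale n))"
    by (rule lil_upper_abs) auto
  thus ?thesis using AE_space
  proof eventually_elim
    case (elim \<omega>)
    have "q k \<omega> \<le> 2 * (1/4)" for k using q_range(2)[OF elim(2), of k] by linarith
    hence "\<forall>\<^sub>F k in sequentially. q k \<omega> \<le> 2 * (1/4)" by (simp only: eventually_sequentially) blast
    with elim(1) show ?case by simp
  qed
qed

text \<open>With widely spaced blocks nearly all variance at the end of a block comes from the block
  itself. The value at its start, controlled by the crude bound, is of relative order
  1/sqrt(\<rho>). Large block increments recur because their conditional probabilities, at least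
  1/(2j), have a divergent sum.\<close>

lemma lil_lower:
  assumes Q: "0 < Q" and c: "0 < c" "c < 1"
  shows "AE \<omega> in M. (\<lambda>k. q k \<omega>) \<longlonglongrightarrow> Q \<longrightarrow>
    (\<exists>\<^sub>F n in sequentially. c * sqrt (2 * Q * lil_scale n) \<le> mart n \<omega>)"
proof -
  obtain \<delta> :: real where \<delta>: "0 < \<delta>" "\<delta> < 1" "c < (1 - \<delta>) / sqrt (1 + 4 * \<delta>)"
  proof -
    have "((\<lambda>\<delta>::real. (1 - \<delta>) / sqrt (1 + 4 * \<delta>)) \<longlongrightarrow> 1) (at_right 0)" by real_asymp
    hence "\<forall>\<^sub>F \<delta> in at_right 0. c < (1 - \<delta>) / sqrt (1 + 4 * \<delta>)" using c(2) by (rule order_tendstoD)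
    moreover have "\<forall>\<^sub>F \<delta> in at_right (0::real). 0 < \<delta>" "\<forall>\<^sub>F \<delta> in at_right (0::real). \<delta> < 1" by real_asymp+
    ultimately have "\<forall>\<^sub>F \<delta> in at_right 0. 0 < \<delta> \<and> \<delta> < 1 \<and> c < (1 - \<delta>) / sqrt (1 + 4 * \<delta>)"
      by eventually_elim auto
    thus ?thesis using that eventually_happens'[OF trivial_limit_at_right_real] by blast
  qed
  \<comment> \<open>1 - \<delta> is the loss inside the block event, and sqrt(1 + 4\<delta>) the
    reduction of the tilt that brings its probability up to 1/(2j).\<close>
  define a where "a = (1 - \<delta>) / sqrt (1 + 4 * \<delta>)"
  have a: "c < a" "0 < a" using \<delta> by (auto simp: a_def)
  \<comment> \<open>The two square roots are the limits of \<open>X j / R j\<close> and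
    \<open>Y j / R j\<close> further down.\<close>
  obtain \<rho> :: real where \<rho>: "2 < \<rho>" "c < a * sqrt (1 - 1 / \<rho>) - 4 * sqrt (1 / (4 * Q * \<rho>))"
  proof -
    have "((\<lambda>\<rho>. a * sqrt (1 - 1 / \<rho>) - 4 * sqrt (1 / (4 * Q * \<rho>))) \<longlongrightarrow> a) at_top"
      using Q a by real_asymp
    hence "\<forall>\<^sub>F \<rho> in at_top. c < a * sqrt (1 - 1 / \<rho>) - 4 * sqrt (1 / (4 * Q * \<rho>))"
      using a(1) by (rule order_tendstoD)
    moreover have "\<forall>\<^sub>F \<rho> in at_top. (2::real) < \<rho>" by (rule eventually_gt_at_top)
    ultimately have "\<forall>\<^sub>F \<rho> in at_top. 2 < \<rho> \<and> c < a * sqrt (1 - 1 / \<rho>) - 4 * sqrt (1 / (4 * Q * \<rho>))"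
      by eventually_elim auto
    thus ?thesis using that eventually_happens'[OF trivial_limit_at_top_linorder] by blast
  qed
  \<comment> \<open>\<open>\<nu>\<close> overshoots a level by at most one increment, hence by at
    most \<open>B\<^sup>2\<close>; adding 1 makes \<open>E\<close> positive.\<close>
  define E where "E = B\<^sup>2 + 1"
  have E: "E > 0" by (simp add: E_def add_nonneg_pos)
  define t where "t j = (LEAST n. \<rho> ^ j \<le> \<nu> n)" for j
  have ex: "\<exists>n. \<rho> ^ j \<le> \<nu> n" for j
    using nu_lim eventually_happens'[OF sequentially_bot] by (auto simp: filterlim_at_top)
  have t1: "\<rho> ^ j \<le> \<nu> (t j)" for j unfolding t_def using ex by (rule LeastI_ex)
  have t2: "\<nu> (t j) \<le> \<rho> ^ j + E" for j
  proof (cases "t j")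
    case 0
    thus ?thesis using t1[of j] \<rho> by (simp add: \<nu>_def) (smt (verit) zero_less_power)
  next
    case (Suc n)
    hence "\<not> \<rho> ^ j \<le> \<nu> n" using not_less_Least[of n "\<lambda>n. \<rho> ^ j \<le> \<nu> n"] by (simp add: t_def)
    thus ?thesis unfolding Suc nu_Suc E_def using b_square_le[of n] by simp
  qed
  have t_mono: "mono t"
  proof (rule monoI)
    fix i j :: nat assume "i \<le> j"
    hence "\<rho> ^ i \<le> \<rho> ^ j" using \<rho> by (intro power_increasing) auto
    hence "\<rho> ^ i \<le> \<nu> (t j)" using t1[of j] by linarith
    thus "t i \<le> t j" unfolding t_def[of i] by (rule Least_le)
  qed
  have t_lim: "filterlim t at_top sequentially"
  proof -
    have "\<forall>\<^sub>F j in sequentially. N \<le> t j" for N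
    proof -
      have "filterlim (\<lambda>j::nat. \<rho> ^ j) at_top sequentially" using \<rho> by real_asymp
      hence "\<forall>\<^sub>F j in sequentially. \<nu> N < \<rho> ^ j" by (auto simp: filterlim_at_top_dense)
      thus ?thesis
      proof eventually_elim
        case (elim j)
        show ?case
        proof (rule ccontr)
          assume "\<not> N \<le> t j"
          hence "\<nu> (t j) \<le> \<nu> N" by (intro nu_mono) auto
          thus False using elim t1[of j] by linarith
        qed
      qed
    qed
    thus ?thesis by (simp add: filterlim_at_top)
  qed
  define V where "V j = Q * (\<nu> (t (Suc j)) - \<nu> (t j))" for j
  \<comment> \<open>An explicit lower bound for the variance of the block, which allows limits to be
    computed without knowing the passage times.\<close>
  define Vl where "Vl j = Q * (\<rho> ^ Suc j - \<rho> ^ j - E)" for j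
  have Vl: "Vl j \<le> V j" for j
    unfolding Vl_def V_def using Q t1[of "Suc j"] t2[of j] by (intro mult_left_mono) auto
  \<comment> \<open>Chosen so that \<open>(\<theta> j)\<^sup>2 * V j * (1/2 + 2 * \<delta>)\<close>
    equals ln j, which turns the bound of the block lemma into 1/(2j).\<close>
  define \<theta> where "\<theta> j = sqrt (2 * ln (real j) / ((1 + 4 * \<delta>) * V j))" for j
  have E_lim: "(\<lambda>j. E / \<rho> ^ j) \<longlonglongrightarrow> 0" using \<rho>(1) by real_asymp
  have "filterlim (\<lambda>j::nat. Q * (\<rho> ^ j - E)) at_top sequentially" using \<rho>(1) Q by real_asymp
  moreover have "Q * (\<rho> ^ j - E) \<le> Vl j" for j
  proof -
    have "2 * \<rho> ^ j \<le> \<rho> * \<rho> ^ j" using \<rho>(1) by (intro mult_right_mono) auto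
    thus ?thesis unfolding Vl_def using Q by (intro mult_left_mono) auto
  qed
  ultimately have "filterlim Vl at_top sequentially" by (auto intro: filterlim_at_top_mono)
  hence ev1: "\<forall>\<^sub>F j in sequentially. 1 \<le> Vl j" by (simp add: filterlim_at_top)
  have ev2: "\<forall>\<^sub>F j in sequentially. 2 * sqrt (2 * ln (real j) / ((1 + 4 * \<delta>) * Vl j)) * B \<le> \<delta>\<^sup>2/80"
  proof -
    have "(\<lambda>j. (ln (real j) / \<rho> ^ j) / (Vl j / \<rho> ^ j)) \<longlonglongrightarrow> 0 / (Q * (\<rho> - 1 - 0))"
    proof (intro tendsto_divide)
      show "(\<lambda>j. ln (real j) / \<rho> ^ j) \<longlonglongrightarrow> 0" using \<rho>(1) by real_asymp
      have "Vl j / \<rho> ^ j = Q * (\<rho> - 1 - E / \<rho> ^ j)" for j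
      proof -
        have "Q * (x * y - y - E) / y = Q * (x - 1 - E / y)" if "y > 0" for x y
          using that by (simp add: divide_simps) (simp add: left_diff_distrib)
        from this[of "\<rho> ^ j" \<rho>] show ?thesis using \<rho>(1) by (simp add: Vl_def)
      qed
      thus "(\<lambda>j. Vl j / \<rho> ^ j) \<longlonglongrightarrow> Q * (\<rho> - 1 - 0)"
        by (simp only:) (intro tendsto_intros E_lim)
    qed (use Q \<rho> in auto)
    hence "(\<lambda>j. ln (real j) / Vl j) \<longlonglongrightarrow> 0" using \<rho>(1) by simp
    hence "(\<lambda>j. 2 * sqrt (2 / (1 + 4 * \<delta>) * (ln (real j) / Vl j)) * B) \<longlonglongrightarrow> 2 * sqrt (2 / (1 + 4 * \<delta>) * 0) * B"
      by (intro tendsto_intros)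
    hence "(\<lambda>j. 2 * sqrt (2 * ln (real j) / ((1 + 4 * \<delta>) * Vl j)) * B) \<longlonglongrightarrow> 0"
      by simp
    hence "\<forall>\<^sub>F j in sequentially. 2 * sqrt (2 * ln (real j) / ((1 + 4 * \<delta>) * Vl j)) * B < \<delta>\<^sup>2/80"
      using \<delta> by (intro order_tendstoD) auto
    thus ?thesis by eventually_elim simp
  qed
  have ev3: "\<forall>\<^sub>F j in sequentially. 4 * ln 4 \<le> (2 * ln (real j) / (1 + 4 * \<delta>)) * \<delta>\<^sup>2"
  proof -
    have "filterlim (\<lambda>j. (2 * ln (real j) / (1 + 4 * \<delta>)) * \<delta>\<^sup>2) at_top sequentially"
      using \<delta> by real_asymp
    thus ?thesis unfolding filterlim_at_top by blast
  qed
  have "\<forall>\<^sub>F j in sequentially. 1 \<le> Vl j \<and> 2 * sqrt (2 * ln (real j) / ((1 + 4 * \<delta>) * Vl j)) * B \<le> \<delta>\<^sup>2/80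
      \<and> 4 * ln 4 \<le> (2 * ln (real j) / (1 + 4 * \<delta>)) * \<delta>\<^sup>2 \<and> 2 \<le> j"
    using ev1 ev2 ev3 eventually_ge_at_top[of 2] by eventually_elim blast
  then obtain J where JJ: "\<forall>j\<ge>J. 1 \<le> Vl j \<and> 2 * sqrt (2 * ln (real j) / ((1 + 4 * \<delta>) * Vl j)) * B \<le> \<delta>\<^sup>2/80
      \<and> 4 * ln 4 \<le> (2 * ln (real j) / (1 + 4 * \<delta>)) * \<delta>\<^sup>2 \<and> 2 \<le> j"
    unfolding eventually_sequentially ..
  have J: "1 \<le> Vl j" "2 * sqrt (2 * ln (real j) / ((1 + 4 * \<delta>) * Vl j)) * B \<le> \<delta>\<^sup>2/80"
     "4 * ln 4 \<le> (2 * ln (real j) / (1 + 4 * \<delta>)) * \<delta>\<^sup>2" "2 \<le> j" if "j \<ge> J" for j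
    using JJ[rule_format, OF that] by (simp_all only:)
  define N where "N j \<omega> = (\<Sum>k=t j..<t (Suc j). if \<bar>q k \<omega> - Q\<bar> \<le> \<delta>\<^sup>2/40 * Q then b k * \<xi> k \<omega> else \<theta> j * (b k)\<^sup>2 * Q)" for j \<omega>
  \<comment> \<open>Measurability is required at every \<open>j\<close>, but the block lemma applies
    only from \<open>J\<close> on; the empty set fills the gap.\<close>
  define H where "H j = (if j \<ge> J then {\<omega> \<in> space M. (1 - \<delta>) * \<theta> j * V j \<le> N j \<omega>} else {})" for j
  have cond: "0 \<le> \<theta> j" "2 * \<theta> j * B \<le> \<delta>\<^sup>2/80" "4 * ln 4 \<le> (\<theta> j)\<^sup>2 * V j * \<delta>\<^sup>2"
    "(\<theta> j)\<^sup>2 * V j = 2 * ln (real j) / (1 + 4 * \<delta>)" "1 \<le> V j" if j: "j \<ge> J" for j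
  proof -
    show V: "1 \<le> V j" using J(1)[OF j] Vl[of j] by linarith
    have lj: "0 < ln (real j)" using J(4)[OF j] by simp
    show "0 \<le> \<theta> j" unfolding \<theta>_def using lj V \<delta> by simp
    have "\<theta> j \<le> sqrt (2 * ln (real j) / ((1 + 4 * \<delta>) * Vl j))"
      unfolding \<theta>_def using lj \<delta> J(1)[OF j] Vl[of j]
      by (intro real_sqrt_le_mono divide_left_mono mult_left_mono mult_pos_pos) auto
    hence "2 * \<theta> j * B \<le> 2 * sqrt (2 * ln (real j) / ((1 + 4 * \<delta>) * Vl j)) * B"
      using B_nonneg by (intro mult_right_mono) auto
    thus "2 * \<theta> j * B \<le> \<delta>\<^sup>2/80" using J(2)[OF j] by linarith
    show TV: "(\<theta> j)\<^sup>2 * V j = 2 * ln (real j) / (1 + 4 * \<delta>)"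
      unfolding \<theta>_def using lj V \<delta> by simp
    show "4 * ln 4 \<le> (\<theta> j)\<^sup>2 * V j * \<delta>\<^sup>2" unfolding TV by (rule J(3)[OF j])
  qed
  have tS: "t j \<le> t (Suc j)" for j by (rule monoD[OF t_mono]) simp
  note blk = tS \<delta>(1) less_imp_le[OF \<delta>(2)] Q
  have Hj: "H j = {\<omega> \<in> space M. (1 - \<delta>) * \<theta> j * (Q * (\<nu> (t (Suc j)) - \<nu> (t j))) \<le>
      (\<Sum>k=t j..<t (Suc j). if \<bar>q k \<omega> - Q\<bar> \<le> \<delta>\<^sup>2/40 * Q then b k * \<xi> k \<omega> else \<theta> j * (b k)\<^sup>2 * Q)}"
    if "j \<ge> J" for j
    using that by (simp add: H_def N_def V_def)
  have HF: "H j \<in> sets (F (t (Suc j)))" for j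
  proof (cases "j \<ge> J")
    case True
    show ?thesis unfolding Hj[OF True]
      by (rule lil_lower_block_sets[OF blk cond(1,2)[OF True] cond(3)[OF True, unfolded V_def]])
  qed (auto simp: H_def)
  have HP: "1 / (2 * real j) * prob A \<le> prob (A \<inter> H j)" if j: "j \<ge> J" and A: "A \<in> sets (F (t j))" for j A
  proof -
    have "exp (- ((\<theta> j)\<^sup>2 * V j * (1/2 + 2 * \<delta>))) / 2 * prob A \<le> prob (A \<inter> H j)"
      unfolding Hj[OF j] V_def
      by (rule lil_lower_block_prob[OF blk cond(1,2)[OF j] cond(3)[OF j, unfolded V_def] A])
    moreover have "(\<theta> j)\<^sup>2 * V j * (1/2 + 2 * \<delta>) = ln (real j)"
      unfolding cond(4)[OF j] using \<delta> by (simp add: field_simps)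
    moreover have "exp (- ln (real j)) = 1 / real j"
      using J(4)[OF j] by (simp add: exp_minus inverse_eq_divide)
    ultimately show ?thesis by simp
  qed
  have BC: "AE \<omega> in M. \<exists>\<^sub>F j in sequentially. \<omega> \<in> H j"
  proof (rule second_borel_cantelli[OF t_mono HF _ _ HP])
    show "\<not> summable (\<lambda>j. 1 / (2 * real j))"
    proof
      assume "summable (\<lambda>j. 1 / (2 * real j))"
      hence "summable (\<lambda>j. 2 * (1 / (2 * real j)))" by (rule summable_mult)
      hence "summable (\<lambda>j. inverse (real j))" by (simp add: inverse_eq_divide)
      thus False using not_summable_harmonic[where 'a = real] by simp
    qed
  qed auto
  \<comment> \<open>\<open>a * X\<close> is below the increment granted by the block event,
    \<open>4 * Y\<close> bounds the martingale at the start of the block, \<open>Z\<close> bounds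
    the target scale at its end, and \<open>R\<close> is the common normaliser.\<close>
  define X where "X j = sqrt (2 * ln (real j) * Vl j)" for j
  define Y where "Y j = sqrt (1/2 * ((\<rho> ^ j + E) * ln (ln (\<rho> ^ j + E))))" for j :: nat
  define Z where "Z j = sqrt (2 * Q * ((\<rho> ^ Suc j + E) * ln (ln (\<rho> ^ Suc j + E))))" for j :: nat
  define R where "R j = sqrt (2 * Q * \<rho> ^ Suc j * ln (real j))" for j
  have E_lim': "(\<lambda>j. E / \<rho> ^ Suc j) \<longlonglongrightarrow> 0" by (rule LIMSEQ_Suc[OF E_lim])
  have W1: "(\<lambda>j. ln (ln (\<rho> ^ j + E)) / ln (real j)) \<longlonglongrightarrow> 1"
    using \<rho>(1) by real_asymp
  have W2: "(\<lambda>j. ln (ln (\<rho> ^ Suc j + E)) / ln (real j)) \<longlonglongrightarrow> 1"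
    using \<rho>(1) by real_asymp
  have "(\<lambda>j. sqrt (1 - 1 / \<rho> - E / \<rho> ^ Suc j)) \<longlonglongrightarrow> sqrt (1 - 1 / \<rho> - 0)"
    by (intro tendsto_intros E_lim')
  moreover have "\<forall>\<^sub>F j in sequentially. sqrt (1 - 1 / \<rho> - E / \<rho> ^ Suc j) = X j / R j"
    using eventually_ge_at_top[of 2]
  proof eventually_elim
    case (elim j)
    have "2 * ln (real j) * Vl j / (2 * Q * \<rho> ^ Suc j * ln (real j)) = 1 - 1 / \<rho> - E / \<rho> ^ Suc j"
      unfolding Vl_def using elim \<rho>(1) Q by (simp add: field_simps)
    thus ?case by (simp only: X_def R_def real_sqrt_divide[symmetric])
  qed
  ultimately have "(\<lambda>j. X j / R j) \<longlonglongrightarrow> sqrt (1 - 1 / \<rho>)"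
    by (simp add: tendsto_cong)
  moreover have "(\<lambda>j. sqrt (1 / (4 * Q * \<rho>) * (1 + E / \<rho> ^ j) * (ln (ln (\<rho> ^ j + E)) / ln (real j))))
      \<longlonglongrightarrow> sqrt (1 / (4 * Q * \<rho>) * (1 + 0) * 1)"
    by (intro tendsto_intros E_lim W1)
  moreover have "sqrt (1 / (4 * Q * \<rho>) * (1 + E / \<rho> ^ j) * (ln (ln (\<rho> ^ j + E)) / ln (real j))) = Y j / R j" for j
  proof -
    have "1/2 * ((\<rho> ^ j + E) * L) / (2 * Q * \<rho> ^ Suc j * l) = 1 / (4 * Q * \<rho>) * (1 + E / \<rho> ^ j) * (L / l)" for L l :: real
      using \<rho>(1) Q by (simp add: divide_simps)
    thus ?thesis by (simp only: Y_def R_def real_sqrt_divide[symmetric])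
  qed
  moreover have "(\<lambda>j. sqrt ((1 + E / \<rho> ^ Suc j) * (ln (ln (\<rho> ^ Suc j + E)) / ln (real j)))) \<longlonglongrightarrow> sqrt ((1 + 0) * 1)"
    by (intro tendsto_intros E_lim' W2)
  moreover have "sqrt ((1 + E / \<rho> ^ Suc j) * (ln (ln (\<rho> ^ Suc j + E)) / ln (real j))) = Z j / R j" for j
  proof -
    have "2 * Q * ((r + E) * L) / (2 * Q * r * l) = (1 + E / r) * (L / l)" if "r > 0" for r L l :: real
      using that Q by (simp add: divide_simps)
    from this[of "\<rho> ^ Suc j"] have "2 * Q * ((\<rho> ^ Suc j + E) * L) / (2 * Q * \<rho> ^ Suc j * l) =
        (1 + E / \<rho> ^ Suc j) * (L / l)" for L l
      using \<rho>(1) by simp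
    thus ?thesis by (simp only: Z_def R_def real_sqrt_divide[symmetric])
  qed
  ultimately have "(\<lambda>j. X j / R j) \<longlonglongrightarrow> sqrt (1 - 1 / \<rho>)"
    "(\<lambda>j. Y j / R j) \<longlonglongrightarrow> sqrt (1 / (4 * Q * \<rho>))" "(\<lambda>j. Z j / R j) \<longlonglongrightarrow> 1"
    by simp_all
  hence "(\<lambda>j. a * (X j / R j) - 4 * (Y j / R j) - c * (Z j / R j))
      \<longlonglongrightarrow> a * sqrt (1 - 1 / \<rho>) - 4 * sqrt (1 / (4 * Q * \<rho>)) - c * 1"
    by (intro tendsto_intros)
  hence "\<forall>\<^sub>F j in sequentially. 0 < a * (X j / R j) - 4 * (Y j / R j) - c * (Z j / R j)"
    by (rule order_tendstoD) (use \<rho> in auto)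
  hence XYZ: "\<forall>\<^sub>F j in sequentially. c * Z j < a * X j - 4 * Y j"
    using eventually_ge_at_top[of 2]
  proof eventually_elim
    case (elim j)
    have "R j > 0" using elim(2) \<rho> Q by (simp add: R_def)
    moreover have "a * (X j / R j) - 4 * (Y j / R j) - c * (Z j / R j) = (a * X j - 4 * Y j - c * Z j) / R j"
      by (simp add: diff_divide_distrib)
    ultimately show ?case using elim(1) by (simp add: zero_less_divide_iff)
  qed
  have scale_le: "lil_scale n \<le> y * ln (ln y)" if "3 \<le> \<nu> n" "\<nu> n \<le> y" for n y
  proof -
    have "exp 1 \<le> \<nu> n" using that exp_le by linarith
    hence "1 \<le> ln (\<nu> n)" by (subst ln_ge_iff) (use that in auto)
    thus ?thesis unfolding lil_scale_def using that by (intro mult_mono) auto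
  qed
  have "filterlim (\<lambda>j::nat. \<rho> ^ j) at_top sequentially" using \<rho> by real_asymp
  hence \<rho>3: "\<forall>\<^sub>F j in sequentially. 3 \<le> \<rho> ^ j" by (simp add: filterlim_at_top)
  have t_lim': "filterlim (\<lambda>j. t (Suc j)) at_top sequentially"
    by (rule filterlim_compose[OF t_lim filterlim_Suc])
  show ?thesis using BC mart_bigo
  proof eventually_elim
    case (elim \<omega>)
    show ?case
    proof
      assume qQ: "(\<lambda>k. q k \<omega>) \<longlonglongrightarrow> Q"
      have "0 < \<delta>\<^sup>2/40 * Q" using \<delta> Q by simp
      hence "\<forall>\<^sub>F k in sequentially. dist (q k \<omega>) Q < \<delta>\<^sup>2/40 * Q" using qQ by (simp only: tendsto_iff)
      then obtain K where K: "\<And>k. k \<ge> K \<Longrightarrow> \<bar>q k \<omega> - Q\<bar> \<le> \<delta>\<^sup>2/40 * Q"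
        unfolding eventually_sequentially dist_real_def by (meson less_imp_le)
      have "\<forall>\<^sub>F j in sequentially. t j \<ge> K" using t_lim by (simp add: filterlim_at_top)
      hence "\<forall>\<^sub>F j in sequentially. \<omega> \<in> H j \<longrightarrow> c * sqrt (2 * Q * lil_scale (t (Suc j))) \<le> mart (t (Suc j)) \<omega>"
        using XYZ \<rho>3 eventually_ge_at_top[of J] eventually_compose_filterlim[OF elim(2) t_lim]
      proof eventually_elim
        case (elim j)
        show ?case
        proof
          assume "\<omega> \<in> H j"
          hence "(1 - \<delta>) * \<theta> j * V j \<le> N j \<omega>" using elim(4) by (simp add: H_def)
          also have "N j \<omega> = (\<Sum>k=t j..<t (Suc j). b k * \<xi> k \<omega>)"
            unfolding N_def using K elim(1) by (intro sum.cong) auto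
          also have "\<dots> = mart (t (Suc j)) \<omega> - mart (t j) \<omega>"
            unfolding mart_def lessThan_atLeast0 using sum_diff_nat_ivl[of 0 "t j" "t (Suc j)" "\<lambda>k. b k * \<xi> k \<omega>"] tS by simp
          finally have 1: "(1 - \<delta>) * \<theta> j * V j \<le> mart (t (Suc j)) \<omega> - mart (t j) \<omega>" .
          have V: "1 \<le> V j" using cond(5) elim(4) by auto
          have lj: "0 \<le> ln (real j)" using J(4)[OF elim(4)] by simp
          have "\<theta> j * V j = sqrt ((\<theta> j)\<^sup>2 * V j * V j)"
            by (rule real_sqrt_unique[symmetric]) (use V cond(1)[OF elim(4)] in \<open>auto simp: power2_eq_square\<close>)
          also have "\<dots> = sqrt (2 * ln (real j) * V j) / sqrt (1 + 4 * \<delta>)"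
            unfolding cond(4)[OF elim(4)] by (simp add: real_sqrt_divide)
          finally have "(1 - \<delta>) * \<theta> j * V j = a * sqrt (2 * ln (real j) * V j)"
            by (simp add: a_def mult.assoc)
          moreover have "a * X j \<le> a * sqrt (2 * ln (real j) * V j)"
            unfolding X_def using a Vl[of j] lj by (intro mult_left_mono real_sqrt_le_mono) auto
          moreover have "\<bar>mart (t j) \<omega>\<bar> \<le> 4 * Y j"
          proof (rule order_trans[OF elim(5)])
            have "lil_scale (t j) \<le> (\<rho> ^ j + E) * ln (ln (\<rho> ^ j + E))"
              using t1[of j] t2[of j] elim(3) by (intro scale_le) auto
            thus "4 * sqrt (1 / 2 * lil_scale (t j)) \<le> 4 * Y j"
              unfolding Y_def by (intro mult_left_mono real_sqrt_le_mono) auto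
          qed
          moreover have "c * sqrt (2 * Q * lil_scale (t (Suc j))) \<le> c * Z j"
          proof -
            have "\<rho> ^ j \<le> \<rho> ^ Suc j" using \<rho> by (intro power_increasing) auto
            hence "lil_scale (t (Suc j)) \<le> (\<rho> ^ Suc j + E) * ln (ln (\<rho> ^ Suc j + E))"
              using t1[of "Suc j"] t2[of "Suc j"] elim(3) by (intro scale_le) linarith+
            thus ?thesis unfolding Z_def using c Q by (intro mult_left_mono real_sqrt_le_mono) auto
          qed
          ultimately show "c * sqrt (2 * Q * lil_scale (t (Suc j))) \<le> mart (t (Suc j)) \<omega>"
            using 1 elim(2) by linarith
        qed
      qed
      with elim(1) have "\<exists>\<^sub>F j in sequentially. c * sqrt (2 * Q * lil_scale (t (Suc j))) \<le> mart (t (Suc j)) \<omega>"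
        by (rule frequently_rev_mp)
      thus "\<exists>\<^sub>F n in sequentially. c * sqrt (2 * Q * lil_scale n) \<le> mart n \<omega>"
        unfolding frequently_def using eventually_compose_filterlim[OF _ t_lim'] by blast
    qed
  qed
qed

end

text \<open>The Toeplitz form of Cesaro's theorem: a divergent total weight makes every initial
  segment negligible. Signs are asked for only eventually because a difference of logarithms used as
  weight below may be negative at index 0.\<close>

lemma weighted_average_tendsto:
  fixes r y :: "nat \<Rightarrow> real"
  assumes r: "r \<longlonglongrightarrow> l" and y: "\<forall>\<^sub>F k in sequentially. 0 \<le> y k"
    and Y: "filterlim (\<lambda>n. \<Sum>k<n. y k) at_top sequentially"
  shows "(\<lambda>n. (\<Sum>k<n. r k * y k) / (\<Sum>k<n. y k)) \<longlonglongrightarrow> l"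
proof (rule LIMSEQ_I)
  fix e :: real assume e: "0 < e"
  have "\<forall>\<^sub>F k in sequentially. dist (r k) l < e/2" using r e unfolding tendsto_iff by (meson half_gt_zero)
  with y have "\<forall>\<^sub>F k in sequentially. 0 \<le> y k \<and> dist (r k) l < e/2" by (rule eventually_conj)
  then obtain K where K: "\<And>k. k \<ge> K \<Longrightarrow> 0 \<le> y k" "\<And>k. k \<ge> K \<Longrightarrow> \<bar>r k - l\<bar> < e/2"
    unfolding eventually_sequentially dist_real_def by blast
  define C where "C = \<bar>\<Sum>k<K. (r k - l) * y k\<bar> + e/2 * \<bar>\<Sum>k<K. y k\<bar>"
  have "\<forall>\<^sub>F n in sequentially. 4 * C / e + 1 \<le> (\<Sum>k<n. y k)" using Y by (simp add: filterlim_at_top)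
  hence "\<forall>\<^sub>F n in sequentially. norm ((\<Sum>k<n. r k * y k) / (\<Sum>k<n. y k) - l) < e"
    using eventually_ge_at_top[of K]
  proof eventually_elim
    case (elim n)
    have C0: "0 \<le> C" using e by (simp add: C_def)
    have pos: "0 < (\<Sum>k<n. y k)" using elim(1) C0 e by (smt (verit) divide_nonneg_pos)
    have split: "(\<Sum>k<n. f k) = (\<Sum>k<K. f k) + (\<Sum>k=K..<n. f k)" for f :: "nat \<Rightarrow> real"
      using sum.atLeastLessThan_concat[of 0 K n f] elim(2) by (simp add: lessThan_atLeast0)
    have "\<bar>\<Sum>k=K..<n. (r k - l) * y k\<bar> \<le> (\<Sum>k=K..<n. e/2 * y k)"
    proof (rule order_trans[OF sum_abs sum_mono])
      fix k assume "k \<in> {K..<n}"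
      hence "\<bar>r k - l\<bar> * y k \<le> e/2 * y k" using K[of k] by (intro mult_right_mono) auto
      thus "\<bar>(r k - l) * y k\<bar> \<le> e/2 * y k" using K(1)[of k] \<open>k \<in> _\<close> by (simp add: abs_mult)
    qed
    also have "\<dots> = e/2 * (\<Sum>k<n. y k) - e/2 * (\<Sum>k<K. y k)"
      unfolding split[of y] by (simp add: sum_distrib_left distrib_left sum_divide_distrib)
    also have "\<dots> \<le> e/2 * (\<Sum>k<n. y k) + e/2 * \<bar>\<Sum>k<K. y k\<bar>"
      using e mult_left_mono[of "- (\<Sum>k<K. y k)" "\<bar>\<Sum>k<K. y k\<bar>" "e/2"] by simp
    finally have 1: "\<bar>\<Sum>k<n. (r k - l) * y k\<bar> \<le> C + e/2 * (\<Sum>k<n. y k)"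
      unfolding split[of "\<lambda>k. (r k - l) * y k"] C_def by linarith
    have "2 * C < e * (\<Sum>k<n. y k)"
    proof -
      have "4 * C / e < (\<Sum>k<n. y k)" using elim(1) by linarith
      hence "4 * C < e * (\<Sum>k<n. y k)" using e by (simp add: pos_divide_less_eq mult.commute)
      thus ?thesis using C0 by linarith
    qed
    hence "\<bar>\<Sum>k<n. (r k - l) * y k\<bar> < e * (\<Sum>k<n. y k)" using 1 by linarith
    moreover have "(\<Sum>k<n. r k * y k) / (\<Sum>k<n. y k) - l = (\<Sum>k<n. (r k - l) * y k) / (\<Sum>k<n. y k)"
      using pos by (simp add: field_simps sum_subtractf sum_distrib_left)
    ultimately show ?case using pos by (simp add: abs_divide pos_divide_less_eq)
  qed
  thus "\<exists>no. \<forall>n\<ge>no. norm ((\<Sum>k<n. r k * y k) / (\<Sum>k<n. y k) - l) < e"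
    by (simp add: eventually_sequentially)
qed

text \<open>A one-sided lower bound is enough since only squares are compared. The offset
  \<open>x0\<close> is absorbed by applying the hypotheses with \<open>(1 + \<gamma>) / 2\<close>
  and \<open>(1 + c) / 2\<close> and spending the difference on it.\<close>

lemma limsup_square_ratio:
  fixes x s :: "nat \<Rightarrow> real"
  assumes s: "filterlim s at_top sequentially" and Q: "0 < Q"
    and U: "\<And>\<gamma>. 1 < \<gamma> \<Longrightarrow> \<forall>\<^sub>F n in sequentially. \<bar>x n\<bar> \<le> \<gamma> * sqrt (2 * Q * s n)"
    and L: "\<And>c. 0 < c \<Longrightarrow> c < 1 \<Longrightarrow> \<exists>\<^sub>F n in sequentially. c * sqrt (2 * Q * s n) \<le> x n"
  shows "limsup (\<lambda>n. ereal ((x0 + x n)\<^sup>2 / (2 * s n))) = ereal Q"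
proof -
  have small: "\<forall>\<^sub>F n in sequentially. \<bar>x0\<bar> \<le> e * sqrt (2 * Q * s n)" if e: "0 < e" for e
  proof -
    have "filterlim (\<lambda>n. e * sqrt (2 * Q * s n)) at_top sequentially"
      using e Q by (intro filterlim_tendsto_pos_mult_at_top[OF tendsto_const] filterlim_compose[OF sqrt_at_top] s) auto
    thus ?thesis by (simp add: filterlim_at_top)
  qed
  have pos: "\<forall>\<^sub>F n in sequentially. 0 < s n" using s by (simp add: filterlim_at_top_dense)
  have up: "\<forall>\<^sub>F n in sequentially. (x0 + x n)\<^sup>2 / (2 * s n) \<le> \<gamma>\<^sup>2 * Q" if g: "1 < \<gamma>" for \<gamma>
  proof -
    have "1 < (1 + \<gamma>) / 2" "0 < (\<gamma> - 1) / 2" using g by auto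
    from U[OF this(1)] small[OF this(2)] pos show ?thesis
    proof eventually_elim
      case (elim n)
      have "\<bar>x0 + x n\<bar> \<le> (1 + \<gamma>) / 2 * sqrt (2 * Q * s n) + (\<gamma> - 1) / 2 * sqrt (2 * Q * s n)"
        using elim by linarith
      also have "\<dots> = \<gamma> * sqrt (2 * Q * s n)" by (simp add: field_simps)
      finally have "\<bar>x0 + x n\<bar>\<^sup>2 \<le> (\<gamma> * sqrt (2 * Q * s n))\<^sup>2" by (intro power_mono) auto
      hence "(x0 + x n)\<^sup>2 \<le> \<gamma>\<^sup>2 * (2 * Q * s n)" using Q elim by (simp add: power_mult_distrib)
      thus ?case using elim by (simp add: pos_divide_le_eq mult_ac)
    qed
  qed
  have lo: "\<exists>\<^sub>F n in sequentially. c\<^sup>2 * Q \<le> (x0 + x n)\<^sup>2 / (2 * s n)" if c: "0 < c" "c < 1" for c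
  proof -
    have c': "0 < (1 + c) / 2" "(1 + c) / 2 < 1" "0 < (1 - c) / 2" using c by auto
    have "\<forall>\<^sub>F n in sequentially. (1 + c) / 2 * sqrt (2 * Q * s n) \<le> x n \<longrightarrow> c\<^sup>2 * Q \<le> (x0 + x n)\<^sup>2 / (2 * s n)"
      using small[OF c'(3)] pos
    proof eventually_elim
      case (elim n)
      show ?case
      proof
        assume "(1 + c) / 2 * sqrt (2 * Q * s n) \<le> x n"
        hence "(1 + c) / 2 * sqrt (2 * Q * s n) - (1 - c) / 2 * sqrt (2 * Q * s n) \<le> x0 + x n"
          using elim by linarith
        hence "c * sqrt (2 * Q * s n) \<le> x0 + x n" by (simp add: field_simps)
        hence "(c * sqrt (2 * Q * s n))\<^sup>2 \<le> (x0 + x n)\<^sup>2" using c Q elim by (intro power_mono) auto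
        hence "c\<^sup>2 * (2 * Q * s n) \<le> (x0 + x n)\<^sup>2" using Q elim by (simp add: power_mult_distrib)
        thus "c\<^sup>2 * Q \<le> (x0 + x n)\<^sup>2 / (2 * s n)" using elim by (simp add: pos_le_divide_eq mult_ac)
      qed
    qed
    thus ?thesis by (rule frequently_rev_mp[OF L[OF c'(1,2)]])
  qed
  show ?thesis
  proof (rule antisym)
    show "limsup (\<lambda>n. ereal ((x0 + x n)\<^sup>2 / (2 * s n))) \<le> ereal Q"
    proof (rule ereal_le_epsilon2)
      fix e :: real assume e: "0 < e"
      define \<gamma> where "\<gamma> = sqrt (1 + e / Q)"
      have "1 < \<gamma>" and g: "\<gamma>\<^sup>2 * Q = Q + e" using e Q by (auto simp: \<gamma>_def field_simps)
      from up[OF this(1)] have "limsup (\<lambda>n. ereal ((x0 + x n)\<^sup>2 / (2 * s n))) \<le> ereal (\<gamma>\<^sup>2 * Q)"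
        by (intro Limsup_bounded) (auto elim: eventually_mono)
      thus "limsup (\<lambda>n. ereal ((x0 + x n)\<^sup>2 / (2 * s n))) \<le> ereal Q + ereal e" unfolding g by simp
    qed
    show "ereal Q \<le> limsup (\<lambda>n. ereal ((x0 + x n)\<^sup>2 / (2 * s n)))"
    proof (rule ccontr)
      assume "\<not> ?thesis"
      then obtain y where y: "y < ereal Q" and lt: "limsup (\<lambda>n. ereal ((x0 + x n)\<^sup>2 / (2 * s n))) < y"
        using dense[of "limsup (\<lambda>n. ereal ((x0 + x n)\<^sup>2 / (2 * s n)))" "ereal Q"] by (auto simp: not_le)
      obtain c where c: "0 < c" "c < 1" "y < ereal (c\<^sup>2 * Q)"
      proof (cases "y \<le> 0")
        case True
        have "y < ereal ((1/2)\<^sup>2 * Q)" using True Q by (intro le_less_trans[OF True]) auto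
        thus ?thesis by (intro that[of "1/2"]) auto
      next
        case False
        then obtain r where r: "y = ereal r" "0 < r" "r < Q" using y by (cases y) auto
        obtain r' where r': "r < r'" "r' < Q" using dense r(3) by blast
        have "y < ereal ((sqrt (r' / Q))\<^sup>2 * Q)" using r r' Q by simp
        thus ?thesis using r r' Q by (intro that[of "sqrt (r' / Q)"]) auto
      qed
      have "\<exists>\<^sub>F n in sequentially. y < ereal ((x0 + x n)\<^sup>2 / (2 * s n))"
        by (rule frequently_elim1[OF lo[OF c(1,2)]]) (use c(3) in \<open>auto intro: less_le_trans\<close>)
      moreover have "\<forall>\<^sub>F n in sequentially. \<not> y < ereal ((x0 + x n)\<^sup>2 / (2 * s n))"
        using Limsup_lessD[OF lt] by eventually_elim auto
      ultimately show False unfolding frequently_def by blast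
    qed
  qed
qed

section \<open>The law of the iterated logarithm on paths with convergent variance\<close>

context weighted_draws
begin

text \<open>Factors from two sequences tending to 1 leave countably many null sets. The offset
  \<open>x0\<close> will be the initial deviation of the urn.\<close>

theorem law_of_iterated_logarithm:
  assumes Q: "0 < Q"
  shows "AE \<omega> in M. (\<lambda>k. q k \<omega>) \<longlonglongrightarrow> Q \<longrightarrow>
    limsup (\<lambda>n. ereal ((x0 + mart n \<omega>)\<^sup>2 / (2 * lil_scale n))) = ereal Q"
proof -
  have "AE \<omega> in M. \<forall>i. (\<forall>\<^sub>F k in sequentially. q k \<omega> \<le> (1 + 1 / real (Suc i)) * Q) \<longrightarrow>
    (\<forall>\<^sub>F n in sequentially. \<bar>mart n \<omega>\<bar> \<le> (1 + 1 / real (Suc i))\<^sup>2 * sqrt (2 * Q * lil_scale n))"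
    unfolding AE_all_countable by (intro allI lil_upper_abs Q) simp
  moreover have "AE \<omega> in M. \<forall>i. (\<lambda>k. q k \<omega>) \<longlonglongrightarrow> Q \<longrightarrow>
    (\<exists>\<^sub>F n in sequentially. (1 - 1 / real (Suc (Suc i))) * sqrt (2 * Q * lil_scale n) \<le> mart n \<omega>)"
    unfolding AE_all_countable by (intro allI lil_lower Q) auto
  ultimately show ?thesis
  proof eventually_elim
    case (elim \<omega>)
    show ?case
    proof
      assume qQ: "(\<lambda>k. q k \<omega>) \<longlonglongrightarrow> Q"
      show "limsup (\<lambda>n. ereal ((x0 + mart n \<omega>)\<^sup>2 / (2 * lil_scale n))) = ereal Q"
      proof (rule limsup_square_ratio[OF lil_scale_at_top Q])
        fix \<gamma> :: real assume "1 < \<gamma>"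
        hence "0 < sqrt \<gamma> - 1" by simp
        then obtain i where "1 / real (Suc i) < sqrt \<gamma> - 1" by (metis nat_approx_posE)
        hence "(1 + 1 / real (Suc i))\<^sup>2 \<le> (sqrt \<gamma>)\<^sup>2" by (intro power_mono) auto
        hence g: "(1 + 1 / real (Suc i))\<^sup>2 \<le> \<gamma>" using \<open>1 < \<gamma>\<close> by simp
        have "Q < (1 + 1 / real (Suc i)) * Q" using Q by simp
        with qQ have "\<forall>\<^sub>F k in sequentially. q k \<omega> < (1 + 1 / real (Suc i)) * Q" by (rule order_tendstoD)
        hence "\<forall>\<^sub>F k in sequentially. q k \<omega> \<le> (1 + 1 / real (Suc i)) * Q" by eventually_elim simp
        with elim(1) have "\<forall>\<^sub>F n in sequentially. \<bar>mart n \<omega>\<bar> \<le> (1 + 1 / real (Suc i))\<^sup>2 * sqrt (2 * Q * lil_scale n)"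
          by blast
        moreover have "\<forall>\<^sub>F n in sequentially. 0 \<le> lil_scale n"
          using lil_scale_at_top by (simp add: filterlim_at_top)
        ultimately show "\<forall>\<^sub>F n in sequentially. \<bar>mart n \<omega>\<bar> \<le> \<gamma> * sqrt (2 * Q * lil_scale n)"
        proof eventually_elim
          case (elim n)
          have "(1 + 1 / real (Suc i))\<^sup>2 * sqrt (2 * Q * lil_scale n) \<le> \<gamma> * sqrt (2 * Q * lil_scale n)"
            using g Q elim(2) by (intro mult_right_mono) auto
          thus ?case using elim(1) by linarith
        qed
      next
        fix c :: real assume c: "0 < c" "c < 1"
        then obtain i where "1 / real (Suc i) < 1 - c" by (metis nat_approx_posE diff_gt_0_iff_gt)
        moreover have "1 / real (Suc (Suc i)) \<le> 1 / real (Suc i)" by (simp add: field_simps)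
        ultimately have g: "c \<le> 1 - 1 / real (Suc (Suc i))" by linarith
        have "\<exists>\<^sub>F n in sequentially. (1 - 1 / real (Suc (Suc i))) * sqrt (2 * Q * lil_scale n) \<le> mart n \<omega>"
          using elim(2) qQ by blast
        moreover have "\<forall>\<^sub>F n in sequentially. 0 \<le> lil_scale n"
          using lil_scale_at_top by (simp add: filterlim_at_top)
        hence "\<forall>\<^sub>F n in sequentially. (1 - 1 / real (Suc (Suc i))) * sqrt (2 * Q * lil_scale n) \<le> mart n \<omega>
           \<longrightarrow> c * sqrt (2 * Q * lil_scale n) \<le> mart n \<omega>"
        proof eventually_elim
          case (elim n)
          have "c * sqrt (2 * Q * lil_scale n) \<le> (1 - 1 / real (Suc (Suc i))) * sqrt (2 * Q * lil_scale n)"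
            using g Q elim by (intro mult_right_mono) auto
          thus ?case by linarith
        qed
        ultimately show "\<exists>\<^sub>F n in sequentially. c * sqrt (2 * Q * lil_scale n) \<le> mart n \<omega>"
          by (rule frequently_rev_mp)
      qed
    qed
  qed
qed

lemma mart_meas: "mart n \<in> borel_measurable (F n)"
  using F_meas_sum[of "\<lambda>k _. b k" "\<lambda>_ _. 0" 0 n] by (simp add: mart_def[abs_def] atLeast0LessThan)

lemma mart_Suc: "mart (Suc n) \<omega> = mart n \<omega> + b n * \<xi> n \<omega>"
  by (simp add: mart_def)

section \<open>The quadratic strong law\<close>

text \<open>The summand for \<open>k = 0\<close> vanishes because \<open>\<nu> 0 = 0\<close> and division by zero yields zero.\<close>

theorem quadratic_strong_law:
  assumes b0: "\<And>k. b k \<noteq> 0"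
  shows "AE \<omega> in M. (\<lambda>k. q k \<omega>) \<longlonglongrightarrow> Q \<longrightarrow>
    (\<lambda>n. (\<Sum>k<n. (x0 + mart k \<omega>)\<^sup>2 * (b k)\<^sup>2 / (\<nu> k * \<nu> (Suc k))) / ln (\<nu> n)) \<longlonglongrightarrow> Q"
proof -
  have B: "0 < B" using b_bound[of 0] b0[of 0] by linarith
  have nu0: "\<nu> 0 = 0" by (simp add: \<nu>_def)
  have nu_pos: "0 < \<nu> (Suc k)" for k
    unfolding \<nu>_def using b0 by (intro sum_pos) auto
  define m where "m k \<omega> = x0 + mart k \<omega>" for k \<omega>
  \<comment> \<open>The coefficient of \<open>\<xi> k\<close> in the increment of m^2/\<nu>: the
    cross term plus the linear part of the squared innovation. It is zero at \<open>k = 0\<close>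
    because the telescoping starts at time 1, where \<open>\<nu>\<close> is positive.\<close>
  define h where "h k \<omega> = (if k = 0 then 0 else (2 * m k \<omega> * b k + (b k)\<^sup>2 * (1 - 2 * p k \<omega>)) / \<nu> (Suc k))" for k \<omega>
  have hm: "h k \<in> borel_measurable (F k)" for k
    unfolding h_def[abs_def] m_def using mart_meas[of k] p_meas[of k] by measurable
  \<comment> \<open>With u = b^2/\<nu>(k+1) the logarithmic increment is -ln(1 - u), and u tends to
    0 because \<open>b\<close> is bounded.\<close>
  have lim_ratio: "(\<lambda>k. ((b k)\<^sup>2 / \<nu> (Suc k)) / (ln (\<nu> (Suc k)) - ln (\<nu> k))) \<longlonglongrightarrow> 1"
  proof -
    have B0: "(\<lambda>k. B\<^sup>2 / \<nu> (Suc k)) \<longlonglongrightarrow> 0"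
      by (intro tendsto_divide_0[OF tendsto_const] filterlim_at_top_imp_at_infinity
          filterlim_compose[OF nu_lim filterlim_Suc])
    have "(\<lambda>k. (b k)\<^sup>2 / \<nu> (Suc k)) \<longlonglongrightarrow> 0"
      by (rule tendsto_sandwich[OF _ _ tendsto_const B0])
         (use b_square_le nu_pos in \<open>auto intro!: always_eventually divide_right_mono simp: less_imp_le\<close>)
    hence "filterlim (\<lambda>k. (b k)\<^sup>2 / \<nu> (Suc k)) (at_right 0) sequentially"
      using nu_pos b0 unfolding filterlim_at by (auto simp: less_imp_neq[OF nu_pos, symmetric])
    moreover have "((\<lambda>u::real. u / (- ln (1 - u))) \<longlongrightarrow> 1) (at_right 0)" by real_asymp
    ultimately have "(\<lambda>k. ((b k)\<^sup>2 / \<nu> (Suc k)) / (- ln (1 - (b k)\<^sup>2 / \<nu> (Suc k)))) \<longlonglongrightarrow> 1"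
      by (rule filterlim_compose[rotated])
    moreover have "\<forall>\<^sub>F k in sequentially. ((b k)\<^sup>2 / \<nu> (Suc k)) / (- ln (1 - (b k)\<^sup>2 / \<nu> (Suc k))) =
       ((b k)\<^sup>2 / \<nu> (Suc k)) / (ln (\<nu> (Suc k)) - ln (\<nu> k))"
      using eventually_gt_at_top[of 0]
    proof eventually_elim
      case (elim k)
      have nk: "0 < \<nu> k" using nu_pos[of "k - 1"] elim by simp
      have "1 - (b k)\<^sup>2 / \<nu> (Suc k) = \<nu> k / \<nu> (Suc k)"
        using nu_pos[of k] by (simp add: nu_Suc field_simps)
      thus ?case using nk nu_pos[of k] by (simp add: ln_div)
    qed
    ultimately show ?thesis by (rule Lim_transform_eventually)
  qed
  show ?thesis using martingale_growth[of h, OF hm] mart_bigo AE_space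
  proof eventually_elim
    case (elim \<omega>)
    note w = elim(3)
    show ?case
    proof
      assume qQ: "(\<lambda>k. q k \<omega>) \<longlonglongrightarrow> Q"
      have Q0: "0 \<le> Q" by (rule LIMSEQ_le_const[OF qQ]) (use q_range[OF w] in auto)
      define Qs where "Qs n = (\<Sum>k<n. (m k \<omega>)\<^sup>2 * (b k)\<^sup>2 / (\<nu> k * \<nu> (Suc k)))" for n
      define T where "T n = (\<Sum>k<n. h k \<omega> * \<xi> k \<omega>)" for n
      define R where "R n = (\<Sum>k<n. (b k)\<^sup>2 * q k \<omega> / \<nu> (Suc k))" for n
      define m\<^sub>1 where "m\<^sub>1 = (m 1 \<omega>)\<^sup>2 / \<nu> 1 - R 1"
      have nk: "0 < \<nu> k" if "k > 0" for k using nu_pos[of "k - 1"] that by simp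
      \<comment> \<open>Since b^2/(\<nu>(k) \<nu>(k+1)) = 1/\<nu>(k) - 1/\<nu>(k+1), what m^2/\<nu>
        loses to its growing denominator is the summand of \<open>Qs\<close>.\<close>
      have ident: "(m n \<omega>)\<^sup>2 / \<nu> n + Qs n = m\<^sub>1 + T n + R n" if "1 \<le> n" for n
        using that
      proof (induction n rule: dec_induct)
        case base
        show ?case by (simp add: m\<^sub>1_def T_def Qs_def h_def nu0)
      next
        case (step n)
        have n0: "n \<noteq> 0" "0 < \<nu> n" using step(1) nk by auto
        have mS: "m (Suc n) \<omega> = m n \<omega> + b n * \<xi> n \<omega>" by (simp add: m_def mart_Suc)
        have "(m (Suc n) \<omega>)\<^sup>2 = (m n \<omega>)\<^sup>2 + 2 * m n \<omega> * b n * \<xi> n \<omega> + (b n)\<^sup>2 * (\<xi> n \<omega>)\<^sup>2"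
          unfolding mS by (simp add: power2_eq_square algebra_simps)
        also have "\<dots> = (m n \<omega>)\<^sup>2 + (2 * m n \<omega> * b n + (b n)\<^sup>2 * (1 - 2 * p n \<omega>)) * \<xi> n \<omega> + (b n)\<^sup>2 * q n \<omega>"
          unfolding xi_square[OF w] by (simp add: algebra_simps)
        finally have *: "(m (Suc n) \<omega>)\<^sup>2 = (m n \<omega>)\<^sup>2 + (2 * m n \<omega> * b n + (b n)\<^sup>2 * (1 - 2 * p n \<omega>)) * \<xi> n \<omega> + (b n)\<^sup>2 * q n \<omega>" .
        have "(m (Suc n) \<omega>)\<^sup>2 / \<nu> (Suc n) = (m n \<omega>)\<^sup>2 / \<nu> (Suc n) + h n \<omega> * \<xi> n \<omega> + (b n)\<^sup>2 * q n \<omega> / \<nu> (Suc n)"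
        proof -
          have "(u + v * x + z) / y = u / y + v / y * x + z / y" for u v x y z :: real
            by (simp add: add_divide_distrib)
          thus ?thesis using n0 *  by (simp add: h_def)
        qed
        moreover have "(m n \<omega>)\<^sup>2 / \<nu> (Suc n) + (m n \<omega>)\<^sup>2 * (b n)\<^sup>2 / (\<nu> n * \<nu> (Suc n)) = (m n \<omega>)\<^sup>2 / \<nu> n"
          using n0 nu_pos[of n] by (simp add: divide_simps) (simp add: nu_Suc algebra_simps)
        ultimately show ?case using step.IH by (simp add: Qs_def T_def R_def)
      qed
      have Qs0: "0 \<le> Qs n" for n
        unfolding Qs_def by (intro sum_nonneg) (auto simp: \<nu>_def sum_nonneg)
      have mb: "\<forall>\<^sub>F n in sequentially. \<bar>m n \<omega>\<bar> \<le> 4 * sqrt (1/2 * lil_scale n) + \<bar>x0\<bar>"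
        using elim(2) by eventually_elim (auto simp: m_def)
      \<comment> \<open>The growth lemma needs multipliers at most 1. The crude bound provides this:
        m is of order at most sqrt(\<nu> ln ln \<nu>), so m/\<nu> tends to 0.\<close>
      have hb: "\<forall>\<^sub>F k in sequentially. \<bar>h k \<omega>\<bar> \<le> 1"
      proof -
        define X where "X = \<bar>x0\<bar> + 1"
        have X: "X > 0" by (simp add: X_def add_nonneg_pos)
        have "((\<lambda>x. (2 * B * (4 * sqrt (1/2 * (x * ln (ln x))) + X) + B\<^sup>2) / x) \<longlongrightarrow> 0) at_top"
          using B X by real_asymp
        hence "(\<lambda>n. (2 * B * (4 * sqrt (1/2 * lil_scale n) + X) + B\<^sup>2) / \<nu> n) \<longlonglongrightarrow> 0"
          unfolding lil_scale_def using filterlim_compose[OF _ nu_lim] by blast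
        hence "\<forall>\<^sub>F n in sequentially. (2 * B * (4 * sqrt (1/2 * lil_scale n) + X) + B\<^sup>2) / \<nu> n < 1"
          by (rule order_tendstoD) simp
        thus ?thesis using mb eventually_gt_at_top[of 0]
        proof eventually_elim
          case (elim k)
          have "\<bar>2 * m k \<omega> * b k + (b k)\<^sup>2 * (1 - 2 * p k \<omega>)\<bar> \<le> 2 * B * (4 * sqrt (1/2 * lil_scale k) + X) + B\<^sup>2"
          proof -
            have "\<bar>m k \<omega>\<bar> * \<bar>b k\<bar> \<le> (4 * sqrt (1/2 * lil_scale k) + X) * B"
              using elim(2) b_bound[of k] by (intro mult_mono) (auto simp: X_def)
            hence 1: "\<bar>2 * m k \<omega> * b k\<bar> \<le> 2 * B * (4 * sqrt (1/2 * lil_scale k) + X)"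
              by (simp add: abs_mult algebra_simps)
            have "\<bar>(b k)\<^sup>2 * (1 - 2 * p k \<omega>)\<bar> \<le> B\<^sup>2 * 1"
              unfolding abs_mult using b_square_le[of k] p_range[OF w, of k] by (intro mult_mono) auto
            thus ?thesis using 1 by linarith
          qed
          hence "\<bar>h k \<omega>\<bar> \<le> (2 * B * (4 * sqrt (1/2 * lil_scale k) + X) + B\<^sup>2) / \<nu> (Suc k)"
            using elim(3) nu_pos[of k] by (simp add: h_def abs_divide divide_right_mono)
          also have "\<dots> \<le> (2 * B * (4 * sqrt (1/2 * lil_scale k) + X) + B\<^sup>2) / \<nu> k"
            using nu_mono[of k "Suc k"] nk[of k] nu_pos[of k] elim(3) \<open>\<bar>2 * m k \<omega> * b k + _\<bar> \<le> _\<close>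
            by (intro divide_left_mono) auto
          finally show ?case using elim(1) by linarith
        qed
      qed
      have T_bound: "\<exists>C. \<forall>n. \<bar>T n\<bar> \<le> C + l * Qs n" if l: "0 < l" for l
      proof -
        have "0 < l / 2" using l by simp
        then obtain C where C: "\<And>n. \<bar>T n\<bar> \<le> C + l / 2 * (\<Sum>k<n. (h k \<omega>)\<^sup>2 * q k \<omega>)"
          using elim(1) hb unfolding T_def by blast
        \<comment> \<open>Here the estimate becomes self-bounding. With (u + v)^2 at most 2u^2 +
          2v^2 and q at most 1/4, the part from u gives twice the summand of \<open>Qs\<close>,
          while the part from v is at most B^2 times a telescoping difference.\<close>
        have hq_sum: "(\<Sum>k<n. (h k \<omega>)\<^sup>2 * q k \<omega>) \<le> 2 * Qs n + B\<^sup>2 * (1 / \<nu> 1)" for n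
        proof -
          have "(h k \<omega>)\<^sup>2 * q k \<omega> \<le> 2 * ((m k \<omega>)\<^sup>2 * (b k)\<^sup>2 / (\<nu> k * \<nu> (Suc k))) + B\<^sup>2 * (if k = 0 then 0 else 1 / \<nu> k - 1 / \<nu> (Suc k))" for k
          proof (cases "k = 0")
            case True
            thus ?thesis by (simp add: h_def nu0)
          next
            case False
            define u where "u = 2 * m k \<omega> * b k"
            define v where "v = (b k)\<^sup>2 * (1 - 2 * p k \<omega>)"
            have nuk: "0 < \<nu> k" "0 < \<nu> (Suc k)" "\<nu> k \<le> \<nu> (Suc k)" using nk False nu_pos nu_mono by auto
            have uv: "(u + v)\<^sup>2 \<le> 2 * u\<^sup>2 + 2 * v\<^sup>2"
              using zero_le_power2[of "u - v"] by (simp add: power2_eq_square algebra_simps)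
            have v2: "v\<^sup>2 \<le> (b k)\<^sup>2 * B\<^sup>2"
            proof -
              have "(1 - 2 * p k \<omega>)\<^sup>2 \<le> 1" using p_range[OF w, of k] by (subst abs_square_le_1) auto
              hence "((b k)\<^sup>2 * (b k)\<^sup>2) * (1 - 2 * p k \<omega>)\<^sup>2 \<le> ((b k)\<^sup>2 * B\<^sup>2) * 1"
                using b_square_le[of k] by (intro mult_mono mult_left_mono) auto
              thus ?thesis by (simp add: v_def power_mult_distrib power2_eq_square[of "(b k)\<^sup>2"])
            qed
            have "(u + v)\<^sup>2 * q k \<omega> \<le> (2 * u\<^sup>2 + 2 * v\<^sup>2) * (1/4)"
              using uv q_range[OF w, of k] by (intro mult_mono) auto
            also have "\<dots> \<le> 2 * ((m k \<omega>)\<^sup>2 * (b k)\<^sup>2) + B\<^sup>2 * (b k)\<^sup>2"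
              using v2 by (simp add: u_def power_mult_distrib) (smt (verit) mult.commute zero_le_mult_iff zero_le_power2)
            finally have 1: "(u + v)\<^sup>2 * q k \<omega> \<le> 2 * ((m k \<omega>)\<^sup>2 * (b k)\<^sup>2) + B\<^sup>2 * (b k)\<^sup>2" .
            have "(h k \<omega>)\<^sup>2 * q k \<omega> = (u + v)\<^sup>2 * q k \<omega> / (\<nu> (Suc k) * \<nu> (Suc k))"
              using False by (simp add: h_def u_def v_def power_divide power2_eq_square[of "\<nu> (Suc k)"])
            also have "\<dots> \<le> (2 * ((m k \<omega>)\<^sup>2 * (b k)\<^sup>2) + B\<^sup>2 * (b k)\<^sup>2) / (\<nu> k * \<nu> (Suc k))"
              using nuk 1 by (intro frac_le mult_right_mono) auto
            also have "\<dots> = 2 * ((m k \<omega>)\<^sup>2 * (b k)\<^sup>2 / (\<nu> k * \<nu> (Suc k))) + B\<^sup>2 * ((b k)\<^sup>2 / (\<nu> k * \<nu> (Suc k)))"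
              by (simp add: add_divide_distrib)
            also have "(b k)\<^sup>2 / (\<nu> k * \<nu> (Suc k)) = 1 / \<nu> k - 1 / \<nu> (Suc k)"
              using nuk by (simp add: nu_Suc divide_simps)
            finally show ?thesis using False by simp
          qed
          hence "(\<Sum>k<n. (h k \<omega>)\<^sup>2 * q k \<omega>) \<le> (\<Sum>k<n. 2 * ((m k \<omega>)\<^sup>2 * (b k)\<^sup>2 / (\<nu> k * \<nu> (Suc k))) + B\<^sup>2 * (if k = 0 then 0 else 1 / \<nu> k - 1 / \<nu> (Suc k)))"
            by (intro sum_mono)
          also have "\<dots> = 2 * Qs n + B\<^sup>2 * (\<Sum>k<n. if k = 0 then 0 else 1 / \<nu> k - 1 / \<nu> (Suc k))"
            by (simp add: sum.distrib sum_distrib_left Qs_def)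
          also have "(\<Sum>k<n. if k = 0 then 0 else 1 / \<nu> k - 1 / \<nu> (Suc k)) \<le> 1 / \<nu> 1"
          proof (cases n)
            case 0
            thus ?thesis using nu_pos[of 0] by simp
          next
            case (Suc n')
            have "(\<Sum>k<Suc n'. if k = 0 then 0 else 1 / \<nu> k - 1 / \<nu> (Suc k)) = 1 / \<nu> 1 - 1 / \<nu> (Suc n')"
              by (induction n') auto
            thus ?thesis unfolding Suc using nu_pos[of n'] by simp
          qed
          finally show ?thesis by (simp add: mult_left_mono)
        qed
        have "\<bar>T n\<bar> \<le> (C + l / 2 * (B\<^sup>2 * (1 / \<nu> 1))) + l * Qs n" for n
        proof -
          have "l / 2 * (\<Sum>k<n. (h k \<omega>)\<^sup>2 * q k \<omega>) \<le> l / 2 * (2 * Qs n + B\<^sup>2 * (1 / \<nu> 1))"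
            using l by (intro mult_left_mono hq_sum) auto
          also have "\<dots> = l / 2 * (B\<^sup>2 * (1 / \<nu> 1)) + l * Qs n" by (simp add: distrib_left)
          finally show ?thesis using C[of n] by linarith
        qed
        thus ?thesis by blast
      qed
      have ln_lim: "filterlim (\<lambda>n. ln (\<nu> n)) at_top sequentially"
        by (rule filterlim_compose[OF ln_at_top nu_lim])
      have R_lim: "(\<lambda>n. R n / ln (\<nu> n)) \<longlonglongrightarrow> Q"
      proof -
        define y where "y k = ln (\<nu> (Suc k)) - ln (\<nu> k)" for k
        define r where "r k = q k \<omega> * (((b k)\<^sup>2 / \<nu> (Suc k)) / y k)" for k
        \<comment> \<open>Exact because ln 0 is 0 in HOL, so the lower end of the telescoping sum
          contributes nothing.\<close>
        have sy: "(\<Sum>k<n. y k) = ln (\<nu> n)" for n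
          using sum_lessThan_telescope[of "\<lambda>k. ln (\<nu> k)" n] by (simp add: y_def nu0)
        have y_pos: "y k > 0" if "k > 0" for k
          unfolding y_def using nk[OF that] b0[of k] by (simp add: nu_Suc add_pos_nonneg)
        have "r \<longlonglongrightarrow> Q * 1"
          unfolding r_def[abs_def] y_def by (intro tendsto_mult qQ lim_ratio)
        moreover have "\<forall>\<^sub>F k in sequentially. 0 \<le> y k"
          using eventually_gt_at_top[of 0] by eventually_elim (simp add: y_pos less_imp_le)
        ultimately have lim: "(\<lambda>n. (\<Sum>k<n. r k * y k) / (\<Sum>k<n. y k)) \<longlonglongrightarrow> Q * 1"
          by (rule weighted_average_tendsto) (simp add: sy ln_lim)
        \<comment> \<open>Index 0 is separated: \<open>y 0 = ln (\<nu> 1)\<close> may vanish, and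
          then \<open>r 0 * y 0\<close> is not the summand of \<open>R\<close>.\<close>
        define D where "D = R 1 - r 0 * y 0"
        have "R n = (\<Sum>k<n. r k * y k) + D" if "n \<ge> 1" for n
          using that
        proof (induction n rule: dec_induct)
          case base
          show ?case by (simp add: D_def)
        next
          case (step n)
          have "r n * y n = (b n)\<^sup>2 * q n \<omega> / \<nu> (Suc n)"
            using y_pos[of n] step(1) by (simp add: r_def)
          thus ?case using step.IH by (simp add: R_def)
        qed
        hence "\<forall>\<^sub>F n in sequentially. (\<Sum>k<n. r k * y k) / ln (\<nu> n) + D / ln (\<nu> n) = R n / ln (\<nu> n)"
          by (intro eventually_sequentiallyI[of 1]) (simp add: add_divide_distrib)
        moreover have "(\<lambda>n. (\<Sum>k<n. r k * y k) / ln (\<nu> n) + D / ln (\<nu> n)) \<longlonglongrightarrow> Q * 1 + 0"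
          using lim by (intro tendsto_add tendsto_divide_0[OF tendsto_const]
             filterlim_at_top_imp_at_infinity ln_lim) (simp_all add: sy)
        ultimately show ?thesis using Lim_transform_eventually by fastforce
      qed
      have m_lim: "(\<lambda>n. (m n \<omega>)\<^sup>2 / \<nu> n / ln (\<nu> n)) \<longlonglongrightarrow> 0"
      proof -
        define X where "X = \<bar>x0\<bar> + 1"
        have X: "X > 0" by (simp add: X_def add_nonneg_pos)
        have "((\<lambda>x. (4 * sqrt (1/2 * (x * ln (ln x))) + X)\<^sup>2 / x / ln x) \<longlongrightarrow> 0) at_top"
          using X by real_asymp
        hence l0: "(\<lambda>n. (4 * sqrt (1/2 * lil_scale n) + X)\<^sup>2 / \<nu> n / ln (\<nu> n)) \<longlonglongrightarrow> 0"
          unfolding lil_scale_def using filterlim_compose[OF _ nu_lim] by blast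
        have "\<forall>\<^sub>F n in sequentially. 1 < \<nu> n" using nu_lim by (simp add: filterlim_at_top_dense)
        hence ev: "\<forall>\<^sub>F n in sequentially. 0 \<le> (m n \<omega>)\<^sup>2 / \<nu> n / ln (\<nu> n) \<and> (m n \<omega>)\<^sup>2 / \<nu> n / ln (\<nu> n) \<le> (4 * sqrt (1/2 * lil_scale n) + X)\<^sup>2 / \<nu> n / ln (\<nu> n)"
          using mb
        proof eventually_elim
          case (elim n)
          have "\<bar>m n \<omega>\<bar>\<^sup>2 \<le> (4 * sqrt (1/2 * lil_scale n) + X)\<^sup>2"
            using elim(2) by (intro power_mono) (auto simp: X_def)
          thus ?case using elim(1) by (auto intro!: divide_right_mono)
        qed
        show ?thesis
          by (rule tendsto_sandwich[OF _ _ tendsto_const l0]) (use ev in \<open>auto elim: eventually_mono\<close>)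
      qed
      define x where "x n = Qs n / ln (\<nu> n)" for n
      have est: "\<exists>e. e \<longlonglongrightarrow> 0 \<and> (\<forall>\<^sub>F n in sequentially. \<bar>x n - R n / ln (\<nu> n)\<bar> \<le> e n + l * x n)" if l: "0 < l" for l
      proof -
        obtain C where C: "\<And>n. \<bar>T n\<bar> \<le> C + l * Qs n" using T_bound[OF l] by blast
        define e where "e n = (\<bar>m\<^sub>1\<bar> + C) / ln (\<nu> n) + (m n \<omega>)\<^sup>2 / \<nu> n / ln (\<nu> n)" for n
        have "e \<longlonglongrightarrow> 0 + 0" unfolding e_def[abs_def]
          by (intro tendsto_add m_lim tendsto_divide_0[OF tendsto_const] filterlim_at_top_imp_at_infinity ln_lim)
        moreover have "\<forall>\<^sub>F n in sequentially. \<bar>x n - R n / ln (\<nu> n)\<bar> \<le> e n + l * x n"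
        proof -
          have "\<forall>\<^sub>F n in sequentially. 0 < ln (\<nu> n)" using ln_lim by (simp add: filterlim_at_top_dense)
          thus ?thesis using eventually_ge_at_top[of 1]
          proof eventually_elim
            case (elim n)
            have "Qs n - R n = m\<^sub>1 + T n - (m n \<omega>)\<^sup>2 / \<nu> n" using ident[OF elim(2)] by linarith
            moreover have "0 \<le> (m n \<omega>)\<^sup>2 / \<nu> n" using nk[of n] elim(2) by simp
            ultimately have "\<bar>Qs n - R n\<bar> \<le> \<bar>m\<^sub>1\<bar> + C + l * Qs n + (m n \<omega>)\<^sup>2 / \<nu> n"
              using C[of n] by linarith
            hence "\<bar>Qs n - R n\<bar> / ln (\<nu> n) \<le> (\<bar>m\<^sub>1\<bar> + C + l * Qs n + (m n \<omega>)\<^sup>2 / \<nu> n) / ln (\<nu> n)"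
              using elim(1) by (intro divide_right_mono) auto
            moreover have "\<bar>Qs n - R n\<bar> / ln (\<nu> n) = \<bar>x n - R n / ln (\<nu> n)\<bar>"
              using elim(1) by (simp add: x_def diff_divide_distrib[symmetric] abs_divide)
            ultimately show ?case by (simp add: e_def x_def add_divide_distrib)
          qed
        qed
        ultimately show ?thesis by auto
      qed
      have x0': "\<forall>\<^sub>F n in sequentially. 0 \<le> x n"
      proof -
        have "\<forall>\<^sub>F n in sequentially. 0 < ln (\<nu> n)" using ln_lim by (simp add: filterlim_at_top_dense)
        thus ?thesis by eventually_elim (simp add: x_def Qs0)
      qed
      \<comment> \<open>The self-bounding estimate is used twice: with l = 1/2 it shows that
        \<open>x\<close> is bounded, and then a small l makes the error l x negligible.\<close>
      have x_bd: "\<forall>\<^sub>F n in sequentially. x n \<le> 2 * (Q + 2)"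
      proof -
        obtain e where e: "e \<longlonglongrightarrow> 0" "\<forall>\<^sub>F n in sequentially. \<bar>x n - R n / ln (\<nu> n)\<bar> \<le> e n + (1/2) * x n"
          using est[of "1/2"] by auto
        have "\<forall>\<^sub>F n in sequentially. e n < 1" using e(1) by (rule order_tendstoD) simp
        moreover have "\<forall>\<^sub>F n in sequentially. R n / ln (\<nu> n) < Q + 1" using R_lim by (rule order_tendstoD) simp
        ultimately show ?thesis using e(2) by eventually_elim (simp add: abs_le_iff)
      qed
      have "x \<longlonglongrightarrow> Q"
        unfolding tendsto_iff
      proof (intro allI impI)
        fix d :: real assume d: "0 < d"
        define l where "l = d / (3 * (2 * (Q + 2)))"
        have l: "0 < l" using d Q0 by (simp add: l_def)
        have ld: "l * (2 * (Q + 2)) = d / 3"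
        proof -
          have "d / (3 * z) * z = d / 3" if "0 < z" for z using that by simp
          moreover have "0 < 2 * (Q + 2)" using Q0 by simp
          ultimately show ?thesis unfolding l_def by blast
        qed
        obtain e where e: "e \<longlonglongrightarrow> 0" "\<forall>\<^sub>F n in sequentially. \<bar>x n - R n / ln (\<nu> n)\<bar> \<le> e n + l * x n"
          using est[OF l] by auto
        have "\<forall>\<^sub>F n in sequentially. e n < d / 3" using e(1) by (rule order_tendstoD) (use d in simp)
        moreover have "\<forall>\<^sub>F n in sequentially. dist (R n / ln (\<nu> n)) Q < d / 3"
          using R_lim d unfolding tendsto_iff by (meson divide_pos_pos zero_less_numeral)
        ultimately show "\<forall>\<^sub>F n in sequentially. dist (x n) Q < d"
          using e(2) x_bd
        proof eventually_elim
          case (elim n)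
          have "l * x n \<le> l * (2 * (Q + 2))" using elim(4) l by (intro mult_left_mono) auto
          thus ?case using elim ld unfolding dist_real_def by linarith
        qed
      qed
      thus "(\<lambda>n. (\<Sum>k<n. (x0 + mart k \<omega>)\<^sup>2 * (b k)\<^sup>2 / (\<nu> k * \<nu> (Suc k))) / ln (\<nu> n)) \<longlonglongrightarrow> Q"
        by (simp add: x_def[abs_def] Qs_def m_def)
    qed
  qed
qed

end

section \<open>The critically small urn\<close>

text \<open>ln f / ln g = 1 + ln(f/g) / ln g, so one logarithm removes the constant. Applied twice,
  it passes from \<open>\<nu> n\<close> to its iterated logarithm.\<close>

lemma ln_ratio_tendsto:
  fixes f g :: "nat \<Rightarrow> real"
  assumes fg: "(\<lambda>n. f n / g n) \<longlonglongrightarrow> k" and k: "0 < k" and g: "filterlim g at_top sequentially"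
  shows "(\<lambda>n. ln (f n) / ln (g n)) \<longlonglongrightarrow> 1"
proof -
  have lg: "filterlim (\<lambda>n. ln (g n)) at_top sequentially" by (rule filterlim_compose[OF ln_at_top g])
  have "(\<lambda>n. ln (f n / g n)) \<longlonglongrightarrow> ln k" using fg k by (intro tendsto_ln) auto
  hence "(\<lambda>n. ln (f n / g n) / ln (g n) + 1) \<longlonglongrightarrow> 0 + 1"
    by (intro tendsto_add tendsto_const tendsto_divide_0 filterlim_at_top_imp_at_infinity lg)
  moreover have "\<forall>\<^sub>F n in sequentially. ln (f n / g n) / ln (g n) + 1 = ln (f n) / ln (g n)"
  proof -
    have "\<forall>\<^sub>F n in sequentially. 0 < f n / g n" using fg k by (rule order_tendstoD)
    moreover have "\<forall>\<^sub>F n in sequentially. 1 < g n" using g by (simp add: filterlim_at_top_dense)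
    ultimately show ?thesis
    proof eventually_elim
      case (elim n)
      have "0 < f n" using elim by (simp add: zero_less_divide_iff)
      thus ?case using elim by (simp add: ln_div diff_divide_distrib)
    qed
  qed
  ultimately show ?thesis using Lim_transform_eventually by fastforce
qed

text \<open>\<open>a_eq\<close> is \<sigma> = 1/2 without fractions or subtraction of naturals. It
  gives S = 2(b + c) and, with the balance, d = c + 2b.\<close>

locale critical_urn = balanced_polya_urn M F a b c d \<alpha> \<beta> \<epsilon> U
  for M :: "'w measure" and F a b c d \<alpha> \<beta> and \<epsilon> :: "nat \<Rightarrow> 'w \<Rightarrow> real" and U :: "nat \<Rightarrow> 'w \<Rightarrow> real^2" +
  assumes a_eq: "a = b + 2 * c" and b_pos: "0 < b" and c_pos: "0 < c"
begin

text \<open>By criticality this agrees with a - c and d - b and is half of S.\<close>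

definition m :: real where "m = real b + real c"

definition \<tau> :: real where "\<tau> = real \<alpha> + real \<beta>"

definition red :: "nat \<Rightarrow> 'w \<Rightarrow> real" where "red n \<omega> = U n \<omega> $ 1 / (U n \<omega> $ 1 + U n \<omega> $ 2)"

lemma m_pos: "0 < m"
  using b_pos by (simp add: m_def add_pos_nonneg)

lemma tau_pos: "0 < \<tau>"
  using nonempty unfolding \<tau>_def by linarith

lemma d_eq: "d = c + 2 * b"
  using balanced a_eq by simp

lemma U_components:
  assumes "\<omega> \<in> space M"
  shows "U 0 \<omega> $ 1 = real \<alpha>" "U 0 \<omega> $ 2 = real \<beta>"
    "U (Suc n) \<omega> $ 1 = U n \<omega> $ 1 + (real c + m * \<epsilon> (Suc n) \<omega>)"
    "U (Suc n) \<omega> $ 2 = U n \<omega> $ 2 + (real d - m * \<epsilon> (Suc n) \<omega>)"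
  unfolding U_0[OF assms] U_Suc[OF assms]
  by (simp_all add: matrix_vector_mult_def transpose_def sum_2 replacement_matrix_def a_eq d_eq m_def algebra_simps)

lemma U_total: "\<omega> \<in> space M \<Longrightarrow> U n \<omega> $ 1 + U n \<omega> $ 2 = \<tau> + 2 * m * real n"
  by (induction n) (auto simp: U_components \<tau>_def d_eq m_def algebra_simps)

lemma U_nonneg:
  assumes w: "\<omega> \<in> space M"
  shows "0 \<le> U n \<omega> $ 1 \<and> 0 \<le> U n \<omega> $ 2"
proof (induction n)
  case (Suc n)
  show ?case using Suc draw_range[OF w, of n] m_pos
    by (auto simp: U_components[OF w] d_eq m_def)
qed (simp add: U_components[OF w])

lemma U_meas: "(\<lambda>\<omega>. U n \<omega> $ 1) \<in> borel_measurable (F n)"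
proof (induction n)
  case 0
  have "(\<lambda>\<omega>. U 0 \<omega> $ 1) \<in> borel_measurable (F 0) \<longleftrightarrow> (\<lambda>\<omega>. real \<alpha>) \<in> borel_measurable (F 0)"
    by (rule measurable_cong) (simp add: space_F U_components)
  thus ?case by simp
next
  case (Suc n)
  have "(\<lambda>\<omega>. U n \<omega> $ 1) \<in> borel_measurable (F (Suc n))"
    using borel_measurable_subalgebra[OF _ _ Suc, of "F (Suc n)"] sets_F_mono[of n "Suc n"] by (simp add: space_F)
  hence "(\<lambda>\<omega>. U n \<omega> $ 1 + (real c + m * \<epsilon> (Suc n) \<omega>)) \<in> borel_measurable (F (Suc n))"
    using adapted[of n] by simp
  moreover have "(\<lambda>\<omega>. U (Suc n) \<omega> $ 1) \<in> borel_measurable (F (Suc n)) \<longleftrightarrow>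
     (\<lambda>\<omega>. U n \<omega> $ 1 + (real c + m * \<epsilon> (Suc n) \<omega>)) \<in> borel_measurable (F (Suc n))"
    by (rule measurable_cong) (simp add: space_F U_components)
  ultimately show ?case by simp
qed

lemma red_meas: "red n \<in> borel_measurable (F n)"
proof -
  have "red n \<in> borel_measurable (F n) \<longleftrightarrow> (\<lambda>\<omega>. U n \<omega> $ 1 / (\<tau> + 2 * m * real n)) \<in> borel_measurable (F n)"
    by (rule measurable_cong) (simp add: space_F red_def U_total)
  thus ?thesis using U_meas[of n] by simp
qed

lemma red_range: "\<omega> \<in> space M \<Longrightarrow> 0 \<le> red n \<omega> \<and> red n \<omega> \<le> 1"
  using U_nonneg[of \<omega> n] by (auto simp: red_def divide_le_eq_1)

section \<open>Asymptotics of the normalising product and of the weights\<close>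

definition growth :: "nat \<Rightarrow> real" where "growth n = (\<Prod>k<n. 1 + m / (\<tau> + 2 * m * real k))"

definition weight :: "nat \<Rightarrow> real" where "weight n = m / growth (Suc n)"

lemma growth_ge_1: "1 \<le> growth n"
  unfolding growth_def using m_pos tau_pos by (intro prod_ge_1) (auto intro!: divide_nonneg_nonneg)

definition growth_const :: real where
  "growth_const = Gamma (\<tau> / (2 * m)) / Gamma (\<tau> / (2 * m) + 1/2)"

lemma growth_const_pos: "0 < growth_const"
  unfolding growth_const_def using m_pos tau_pos
  by (intro divide_pos_pos Gamma_real_pos) (auto intro!: add_pos_pos)

text \<open>The product defining \<^term>\<open>growth\<close> is a quotient of two Pochhammer symbols.\<close>

lemma growth_asymp: "(\<lambda>n. growth n / sqrt (real n)) \<longlonglongrightarrow> growth_const"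
proof -
  define t where "t = \<tau> / (2 * m)"
  have t: "0 < t" using m_pos tau_pos by (simp add: t_def)
  have g: "growth n = pochhammer (t + 1/2) n / pochhammer t n" for n
  proof -
    have "1 + m / (\<tau> + 2 * m * real k) = (t + 1/2 + real k) / (t + real k)" for k
    proof -
      have "\<tau> + 2 * m * real k = 2 * m * (t + real k)" using m_pos by (simp add: t_def field_simps)
      moreover have "0 < t + real k" using t by simp
      ultimately show ?thesis using m_pos by (simp add: divide_simps)
    qed
    thus ?thesis by (simp add: growth_def pochhammer_prod prod_dividef atLeast0LessThan)
  qed
  have "(\<lambda>n. Gamma_series' t n / Gamma_series' (t + 1/2) n) \<longlonglongrightarrow> Gamma t / Gamma (t + 1/2)"
  proof (intro tendsto_divide Gamma_series'_LIMSEQ)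
    have "0 < Gamma (t + 1/2)" using t by (intro Gamma_real_pos) simp
    thus "Gamma (t + 1/2) \<noteq> 0" by simp
  qed
  moreover have "\<forall>\<^sub>F n in sequentially. Gamma_series' t n / Gamma_series' (t + 1/2) n = growth n / sqrt (real n)"
    using eventually_gt_at_top[of 0]
  proof eventually_elim
    case (elim n)
    have p: "pochhammer t n > 0" "pochhammer (t + 1/2) n > 0" using t by (auto intro!: pochhammer_pos)
    have "exp ((t + 1/2) * ln (real n)) = exp (t * ln (real n)) * exp (ln (real n) / 2)"
      by (simp add: exp_add[symmetric] algebra_simps)
    also have "exp (ln (real n) / 2) = sqrt (real n)"
      using elim by (simp add: ln_sqrt[symmetric])
    finally have e: "exp ((t + 1/2) * ln (real n)) = exp (t * ln (real n)) * sqrt (real n)" .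
    have "f * E / P / (f * (E * s) / R) = R / P / s" if "f \<noteq> 0" "E \<noteq> 0" "s \<noteq> 0" "P \<noteq> 0" "R \<noteq> 0" for f E P s R :: real
      using that by (simp add: divide_simps)
    thus ?case using e p elim by (simp add: Gamma_series'_def g)
  qed
  ultimately show ?thesis unfolding growth_const_def t_def by (rule Lim_transform_eventually)
qed

definition nu_rate :: real where "nu_rate = m\<^sup>2 / growth_const\<^sup>2"

lemma nu_rate_pos: "0 < nu_rate"
  using m_pos growth_const_pos by (simp add: nu_rate_def)

lemma weight_pos: "0 < weight n"
  unfolding weight_def using m_pos growth_ge_1[of "Suc n"] by simp

lemma weight_nonzero: "weight n \<noteq> 0"
  using weight_pos[of n] by simp

lemma weight_le: "\<bar>weight n\<bar> \<le> m"
  using weight_pos[of n] growth_ge_1[of "Suc n"] m_pos by (simp add: weight_def divide_le_eq mult_left_le)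

lemma weight_asymp: "(\<lambda>n. (weight n)\<^sup>2 * (real n + 1)) \<longlonglongrightarrow> nu_rate"
proof -
  have "(\<lambda>n. m\<^sup>2 / (growth (Suc n) / sqrt (real (Suc n)))\<^sup>2) \<longlonglongrightarrow> nu_rate"
    unfolding nu_rate_def using growth_const_pos
    by (intro tendsto_divide tendsto_const tendsto_power LIMSEQ_Suc[OF growth_asymp]) auto
  moreover have "m\<^sup>2 / (growth (Suc n) / sqrt (real (Suc n)))\<^sup>2 = (weight n)\<^sup>2 * (real n + 1)" for n
    by (simp add: weight_def power_divide add.commute)
  ultimately show ?thesis by simp
qed

text \<open>The squared weights are compared with ln(k+2) - ln(k+1), which is asymptotic to 1/(k+1)
  and telescopes to ln(n+1). The shift keeps these differences positive from k = 0 on.\<close>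

lemma sum_weight_asymp: "(\<lambda>n. (\<Sum>k<n. (weight k)\<^sup>2) / ln (real n + 1)) \<longlonglongrightarrow> nu_rate"
proof -
  define y where "y k = ln (real k + 2) - ln (real k + 1)" for k :: nat
  have y: "0 < y k" for k by (simp add: y_def)
  have sy: "(\<Sum>k<n. y k) = ln (real n + 1)" for n
    using sum_lessThan_telescope[of "\<lambda>k. ln (real k + 1)" n] by (simp add: y_def add.commute)
  have "(\<lambda>k. (real k + 1) * y k) \<longlonglongrightarrow> 1" unfolding y_def by real_asymp
  hence "(\<lambda>k. (weight k)\<^sup>2 * (real k + 1) / ((real k + 1) * y k)) \<longlonglongrightarrow> nu_rate / 1"
    by (intro tendsto_divide weight_asymp) auto
  moreover have "(weight k)\<^sup>2 * (real k + 1) / ((real k + 1) * y k) = (weight k)\<^sup>2 / y k" for k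
  proof -
    have "w * x / (x * z) = w / z" if "x \<noteq> 0" for w x z :: real using that by simp
    from this[of "real k + 1"] show ?thesis by simp
  qed
  ultimately have "(\<lambda>k. (weight k)\<^sup>2 / y k) \<longlonglongrightarrow> nu_rate" by simp
  moreover have "filterlim (\<lambda>n. \<Sum>k<n. y k) at_top sequentially"
    unfolding sy by real_asymp
  ultimately have "(\<lambda>n. (\<Sum>k<n. (weight k)\<^sup>2 / y k * y k) / (\<Sum>k<n. y k)) \<longlonglongrightarrow> nu_rate"
    using y by (intro weighted_average_tendsto) (auto simp: less_imp_le)
  moreover have "(weight k)\<^sup>2 / y k * y k = (weight k)\<^sup>2" for k using y[of k] by simp
  ultimately show ?thesis unfolding sy by simp
qed

sublocale weighted_draws M F red \<epsilon> weight m
proof unfold_locales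
  show "subalgebra M (F n)" for n by (rule subalgebra_F)
  show "red n \<in> borel_measurable (F n)" for n by (rule red_meas)
  show "\<epsilon> (Suc n) \<in> borel_measurable (F (Suc n))" for n by (rule adapted)
  show "\<omega> \<in> space M \<Longrightarrow> 0 \<le> red n \<omega> \<and> red n \<omega> \<le> 1" for n \<omega> by (rule red_range)
  show "\<omega> \<in> space M \<Longrightarrow> \<epsilon> (Suc n) \<omega> \<in> {0, 1}" for n \<omega> by (rule draw_range)
  show "AE \<omega> in M. real_cond_exp M (F n) (indicator {\<omega> \<in> space M. \<epsilon> (Suc n) \<omega> = 1}) \<omega> = red n \<omega>" for n
    unfolding red_def by (rule draw_prob)
  show "\<bar>weight k\<bar> \<le> m" for k by (rule weight_le)
  have "filterlim (\<lambda>n. (\<Sum>k<n. (weight k)\<^sup>2) / ln (real n + 1) * ln (real n + 1)) at_top sequentially"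
    by (rule filterlim_tendsto_pos_mult_at_top[OF sum_weight_asymp nu_rate_pos]) real_asymp
  moreover have "\<forall>\<^sub>F n in sequentially. (\<Sum>k<n. (weight k)\<^sup>2) / ln (real n + 1) * ln (real n + 1) = (\<Sum>k<n. (weight k)\<^sup>2)"
    using eventually_gt_at_top[of 0] by eventually_elim simp
  ultimately show "filterlim (\<lambda>n. \<Sum>k<n. (weight k)\<^sup>2) at_top sequentially"
    by (rule filterlim_mono_eventually[OF _ order_refl order_refl])
qed

lemma nu_asymp: "(\<lambda>n. \<nu> n / ln (real n)) \<longlonglongrightarrow> nu_rate"
proof -
  have "(\<lambda>n. \<nu> n / ln (real n + 1) * (ln (real n + 1) / ln (real n))) \<longlonglongrightarrow> nu_rate * 1"
    unfolding \<nu>_def by (intro tendsto_mult sum_weight_asymp) real_asymp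
  moreover have "\<forall>\<^sub>F n in sequentially. \<nu> n / ln (real n + 1) * (ln (real n + 1) / ln (real n)) = \<nu> n / ln (real n)"
    using eventually_gt_at_top[of 0] by eventually_elim simp
  ultimately show ?thesis using Lim_transform_eventually by fastforce
qed

lemma ln_at_top_nat: "filterlim (\<lambda>n. ln (real n)) at_top sequentially"
  and lnln_at_top_nat: "filterlim (\<lambda>n. ln (ln (real n))) at_top sequentially"
  by real_asymp+

lemma ln_nu_asymp: "(\<lambda>n. ln (\<nu> n) / ln (ln (real n))) \<longlonglongrightarrow> 1"
  by (rule ln_ratio_tendsto[OF nu_asymp nu_rate_pos ln_at_top_nat])

lemma lnln_nu_asymp: "(\<lambda>n. ln (ln (\<nu> n)) / ln (ln (ln (real n)))) \<longlonglongrightarrow> 1"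
  by (rule ln_ratio_tendsto[OF ln_nu_asymp _ lnln_at_top_nat]) simp

text \<open>The equilibrium proportion of red is c/m, and c/m times the total at time n is 2cn +
  \<open>shift\<close>. Thus \<open>Z\<close> measures the distance from equilibrium; it differs by
  a constant from the deviation from the first coordinate of n v1.\<close>

definition shift :: real where "shift = real c * \<tau> / m"

definition Z :: "nat \<Rightarrow> 'w \<Rightarrow> real" where "Z n \<omega> = U n \<omega> $ 1 - 2 * real c * real n - shift"

text \<open>At the equilibrium proportion the mean gain of red balls is c + m (c/m) = 2c, which the
  centring removes. A deviation \<open>Z\<close> changes the proportion by \<open>Z\<close> divided
  by the total, and so feeds back with the factor m over the total; \<open>growth\<close>
  accumulates these factors.\<close>

lemma Z_eq_mart:
  assumes w: "\<omega> \<in> space M"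
  shows "Z n \<omega> = growth n * ((real \<alpha> - shift) + mart n \<omega>)"
proof (induction n)
  case 0
  show ?case by (simp add: Z_def growth_def mart_def U_components[OF w])
next
  case (Suc n)
  define \<tau>n where "\<tau>n = \<tau> + 2 * m * real n"
  have tn: "0 < \<tau>n" using tau_pos m_pos by (simp add: \<tau>n_def add_pos_nonneg)
  have "U n \<omega> $ 1 = Z n \<omega> + 2 * real c * real n + shift" by (simp add: Z_def)
  moreover have "2 * real c * real n + shift = real c / m * \<tau>n"
    using m_pos by (simp add: shift_def \<tau>n_def field_simps)
  ultimately have "U n \<omega> $ 1 = Z n \<omega> + real c / m * \<tau>n" by simp
  moreover have "red n \<omega> = U n \<omega> $ 1 / \<tau>n" by (simp add: red_def U_total[OF w] \<tau>n_def)
  ultimately have "red n \<omega> = (Z n \<omega> + real c / m * \<tau>n) / \<tau>n" by (simp only:)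
  hence "m * red n \<omega> = m / \<tau>n * Z n \<omega> + real c"
    using tn m_pos by (simp add: add_divide_distrib distrib_left)
  moreover have "Z (Suc n) \<omega> = Z n \<omega> - real c + m * \<xi> n \<omega> + m * red n \<omega>"
    by (simp add: Z_def U_components[OF w] \<xi>_def algebra_simps)
  ultimately have "Z (Suc n) \<omega> = (1 + m / \<tau>n) * Z n \<omega> + m * \<xi> n \<omega>"
    by (simp add: algebra_simps)
  also have "\<dots> = growth (Suc n) * ((real \<alpha> - shift) + mart n \<omega>) + growth (Suc n) * (weight n * \<xi> n \<omega>)"
  proof -
    have "growth (Suc n) = (1 + m / \<tau>n) * growth n" by (simp add: growth_def \<tau>n_def)
    moreover have "growth (Suc n) * weight n = m" using growth_ge_1[of "Suc n"] by (simp add: weight_def)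
    ultimately show ?thesis by (simp only: Suc mult.assoc[symmetric])
  qed
  also have "\<dots> = growth (Suc n) * ((real \<alpha> - shift) + mart (Suc n) \<omega>)"
    by (simp add: mart_Suc algebra_simps)
  finally show ?case .
qed

lemma growth_sq_asymp: "(\<lambda>n. (growth n)\<^sup>2 / real n) \<longlonglongrightarrow> growth_const\<^sup>2"
proof -
  have "(\<lambda>n. (growth n / sqrt (real n))\<^sup>2) \<longlonglongrightarrow> growth_const\<^sup>2"
    by (intro tendsto_power growth_asymp)
  thus ?thesis by (simp add: power_divide)
qed

text \<open>The law of large numbers, from crude orders: the martingale is at most of order
  \<open>\<nu> n\<close>, hence of ln n, and \<open>growth n\<close> is of order sqrt n.\<close>

lemma Z_over_n: "AE \<omega> in M. (\<lambda>n. Z n \<omega> / real n) \<longlonglongrightarrow> 0"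
  using mart_bigo AE_space
proof eventually_elim
  case (elim \<omega>)
  have "(\<lambda>n. (\<nu> n / ln (real n))\<^sup>2 * ((ln (real n))\<^sup>2 / real n)) \<longlonglongrightarrow> nu_rate\<^sup>2 * 0"
    by (intro tendsto_mult tendsto_power nu_asymp) real_asymp
  moreover have "\<forall>\<^sub>F n in sequentially. (\<nu> n / ln (real n))\<^sup>2 * ((ln (real n))\<^sup>2 / real n) = (\<nu> n)\<^sup>2 / real n"
    using eventually_gt_at_top[of 1] by eventually_elim (simp add: power_divide)
  ultimately have l1: "(\<lambda>n. (\<nu> n)\<^sup>2 / real n) \<longlonglongrightarrow> 0"
    using Lim_transform_eventually by fastforce
  have "(\<lambda>n. 4 * sqrt (1/2 * ((\<nu> n)\<^sup>2 / real n))) \<longlonglongrightarrow> 4 * sqrt (1/2 * 0)"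
    by (intro tendsto_intros l1)
  hence l2: "(\<lambda>n. 4 * sqrt (1/2 * ((\<nu> n)\<^sup>2 / real n))) \<longlonglongrightarrow> 0" by simp
  have "(\<lambda>n. mart n \<omega> / sqrt (real n)) \<longlonglongrightarrow> 0"
  proof (rule Lim_null_comparison[OF _ l2])
    have "\<forall>\<^sub>F x in at_top. x * ln (ln x) \<le> (x::real)\<^sup>2" by real_asymp
    from eventually_compose_filterlim[OF this nu_lim]
    have "\<forall>\<^sub>F n in sequentially. lil_scale n \<le> (\<nu> n)\<^sup>2" by (simp add: lil_scale_def)
    thus "\<forall>\<^sub>F n in sequentially. norm (mart n \<omega> / sqrt (real n)) \<le> 4 * sqrt (1/2 * ((\<nu> n)\<^sup>2 / real n))"
      using elim(1) eventually_gt_at_top[of 0]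
    proof eventually_elim
      case (elim n)
      have "\<bar>mart n \<omega>\<bar> \<le> 4 * sqrt (1/2 * (\<nu> n)\<^sup>2)"
        using elim by (intro order_trans[OF elim(2)] mult_left_mono real_sqrt_le_mono) auto
      hence "\<bar>mart n \<omega>\<bar> / sqrt (real n) \<le> 4 * sqrt (1/2 * (\<nu> n)\<^sup>2) / sqrt (real n)"
        by (intro divide_right_mono) auto
      also have "\<dots> = 4 * sqrt (1/2 * ((\<nu> n)\<^sup>2 / real n))"
        by (simp only: times_divide_eq_right[symmetric] real_sqrt_divide[symmetric])
      finally show ?case by (simp add: abs_divide)
    qed
  qed
  moreover have "(\<lambda>n. (real \<alpha> - shift) / sqrt (real n)) \<longlonglongrightarrow> 0"
    by (intro tendsto_divide_0[OF tendsto_const] filterlim_at_top_imp_at_infinity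
        filterlim_compose[OF sqrt_at_top] filterlim_real_sequentially)
  ultimately have "(\<lambda>n. (growth n / sqrt (real n)) * ((real \<alpha> - shift) / sqrt (real n) + mart n \<omega> / sqrt (real n)))
     \<longlonglongrightarrow> growth_const * (0 + 0)"
    by (intro tendsto_mult tendsto_add growth_asymp)
  moreover have "(growth n / sqrt (real n)) * ((real \<alpha> - shift) / sqrt (real n) + mart n \<omega> / sqrt (real n)) = Z n \<omega> / real n" for n
  proof -
    have "(g / s) * (x / s + y / s) = g * (x + y) / (s * s)" for g s x y :: real
      by (simp add: add_divide_distrib[symmetric])
    thus ?thesis unfolding Z_eq_mart[OF elim(2)] by simp
  qed
  ultimately show ?case by simp
qed

text \<open>The variance p(1 - p) of a draw at the equilibrium proportion p = c/m.\<close>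

definition q_lim :: real where "q_lim = real b * real c / m\<^sup>2"

lemma q_lim_pos: "0 < q_lim"
  using b_pos c_pos m_pos by (simp add: q_lim_def)

lemma q_tendsto: "AE \<omega> in M. (\<lambda>n. q n \<omega>) \<longlonglongrightarrow> q_lim"
  using Z_over_n AE_space
proof eventually_elim
  case (elim \<omega>)
  have rn: "(\<lambda>n. real n / (\<tau> + 2 * m * real n)) \<longlonglongrightarrow> 1 / (2 * m)"
    using m_pos tau_pos by real_asymp (simp add: divide_simps)
  have "(\<lambda>n. real c / m + (Z n \<omega> / real n) * (real n / (\<tau> + 2 * m * real n))) \<longlonglongrightarrow> real c / m + 0 * (1 / (2 * m))"
    by (intro tendsto_add tendsto_mult tendsto_const elim(1) rn)
  moreover have "\<forall>\<^sub>F n in sequentially. real c / m + (Z n \<omega> / real n) * (real n / (\<tau> + 2 * m * real n)) = red n \<omega>"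
    using eventually_gt_at_top[of 0]
  proof eventually_elim
    case (elim n)
    define \<tau>n where "\<tau>n = \<tau> + 2 * m * real n"
    have tn: "0 < \<tau>n" using tau_pos m_pos by (simp add: \<tau>n_def add_pos_nonneg)
    have "U n \<omega> $ 1 = Z n \<omega> + (2 * real c * real n + shift)" by (simp add: Z_def)
    moreover have "2 * real c * real n + shift = real c / m * \<tau>n"
      using m_pos by (simp add: shift_def \<tau>n_def field_simps)
    ultimately have "red n \<omega> = (Z n \<omega> + real c / m * \<tau>n) / \<tau>n"
      using U_total[OF \<open>\<omega> \<in> space M\<close>, of n] by (simp add: red_def \<tau>n_def)
    also have "\<dots> = real c / m + Z n \<omega> / \<tau>n" using tn by (simp add: add_divide_distrib)
    finally show ?case using elim by (simp add: \<tau>n_def)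
  qed
  ultimately have r: "(\<lambda>n. red n \<omega>) \<longlonglongrightarrow> real c / m" using Lim_transform_eventually by fastforce
  have "(\<lambda>n. red n \<omega> * (1 - red n \<omega>)) \<longlonglongrightarrow> real c / m * (1 - real c / m)"
    by (intro tendsto_intros r)
  moreover have "real c / m * (1 - real c / m) = q_lim"
  proof -
    have "1 - real c / m = real b / m" using m_pos by (simp add: m_def field_simps)
    thus ?thesis by (simp add: q_lim_def power2_eq_square)
  qed
  ultimately show ?case by (simp add: q_def[abs_def])
qed

lemma rates_product: "growth_const\<^sup>2 * nu_rate * q_lim = real b * real c"
  using growth_const_pos m_pos by (simp add: nu_rate_def q_lim_def)

lemma Z_lil: "AE \<omega> in M.
  limsup (\<lambda>n. ereal ((Z n \<omega>)\<^sup>2 / (2 * (real n * ln (real n) * ln (ln (ln (real n))))))) = ereal (real b * real c)"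
  using law_of_iterated_logarithm[OF q_lim_pos, of "real \<alpha> - shift"] q_tendsto AE_space
proof eventually_elim
  case (elim \<omega>)
  \<comment> \<open>The factor that converts the martingale scale into n ln n ln ln ln n. It has a
    positive finite limit and so can be taken out of the limsup.\<close>
  define v where "v n = (growth n)\<^sup>2 / real n * (\<nu> n / ln (real n) * (ln (ln (\<nu> n)) / ln (ln (ln (real n)))))" for n
  have v: "v \<longlonglongrightarrow> growth_const\<^sup>2 * (nu_rate * 1)"
    unfolding v_def[abs_def] by (intro tendsto_mult growth_sq_asymp nu_asymp lnln_nu_asymp)
  define L where "L n = ((real \<alpha> - shift) + mart n \<omega>)\<^sup>2 / (2 * lil_scale n)" for n
  have lim: "limsup (\<lambda>n. ereal (L n)) = ereal q_lim" using elim unfolding L_def by blast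
  have "limsup (\<lambda>n. ereal (v n) * ereal (L n)) = ereal (growth_const\<^sup>2 * (nu_rate * 1)) * limsup (\<lambda>n. ereal (L n))"
    using growth_const_pos nu_rate_pos by (intro ereal_limsup_lim_mult tendsto_ereal v) auto
  also have "\<dots> = ereal (real b * real c)" unfolding lim using rates_product by simp
  finally have 1: "limsup (\<lambda>n. ereal (v n) * ereal (L n)) = ereal (real b * real c)" .
  have "\<forall>\<^sub>F n in sequentially. 0 < lil_scale n" using lil_scale_at_top by (simp add: filterlim_at_top_dense)
  hence "\<forall>\<^sub>F n in sequentially. ereal (v n) * ereal (L n) =
      ereal ((Z n \<omega>)\<^sup>2 / (2 * (real n * ln (real n) * ln (ln (ln (real n))))))"
  proof eventually_elim
    case (elim n)
    have "g / x * (nn / l * (ll / lll)) * (mm / (2 * (nn * ll))) = g * mm / (2 * (x * l * lll))"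
      if "nn \<noteq> 0" "ll \<noteq> 0" for g x nn l ll lll mm :: real using that by simp
    moreover have "\<nu> n \<noteq> 0" "ln (ln (\<nu> n)) \<noteq> 0" using elim unfolding lil_scale_def by (metis less_irrefl mult_zero_left mult_zero_right)+
    ultimately show ?case
      unfolding Z_eq_mart[OF \<open>\<omega> \<in> space M\<close>] v_def L_def lil_scale_def power_mult_distrib by simp
  qed
  from Limsup_eq[OF this] show ?case using 1 by simp
qed

lemma Z_qsl: "AE \<omega> in M.
  (\<lambda>n. (\<Sum>k=2..n. (Z k \<omega>)\<^sup>2 / (real k * ln (real k))\<^sup>2) / ln (ln (real n))) \<longlonglongrightarrow> real b * real c"
  using quadratic_strong_law[OF weight_nonzero, of q_lim "real \<alpha> - shift"] q_tendsto AE_space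
proof eventually_elim
  case (elim \<omega>)
  define y where "y k = ((real \<alpha> - shift) + mart k \<omega>)\<^sup>2 * (weight k)\<^sup>2 / (\<nu> k * \<nu> (Suc k))" for k
  have ylim: "(\<lambda>n. (\<Sum>k<n. y k) / ln (\<nu> n)) \<longlonglongrightarrow> q_lim"
    using elim(1,2) unfolding y_def by blast
  \<comment> \<open>The quotient of the wanted summand by \<open>y k\<close>, arranged so that every
    factor has a known limit; the bracket tending to 1 cancels the logarithm and the linear factor
    introduced by index k + 1.\<close>
  define r where "r k = (growth k)\<^sup>2 / real k * (\<nu> k / ln (real k)) * (\<nu> (Suc k) / ln (real (Suc k)))
     * ((ln (real (Suc k)) / ln (real k)) * ((real k + 1) / real k)) / ((weight k)\<^sup>2 * (real k + 1))" for k
  have r: "r \<longlonglongrightarrow> growth_const\<^sup>2 * nu_rate * nu_rate * 1 / nu_rate"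
    unfolding r_def[abs_def] using nu_rate_pos
  proof (intro tendsto_divide tendsto_mult growth_sq_asymp nu_asymp weight_asymp LIMSEQ_Suc[OF nu_asymp])
    show "(\<lambda>k. (ln (real (Suc k)) / ln (real k)) * ((real k + 1) / real k)) \<longlonglongrightarrow> 1" by real_asymp
  qed auto
  have nu_nonneg: "0 \<le> \<nu> k" for k
    unfolding \<nu>_def by (rule sum_nonneg) simp
  have nu_pos: "0 < \<nu> (Suc k)" for k
    using nu_nonneg[of k] weight_pos[of k] by (simp add: nu_Suc add_nonneg_pos)
  have y0: "0 \<le> y k" for k
    unfolding y_def by (intro divide_nonneg_nonneg mult_nonneg_nonneg nu_nonneg zero_le_power2)
  have ln_nu: "filterlim (\<lambda>n. ln (\<nu> n)) at_top sequentially" by (rule filterlim_compose[OF ln_at_top nu_lim])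
  have ev_ln: "\<forall>\<^sub>F n in sequentially. 0 < ln (\<nu> n)" using ln_nu by (simp add: filterlim_at_top_dense)
  have y_top: "filterlim (\<lambda>n. \<Sum>k<n. y k) at_top sequentially"
  proof -
    have "filterlim (\<lambda>n. (\<Sum>k<n. y k) / ln (\<nu> n) * ln (\<nu> n)) at_top sequentially"
      by (rule filterlim_tendsto_pos_mult_at_top[OF ylim q_lim_pos ln_nu])
    moreover have "\<forall>\<^sub>F n in sequentially. (\<Sum>k<n. y k) / ln (\<nu> n) * ln (\<nu> n) = (\<Sum>k<n. y k)"
      using ev_ln by eventually_elim simp
    ultimately show ?thesis by (rule filterlim_mono_eventually[OF _ order_refl order_refl])
  qed
  have avg: "(\<lambda>n. (\<Sum>k<n. r k * y k) / (\<Sum>k<n. y k)) \<longlonglongrightarrow> growth_const\<^sup>2 * nu_rate * nu_rate * 1 / nu_rate"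
    by (rule weighted_average_tendsto[OF r _ y_top]) (simp add: y0)
  define S where "S n = (\<Sum>k<n. (Z k \<omega>)\<^sup>2 / (real k * ln (real k))\<^sup>2)" for n
  \<comment> \<open>For k = 0 and k = 1 both sides vanish, because division by zero yields zero; the
    sum may therefore start at 0 although the wanted one starts at 2.\<close>
  have ry: "r k * y k = (Z k \<omega>)\<^sup>2 / (real k * ln (real k))\<^sup>2" for k
  proof (cases "k < 2")
    case True
    hence "k = 0 \<or> k = 1" by auto
    thus ?thesis by (auto simp: r_def)
  next
    case False
    have nz: "\<nu> k \<noteq> 0" "\<nu> (Suc k) \<noteq> 0" "weight k \<noteq> 0" "ln (real (Suc k)) \<noteq> 0" "real k + 1 \<noteq> 0"
    proof -
      show "\<nu> k \<noteq> 0" using nu_pos[of "k - 1"] False by simp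
      show "\<nu> (Suc k) \<noteq> 0" using nu_pos[of k] by simp
    qed (use False weight_pos[of k] in auto)
    have "g / x * (n1 / l) * (n2 / l') * ((l' / l) * (x' / x)) / (w * x') * (mm * w / (n1 * n2)) = g * mm / (x * l)\<^sup>2"
      if "n1 \<noteq> 0" "n2 \<noteq> 0" "w \<noteq> 0" "l' \<noteq> 0" "x' \<noteq> 0" for g x n1 l n2 l' x' w mm :: real
      using that by (simp add: power2_eq_square)
    from this[OF nz(1,2) _ nz(4,5), of "(weight k)\<^sup>2"] show ?thesis
      unfolding r_def y_def Z_eq_mart[OF elim(3)] power_mult_distrib using nz(3) by simp
  qed
  have "(\<lambda>n. (\<Sum>k<n. r k * y k) / (\<Sum>k<n. y k) * ((\<Sum>k<n. y k) / ln (\<nu> n)) * (ln (\<nu> n) / ln (ln (real n))))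
     \<longlonglongrightarrow> (growth_const\<^sup>2 * nu_rate * nu_rate * 1 / nu_rate) * q_lim * 1"
    by (intro tendsto_mult avg ylim ln_nu_asymp)
  moreover have "(growth_const\<^sup>2 * nu_rate * nu_rate * 1 / nu_rate) * q_lim * 1 = real b * real c"
    using rates_product nu_rate_pos by simp
  moreover have "\<forall>\<^sub>F n in sequentially. (\<Sum>k<n. r k * y k) / (\<Sum>k<n. y k) * ((\<Sum>k<n. y k) / ln (\<nu> n)) * (ln (\<nu> n) / ln (ln (real n)))
      = S n / ln (ln (real n))"
  proof -
    have "\<forall>\<^sub>F n in sequentially. 0 < (\<Sum>k<n. y k)" using y_top by (simp add: filterlim_at_top_dense)
    thus ?thesis using ev_ln
    proof eventually_elim
      case (elim n)
      have "x / s * (s / l) * (l / u) = x / u" if "s \<noteq> 0" "l \<noteq> 0" for x s l u :: real using that by simp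
      from this[of "\<Sum>k<n. y k" "ln (\<nu> n)"] elim show ?case by (simp add: S_def ry)
    qed
  qed
  ultimately have "(\<lambda>n. S n / ln (ln (real n))) \<longlonglongrightarrow> real b * real c"
    using Lim_transform_eventually by fastforce
  \<comment> \<open>The sum over k < n is turned into the sum up to n; the double logarithm does not
    notice the shift.\<close>
  from LIMSEQ_Suc[OF this]
  have "(\<lambda>n. S (Suc n) / ln (ln (real (Suc n))) * (ln (ln (real (Suc n))) / ln (ln (real n)))) \<longlonglongrightarrow> real b * real c * 1"
    by (rule tendsto_mult) real_asymp
  moreover have "\<forall>\<^sub>F n in sequentially. S (Suc n) / ln (ln (real (Suc n))) * (ln (ln (real (Suc n))) / ln (ln (real n)))
     = (\<Sum>k=2..n. (Z k \<omega>)\<^sup>2 / (real k * ln (real k))\<^sup>2) / ln (ln (real n))"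
  proof -
    have "filterlim (\<lambda>n. ln (ln (real (Suc n)))) at_top sequentially" by real_asymp
    hence "\<forall>\<^sub>F n in sequentially. 0 < ln (ln (real (Suc n)))" by (simp add: filterlim_at_top_dense)
    thus ?thesis
    proof eventually_elim
      case (elim n)
      have "S (Suc n) = (\<Sum>k=2..n. (Z k \<omega>)\<^sup>2 / (real k * ln (real k))\<^sup>2)"
        unfolding S_def
      proof (rule sum.mono_neutral_right)
        show "\<forall>k\<in>{..<Suc n} - {2..n}. (Z k \<omega>)\<^sup>2 / (real k * ln (real k))\<^sup>2 = 0"
        proof
          fix k assume "k \<in> {..<Suc n} - {2..n}"
          hence "k = 0 \<or> k = 1" by auto
          thus "(Z k \<omega>)\<^sup>2 / (real k * ln (real k))\<^sup>2 = 0" by auto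
        qed
      qed auto
      thus ?case using elim by simp
    qed
  qed
  ultimately show ?case using Lim_transform_eventually by fastforce
qed

end

lemma outer_square_component: "outer_square x $ i $ j = x $ i * x $ j"
  by (simp add: outer_square_def matrix_matrix_mult_def columnvector_def rowvector_def)

section \<open>Replacing the centring at equilibrium by the centring at n v1\<close>

context critical_urn
begin

text \<open>The weights are summable, by comparison with 1/k^2, while ln ln n diverges. This makes
  constant changes of the centring invisible.\<close>

lemma log_weights_negligible:
  "(\<lambda>n. (\<Sum>k=2..n. 1 / (real k * ln (real k))\<^sup>2) / ln (ln (real n))) \<longlonglongrightarrow> 0"
proof -
  let ?f = "\<lambda>k. 1 / (real k * ln (real k))\<^sup>2"
  have sm: "summable ?f"
  proof (rule summable_comparison_test_ev)
    show "summable (\<lambda>k. inverse (real k ^ 2))" by (rule inverse_power_summable) simp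
    have "\<forall>\<^sub>F k in sequentially. 1 \<le> ln (real k)" using ln_at_top_nat by (simp add: filterlim_at_top)
    thus "\<forall>\<^sub>F k in sequentially. norm (?f k) \<le> inverse (real k ^ 2)"
      using eventually_gt_at_top[of 0]
    proof eventually_elim
      case (elim k)
      have "real k * 1 \<le> real k * ln (real k)" using elim by (intro mult_left_mono) auto
      hence "(real k)\<^sup>2 \<le> (real k * ln (real k))\<^sup>2" by (intro power_mono) auto
      hence "inverse ((real k * ln (real k))\<^sup>2) \<le> inverse ((real k)\<^sup>2)"
        using elim by (intro le_imp_inverse_le) auto
      moreover have "norm (?f k) = inverse ((real k * ln (real k))\<^sup>2)" by (simp add: inverse_eq_divide)
      ultimately show ?case by (simp only:)
    qed
  qed
  have le: "(\<Sum>k=2..n. ?f k) \<le> suminf ?f" for n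
    by (rule sum_le_suminf[OF sm]) auto
  have ev: "\<forall>\<^sub>F n in sequentially. 0 < ln (ln (real n))"
    using lnln_at_top_nat by (simp add: filterlim_at_top_dense)
  have "(\<lambda>n. suminf ?f / ln (ln (real n))) \<longlonglongrightarrow> 0"
    by (intro tendsto_divide_0[OF tendsto_const] filterlim_at_top_imp_at_infinity lnln_at_top_nat)
  thus ?thesis
  proof (rule Lim_null_comparison[rotated])
    show "\<forall>\<^sub>F n in sequentially. norm ((\<Sum>k=2..n. ?f k) / ln (ln (real n))) \<le> suminf ?f / ln (ln (real n))"
      using ev
    proof eventually_elim
      case (elim n)
      have "0 \<le> (\<Sum>k=2..n. ?f k)" by (intro sum_nonneg) auto
      thus ?case using elim le[of n] by (simp add: divide_right_mono)
    qed
  qed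
qed

text \<open>After expansion the constant terms are negligible, and the sum linear in
  \<open>Z\<close> is so by Cauchy-Schwarz between the main sum and the constant one. Two shifts are
  needed because off-diagonal entries multiply different coordinates.\<close>

lemma Z_qsl_shifted: "AE \<omega> in M. \<forall>u v.
  (\<lambda>n. (\<Sum>k=2..n. (Z k \<omega> + u) * (Z k \<omega> + v) / (real k * ln (real k))\<^sup>2) / ln (ln (real n))) \<longlonglongrightarrow> real b * real c"
  using Z_qsl
proof eventually_elim
  case (elim \<omega>)
  let ?w = "\<lambda>k. 1 / (real k * ln (real k))"
  define L where "L n = ln (ln (real n))" for n :: nat
  define A where "A n = (\<Sum>k=2..n. (Z k \<omega>)\<^sup>2 / (real k * ln (real k))\<^sup>2)" for n
  define W where "W n = (\<Sum>k=2..n. 1 / (real k * ln (real k))\<^sup>2)" for n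
  define C where "C n = (\<Sum>k=2..n. Z k \<omega> / (real k * ln (real k))\<^sup>2)" for n
  have A: "(\<lambda>n. A n / L n) \<longlonglongrightarrow> real b * real c" using elim by (simp add: A_def L_def)
  have W: "(\<lambda>n. W n / L n) \<longlonglongrightarrow> 0" using log_weights_negligible by (simp add: W_def L_def)
  have ev: "\<forall>\<^sub>F n in sequentially. 0 < L n"
    using lnln_at_top_nat by (simp add: L_def filterlim_at_top_dense)
  have "(\<lambda>n. sqrt ((A n / L n) * (W n / L n))) \<longlonglongrightarrow> sqrt ((real b * real c) * 0)"
    by (intro tendsto_real_sqrt tendsto_mult A W)
  hence "(\<lambda>n. sqrt ((A n / L n) * (W n / L n))) \<longlonglongrightarrow> 0" by simp
  hence C: "(\<lambda>n. C n / L n) \<longlonglongrightarrow> 0"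
  proof (rule Lim_null_comparison[rotated])
    show "\<forall>\<^sub>F n in sequentially. norm (C n / L n) \<le> sqrt ((A n / L n) * (W n / L n))"
      using ev
    proof eventually_elim
      case (elim n)
      have "C n = (\<Sum>k=2..n. (Z k \<omega> * ?w k) * ?w k)" by (simp add: C_def power2_eq_square)
      hence "(C n)\<^sup>2 \<le> (\<Sum>k=2..n. (Z k \<omega> * ?w k)\<^sup>2) * (\<Sum>k=2..n. (?w k)\<^sup>2)"
        by (simp only: Cauchy_Schwarz_ineq_sum)
      also have "\<dots> = A n * W n" by (simp add: A_def W_def power_divide)
      finally have "(C n / L n)\<^sup>2 \<le> (A n / L n) * (W n / L n)"
        using elim by (simp add: power_divide power2_eq_square[of "L n"] divide_right_mono)
      hence "sqrt ((C n / L n)\<^sup>2) \<le> sqrt ((A n / L n) * (W n / L n))" by (rule real_sqrt_le_mono)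
      thus ?case by simp
    qed
  qed
  show ?case
  proof (intro allI)
    fix u v
    have "(\<lambda>n. A n / L n + (u + v) * (C n / L n) + u * v * (W n / L n)) \<longlonglongrightarrow> real b * real c + (u + v) * 0 + u * v * 0"
      by (intro tendsto_add tendsto_mult tendsto_const A C W)
    moreover have "A n / L n + (u + v) * (C n / L n) + u * v * (W n / L n) =
       (\<Sum>k=2..n. (Z k \<omega> + u) * (Z k \<omega> + v) / (real k * ln (real k))\<^sup>2) / L n" for n
    proof -
      have "A n + (u + v) * C n + u * v * W n = (\<Sum>k=2..n. (Z k \<omega> + u) * (Z k \<omega> + v) / (real k * ln (real k))\<^sup>2)"
        unfolding A_def C_def W_def sum_distrib_left sum.distrib[symmetric]
      proof (intro sum.cong refl)
        fix k
        have "x\<^sup>2 / y + (u + v) * (x / y) + u * v * (1 / y) = (x + u) * (x + v) / y" for x y :: real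
          by (simp add: add_divide_distrib[symmetric] power2_eq_square algebra_simps)
        thus "(Z k \<omega>)\<^sup>2 / (real k * ln (real k))\<^sup>2 + (u + v) * (Z k \<omega> / (real k * ln (real k))\<^sup>2)
          + u * v * (1 / (real k * ln (real k))\<^sup>2) = (Z k \<omega> + u) * (Z k \<omega> + v) / (real k * ln (real k))\<^sup>2" .
      qed
      thus ?thesis by (simp add: add_divide_distrib[symmetric])
    qed
    ultimately show "(\<lambda>n. (\<Sum>k=2..n. (Z k \<omega> + u) * (Z k \<omega> + v) / (real k * ln (real k))\<^sup>2) / ln (ln (real n))) \<longlonglongrightarrow> real b * real c"
      by (simp add: L_def)
  qed
qed

text \<open>Both coordinates equal \<open>Z\<close> up to sign and a constant, hence the doubled
  limit. For the cross term \<open>Z\<close> = o(n) is enough, as n itself is of smaller order than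
  n ln n ln ln ln n.\<close>

lemma Z_lil_shifted: "AE \<omega> in M. \<forall>u v.
  limsup (\<lambda>n. ereal (((Z n \<omega> + u)\<^sup>2 + (Z n \<omega> + v)\<^sup>2) / (2 * real n * ln (real n) * ln (ln (ln (real n)))))) = ereal (2 * real b * real c)"
  using Z_lil Z_over_n
proof eventually_elim
  case (elim \<omega>)
  define s where "s n = real n * ln (real n) * ln (ln (ln (real n)))" for n
  show ?case
  proof (intro allI)
    fix u v
    have "(\<lambda>n. real n / (2 * s n)) \<longlonglongrightarrow> 0" unfolding s_def by real_asymp
    moreover have "(\<lambda>n. 1 / (2 * s n)) \<longlonglongrightarrow> 0" unfolding s_def by real_asymp
    ultimately have "(\<lambda>n. 2 * (u + v) * (Z n \<omega> / real n * (real n / (2 * s n))) + (u\<^sup>2 + v\<^sup>2) * (1 / (2 * s n)))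
      \<longlonglongrightarrow> 2 * (u + v) * (0 * 0) + (u\<^sup>2 + v\<^sup>2) * 0"
      using elim(2) by (intro tendsto_add tendsto_mult tendsto_const)
    hence err: "(\<lambda>n. ereal (2 * (u + v) * (Z n \<omega> / real n * (real n / (2 * s n))) + (u\<^sup>2 + v\<^sup>2) * (1 / (2 * s n)))) \<longlonglongrightarrow> ereal 0"
      by (intro tendsto_ereal) simp
    have "limsup (\<lambda>n. ereal 2 * ereal ((Z n \<omega>)\<^sup>2 / (2 * s n))) = ereal 2 * limsup (\<lambda>n. ereal ((Z n \<omega>)\<^sup>2 / (2 * s n)))"
      by (rule ereal_limsup_lim_mult[OF tendsto_const]) auto
    also have "\<dots> = ereal (2 * real b * real c)" using elim(1) by (simp add: s_def)
    finally have two: "limsup (\<lambda>n. ereal 2 * ereal ((Z n \<omega>)\<^sup>2 / (2 * s n))) = ereal (2 * real b * real c)" .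
    have "limsup (\<lambda>n. ereal (2 * (u + v) * (Z n \<omega> / real n * (real n / (2 * s n))) + (u\<^sup>2 + v\<^sup>2) * (1 / (2 * s n)))
        + ereal 2 * ereal ((Z n \<omega>)\<^sup>2 / (2 * s n))) = ereal 0 + limsup (\<lambda>n. ereal 2 * ereal ((Z n \<omega>)\<^sup>2 / (2 * s n)))"
      by (rule ereal_limsup_lim_add[OF err]) simp
    also have "\<dots> = ereal (2 * real b * real c)" unfolding two by simp
    finally have lim: "limsup (\<lambda>n. ereal (2 * (u + v) * (Z n \<omega> / real n * (real n / (2 * s n))) + (u\<^sup>2 + v\<^sup>2) * (1 / (2 * s n)))
        + ereal 2 * ereal ((Z n \<omega>)\<^sup>2 / (2 * s n))) = ereal (2 * real b * real c)" .
    have eq: "\<forall>\<^sub>F n in sequentially. ereal (2 * (u + v) * (Z n \<omega> / real n * (real n / (2 * s n))) + (u\<^sup>2 + v\<^sup>2) * (1 / (2 * s n)))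
        + ereal 2 * ereal ((Z n \<omega>)\<^sup>2 / (2 * s n)) = ereal (((Z n \<omega> + u)\<^sup>2 + (Z n \<omega> + v)\<^sup>2) / (2 * s n))"
      using eventually_gt_at_top[of 0]
    proof eventually_elim
      case (elim n)
      have "2 * (u + v) * (z / x * (x / y)) + (u\<^sup>2 + v\<^sup>2) * (1 / y) + 2 * (z\<^sup>2 / y) = ((z + u)\<^sup>2 + (z + v)\<^sup>2) / y"
        if "x \<noteq> 0" for x y z :: real
        using that by (simp add: add_divide_distrib[symmetric] power2_eq_square algebra_simps)
      from this[of "real n" "Z n \<omega>" "2 * s n"] elim show ?case
        unfolding plus_ereal.simps times_ereal.simps by simp
    qed
    have "limsup (\<lambda>n. ereal (((Z n \<omega> + u)\<^sup>2 + (Z n \<omega> + v)\<^sup>2) / (2 * s n))) = ereal (2 * real b * real c)"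
      using Limsup_eq[OF eq] lim by (simp only:)
    thus "limsup (\<lambda>n. ereal (((Z n \<omega> + u)\<^sup>2 + (Z n \<omega> + v)\<^sup>2) / (2 * real n * ln (real n) * ln (ln (ln (real n)))))) = ereal (2 * real b * real c)"
      by (simp add: s_def mult.assoc)
  qed
qed

end

theorem theorem3p7:
  fixes M :: "'w measure" and F :: "nat \<Rightarrow> 'w measure"
    and a b c d \<alpha> \<beta> :: nat
    and \<epsilon> :: "nat \<Rightarrow> 'w \<Rightarrow> real" and U :: "nat \<Rightarrow> 'w \<Rightarrow> real^2"
    and S m \<sigma> :: real and v1 :: "real^2"
  assumes urn: "balanced_polya_urn M F a b c d \<alpha> \<beta> \<epsilon> U"
    and S: "S = real a + real b"
    and m: "m = real a - real c"
    and sigma: "\<sigma> = m / S"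
    and v1: "v1 = (S / (real b + real c)) *\<^sub>R vector [real c, real b]"
    and critically_small: "\<sigma> = 1 / 2"
    and bc: "b * c \<noteq> 0"
  shows
    "(AE \<omega> in M.
        (\<lambda>n. (1 / ln (ln (real n))) *\<^sub>R
           (\<Sum>k = 2..n. (1 / (real k * ln (real k))\<^sup>2) *\<^sub>R
              outer_square (U k \<omega> - real k *\<^sub>R v1)))
        \<longlonglongrightarrow> (real b * real c) *\<^sub>R vector [vector [1, -1], vector [-1, 1]])
     \<and> (AE \<omega> in M.
        (\<lambda>n. (1 / ln (ln (real n))) *
           (\<Sum>k = 2..n. (norm (U k \<omega> - real k *\<^sub>R v1))\<^sup>2 / (real k * ln (real k))\<^sup>2))
        \<longlonglongrightarrow> 2 * real b * real c)
     \<and> (AE \<omega> in M.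
        limsup (\<lambda>n. ereal ((norm (U n \<omega> - real n *\<^sub>R v1))\<^sup>2 /
           (2 * real n * ln (real n) * ln (ln (ln (real n))))))
        = ereal (2 * real b * real c))"
proof -
  interpret balanced_polya_urn M F a b c d \<alpha> \<beta> \<epsilon> U by (rule urn)
  have S0: "0 < S" unfolding S using balance_pos by linarith
  have "m = S / 2" using sigma critically_small S0 by (simp add: field_simps)
  hence "real a = real b + 2 * real c" unfolding S m by simp
  hence a: "a = b + 2 * c" by linarith
  interpret critical_urn M F a b c d \<alpha> \<beta> \<epsilon> U
    by unfold_locales (use a bc in auto)
  have ratio: "S / (real b + real c) = 2"
  proof -
    have "S = 2 * (real b + real c)" by (simp add: S a)
    moreover have "2 * x / x = 2" if "x \<noteq> 0" for x :: real using that by simp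
    moreover have "real b + real c \<noteq> 0" using bc by auto
    ultimately show ?thesis by blast
  qed
  have W1: "(U k \<omega> - real k *\<^sub>R v1) $ 1 = Z k \<omega> + shift" for k \<omega>
    by (simp add: v1 ratio Z_def)
  \<comment> \<open>The total is deterministic, so the second coordinate mirrors the first up to a
    constant. This produces the negative off-diagonal entries of the limit.\<close>
  have W2: "(U k \<omega> - real k *\<^sub>R v1) $ 2 = - (Z k \<omega> + (shift - \<tau>))" if "\<omega> \<in> space M" for k \<omega>
    using U_total[OF that, of k] by (simp add: v1 ratio Z_def critical_urn.m_def[OF critical_urn_axioms] algebra_simps)
  have nrm: "(norm (U k \<omega> - real k *\<^sub>R v1))\<^sup>2 = (Z k \<omega> + shift)\<^sup>2 + (Z k \<omega> + (shift - \<tau>))\<^sup>2"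
    if "\<omega> \<in> space M" for k \<omega>
  proof -
    have "(norm x)\<^sup>2 = (x $ 1)\<^sup>2 + (x $ 2)\<^sup>2" for x :: "real^2"
      by (simp add: norm_vec_def L2_set_def sum_2 add_nonneg_nonneg)
    thus ?thesis using W1 W2[OF that] by (simp only: power2_minus)
  qed
  have QSL: "AE \<omega> in M. (\<lambda>n. (1 / ln (ln (real n))) *\<^sub>R
           (\<Sum>k = 2..n. (1 / (real k * ln (real k))\<^sup>2) *\<^sub>R
              outer_square (U k \<omega> - real k *\<^sub>R v1)))
        \<longlonglongrightarrow> (real b * real c) *\<^sub>R vector [vector [1, -1], vector [-1, 1]]"
    using Z_qsl_shifted AE_space
  proof eventually_elim
    case (elim \<omega>)
    note lim = elim(1)[rule_format]
    note W = W1 W2[OF elim(2)]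
    show ?case
    proof (intro vec_tendstoI)
      fix i j :: 2
      \<comment> \<open>The four entries use the shifts of their row and column; each factor from
        coordinate 2 contributes a minus sign, and on the diagonal the two signs cancel.\<close>
      have "i = 1 \<or> i = 2" "j = 1 \<or> j = 2" using exhaust_2 by auto
      thus "(\<lambda>n. ((1 / ln (ln (real n))) *\<^sub>R
           (\<Sum>k = 2..n. (1 / (real k * ln (real k))\<^sup>2) *\<^sub>R outer_square (U k \<omega> - real k *\<^sub>R v1))) $ i $ j)
        \<longlonglongrightarrow> ((real b * real c) *\<^sub>R vector [vector [1, -1], vector [-1, 1]] :: real^2^2) $ i $ j"
        using lim[of shift shift] tendsto_minus[OF lim[of shift "shift - \<tau>"]]
          tendsto_minus[OF lim[of "shift - \<tau>" shift]] lim[of "shift - \<tau>" "shift - \<tau>"]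
        by (elim disjE) (simp_all only: vector_scaleR_component sum_component outer_square_component W vector_2
          real_scaleR_def mult_minus_left mult_minus_right minus_minus sum_negf times_divide_eq_left mult_1_left
          minus_divide_left[symmetric] mult_1_right)
    qed
  qed
  have QSLn: "AE \<omega> in M. (\<lambda>n. (1 / ln (ln (real n))) *
           (\<Sum>k = 2..n. (norm (U k \<omega> - real k *\<^sub>R v1))\<^sup>2 / (real k * ln (real k))\<^sup>2))
        \<longlonglongrightarrow> 2 * real b * real c"
    using Z_qsl_shifted AE_space
  proof eventually_elim
    case (elim \<omega>)
    have "(\<lambda>n. (\<Sum>k=2..n. (Z k \<omega> + shift) * (Z k \<omega> + shift) / (real k * ln (real k))\<^sup>2) / ln (ln (real n)) +
       (\<Sum>k=2..n. (Z k \<omega> + (shift - \<tau>)) * (Z k \<omega> + (shift - \<tau>)) / (real k * ln (real k))\<^sup>2) / ln (ln (real n)))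
       \<longlonglongrightarrow> real b * real c + real b * real c"
      using elim(1) by (intro tendsto_add) blast+
    thus ?case
      by (simp add: nrm[OF elim(2)] power2_eq_square[of "Z _ _ + _"] add_divide_distrib sum.distrib mult.assoc)
  qed
  have LIL: "AE \<omega> in M. limsup (\<lambda>n. ereal ((norm (U n \<omega> - real n *\<^sub>R v1))\<^sup>2 /
           (2 * real n * ln (real n) * ln (ln (ln (real n)))))) = ereal (2 * real b * real c)"
    using Z_lil_shifted AE_space by eventually_elim (simp add: nrm)
  show ?thesis using QSL QSLn LIL by blast
qed

end
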